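(* Assume that $\mathbb{P}(\lim_{|t|\to\infty}|\boldsymbol Y_t|=0)=1$. Let $H:(\mathbb{R}^d)^{\mathbb{Z}}\to\mathbb{R}$ be a measurable, shift invariant, $1$-homogeneous functional, continuous on the injection of $(\mathbb{R}^d)^k$ into $\ell_0$ for every $k\ge1$, and such that $|H(\boldsymbol y)|\le C|\boldsymbol y|_1$ for a constant $C>0$ and all $\boldsymbol y\in(\mathbb{R}^d)^{\mathbb{Z}}$. Then, for $k\ge1$, $$b_{k+1}(H)-b_k(H)=\mathbb{E}\left[H_+^\alpha(\boldsymbol\Theta_{0,k})-H_+^\alpha(\boldsymbol\Theta_{1,k})\right].$$ Assume moreover that $|H(\boldsymbol x)-H(\boldsymbol y)|\le C|\boldsymbol x-\boldsymbol y|_1$ for all $\boldsymbol x,\boldsymbol y\in(\mathbb{R}^d)^{\mathbb{Z}}$. If $\alpha>1$ assume in addition that $$\mathbb{E}\left[\left(\sum_{j=0}^\infty|\boldsymbol\Theta_j|\right)^{\alpha-1}\right]<\infty .$$ Then $$\lim_{k\to\infty}\frac{b_k(H)}{k}=\mathbb{E}\left[H_+^\alpha(\boldsymbol\Theta_{0,\infty})-H_+^\alpha(\boldsymbol\Theta_{1,\infty})\right]=\vartheta\,\mathbb{E}[H_+^\alpha(\boldsymbol Q)] .$$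
   Context: Let $|\cdot|$ be an arbitrary norm on $\mathbb{R}^d$. Let $\{\boldsymbol X_j,j\in\mathbb{Z}\}$ be a stationary $\mathbb{R}^d$-valued time series which is regularly varying: for all integers $s\le t$ there is a non-zero Radon measure $\nu_{s,t}$ on $(\mathbb{R}^d)^{[s,t]}\setminus\{\boldsymbol 0\}$ such that $\mathbb{P}(u^{-1}(\boldsymbol X_s,\dots,\boldsymbol X_t)\in\cdot)/\mathbb{P}(|\boldsymbol X_0|>u)\to\nu_{s,t}$ vaguely as $u\to\infty$. Let $\alpha>0$ be its tail index. The tail process is the random sequence $\boldsymbol Y=\{\boldsymbol Y_j,j\in\mathbb{Z}\}$ with $\mathbb{P}(|\boldsymbol Y_0|>y)=y^{-\alpha}$ for $y\ge1$ and such that, for all $s\le t$, the law of $u^{-1}(\boldsymbol X_s,\dots,\boldsymbol X_t)$ conditionally on $|\boldsymbol X_0|>u$ converges weakly to that of $(\boldsymbol Y_s,\dots,\boldsymbol Y_t)$ as $u\to\infty$. The spectral tail process is $\boldsymbol\Theta_j=\boldsymbol Y_j/|\boldsymbol Y_0|$, $j\in\mathbb{Z}$; it is independent of $|\boldsymbol Y_0|$. The tail measure $\nu$ is the unique Borel measure on $(\mathbb{R}^d)^{\mathbb{Z}}$ (product topology) with $\nu(\{\boldsymbol 0\})=0$ and $\nu\circ p_{s,t}^{-1}=\nu_{s,t}$ on $(\mathbb{R}^d)^{[s,t]}\setminus\{\boldsymbol 0\}$ for all $s\le t$, where $p_{s,t}$ is the canonical projection. It is known that $\nu$ is $\sigma$-finite,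 shift invariant, satisfies $\nu(c\,\cdot)=c^{-\alpha}\nu$ for all $c>0$, and $\mathbb{E}[H(\boldsymbol Y)]=\int H(\boldsymbol y)\mathbf{1}\{|\boldsymbol y_0|>1\}\,\nu(\mathrm{d}\boldsymbol y)$ for every non negative measurable $H$. Notation: $|\boldsymbol x|_1=\sum_{j\in\mathbb{Z}}|\boldsymbol x_j|\in[0,\infty]$; $\ell_0=\{\boldsymbol x\in(\mathbb{R}^d)^{\mathbb{Z}}:\lim_{|j|\to\infty}|\boldsymbol x_j|=0\}$; $H_+=\max(H,0)$ and $H_+^\alpha(\boldsymbol x)=(H_+(\boldsymbol x))^\alpha$. For $-\infty\le s\le t\le\infty$, a vector $\boldsymbol x_{s,t}=(\boldsymbol x_s,\dots,\boldsymbol x_t)$ is identified with an element of $(\mathbb{R}^d)^{\mathbb{Z}}$ by completing it with zeros outside $[s,t]$ (in particular $(\mathbb{R}^d)^k$ is injected into $\ell_0$). $B$ is the backshift, $(B\boldsymbol x)_j=\boldsymbol x_{j-1}$; $H$ is shift invariant if $H(B\boldsymbol x)=H(\boldsymbol x)$ for all $\boldsymbol x$, and $1$-homogeneous if $H(t\boldsymbol x)=tH(\boldsymbol x)$ for all $\boldsymbol x$ and $t>0$. For $k\ge1$, $$b_k(H)=\lim_{x\to\infty}\frac{\mathbb{P}(H(\boldsymbol X_{1,k})>x)}{\mathbb{P}(|\boldsymbol X_0|>x)}=\nu(\{\boldsymbol y\in(\mathbb{R}^d)^{\mathbb{Z}}:H(\boldsymbol y_{1,k})>1\}),$$ where the limit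 exists and the equality holds by regular variation, homogeneity and continuous mapping. Also $\boldsymbol y^*_{s,t}=\max_{s\le i\le t}|\boldsymbol y_i|$ and $\boldsymbol y^*=\max_{i\in\mathbb{Z}}|\boldsymbol y_i|$ (understood as suprema in $[0,\infty]$). The candidate extremal index is $\vartheta=\mathbb{P}(\sup_{j\ge1}|\boldsymbol Y_j|\le1)$, which also equals $\mathbb{P}(\sup_{j\le-1}|\boldsymbol Y_j|\le1)$; when $\mathbb{P}(\lim_{|k|\to\infty}|\boldsymbol Y_k|=0)=1$, one has $\vartheta>0$. In that case $\boldsymbol Q=\{\boldsymbol Q_j,j\in\mathbb{Z}\}$ denotes a random sequence whose distribution is that of $(\boldsymbol Y^* )^{-1}\boldsymbol Y$ conditionally on $\boldsymbol Y^*_{-\infty,-1}\le1$. *)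

theory Defs
  imports "HOL-Probability.Probability"
begin

text \<open>
  Sequences \<open>\<int> \<rightarrow> \<real>\<^sup>d\<close> are elements of the type \<open>int \<Rightarrow> real ^ 'd\<close>, with the product topology of
  the library; \<open>borel\<close> on this type is the product \<open>\<sigma>\<close>-algebra. A random sequence is a Borel
  random variable with values in this type.
\<close>

definition is_norm :: "('a::real_vector \<Rightarrow> real) \<Rightarrow> bool" where
  "is_norm N \<longleftrightarrow>
     (\<forall>x. 0 \<le> N x) \<and> (\<forall>x. N x = 0 \<longleftrightarrow> x = 0) \<and>
     (\<forall>c x. N (c *\<^sub>R x) = \<bar>c\<bar> * N x) \<and> (\<forall>x y. N (x + y) \<le> N x + N y)"

definition scale_seq :: "real \<Rightarrow> (int \<Rightarrow> 'a::real_vector) \<Rightarrow> (int \<Rightarrow> 'a)" where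
  "scale_seq c x = (\<lambda>j. c *\<^sub>R x j)"

definition backshift :: "(int \<Rightarrow> 'a) \<Rightarrow> (int \<Rightarrow> 'a)" where
  "backshift x = (\<lambda>j. x (j - 1))"

text \<open>
  \<open>window {s..t} x\<close> is \<open>x\<^bsub>s,t\<^esub>\<close> completed by zeros. Thus \<open>block {s..t}\<close> is the image of
  \<open>(\<real>\<^sup>d)\<^bsup>[s,t]\<^esup>\<close> in the space of all sequences, and the subspace topology of \<open>block {s..t}\<close> is the
  usual topology of that finite-dimensional space.
\<close>

definition window :: "int set \<Rightarrow> (int \<Rightarrow> 'a::zero) \<Rightarrow> (int \<Rightarrow> 'a)" where
  "window S x = (\<lambda>j. if j \<in> S then x j else 0)"

definition block :: "int set \<Rightarrow> (int \<Rightarrow> 'a::zero) set" where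
  "block S = {x. \<forall>j. j \<notin> S \<longrightarrow> x j = 0}"

definition punctured_block :: "int set \<Rightarrow> (int \<Rightarrow> 'a::zero) set" where
  "punctured_block S = block S - {\<lambda>_. 0}"

definition l1_norm :: "('a \<Rightarrow> real) \<Rightarrow> (int \<Rightarrow> 'a) \<Rightarrow> ennreal" where
  "l1_norm N x = (\<Sum>\<^sub>\<infinity>j\<in>UNIV. ennreal (N (x j)))"

definition sup_norm_on :: "int set \<Rightarrow> ('a \<Rightarrow> real) \<Rightarrow> (int \<Rightarrow> 'a) \<Rightarrow> ennreal" where
  "sup_norm_on S N x = (SUP j\<in>S. ennreal (N (x j)))"

definition ell0 :: "('a \<Rightarrow> real) \<Rightarrow> (int \<Rightarrow> 'a) set" where
  "ell0 N = {x. ((\<lambda>j. N (x j)) \<longlongrightarrow> 0) at_top \<and> ((\<lambda>j. N (x j)) \<longlongrightarrow> 0) at_bot}"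

text \<open>Only used for exponents \<open>a > 0\<close>, where \<open>\<infinity>\<^sup>a = \<infinity>\<close>.\<close>

definition ennreal_powr :: "ennreal \<Rightarrow> real \<Rightarrow> ennreal" where
  "ennreal_powr x a = (if x = \<infinity> then \<infinity> else ennreal (enn2real x powr a))"

definition stationary :: "'w measure \<Rightarrow> ('w \<Rightarrow> int \<Rightarrow> real ^ 'd) \<Rightarrow> bool" where
  "stationary M X \<longleftrightarrow> distr M borel (\<lambda>\<omega>. backshift (X \<omega>)) = distr M borel X"

text \<open>
  Measures on a Borel subset \<open>E\<close> are represented by Borel measures on the ambient space that do
  not charge the complement of \<open>E\<close>. The sets \<open>E\<close> of interest are locally compact and second
  countable, so Radon means finite on the compact subsets of \<open>E\<close>. The test functions for vague
  convergence are the continuous functions on \<open>E\<close> with compact support in \<open>E\<close>, extended by zero.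
\<close>

definition radon_on :: "'a::topological_space set \<Rightarrow> 'a measure \<Rightarrow> bool" where
  "radon_on E \<mu> \<longleftrightarrow>
     sets \<mu> = sets borel \<and> emeasure \<mu> (- E) = 0 \<and>
     (\<forall>K. compact K \<and> K \<subseteq> E \<longrightarrow> emeasure \<mu> K < \<infinity>)"

definition vaguely_on ::
  "'a::topological_space set \<Rightarrow> ('i \<Rightarrow> 'a measure) \<Rightarrow> 'a measure \<Rightarrow> 'i filter \<Rightarrow> bool" where
  "vaguely_on E \<mu> \<mu>' F \<longleftrightarrow>
     (\<forall>f :: 'a \<Rightarrow> real.
        continuous_on E f \<and> (\<exists>K. compact K \<and> K \<subseteq> E \<and> (\<forall>x. x \<notin> K \<longrightarrow> f x = 0)) \<longrightarrow>
        ((\<lambda>u. LINT x|\<mu> u. f x) \<longlongrightarrow> (LINT x|\<mu>'. f x)) F)"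

definition weakly ::
  "('i \<Rightarrow> 'a::topological_space measure) \<Rightarrow> 'a measure \<Rightarrow> 'i filter \<Rightarrow> bool" where
  "weakly \<mu> \<mu>' F \<longleftrightarrow>
     (\<forall>f :: 'a \<Rightarrow> real.
        continuous_on UNIV f \<and> bounded (range f) \<longrightarrow>
        ((\<lambda>u. LINT x|\<mu> u. f x) \<longlongrightarrow> (LINT x|\<mu>'. f x)) F)"

definition exceed ::
  "(real ^ 'd \<Rightarrow> real) \<Rightarrow> 'w measure \<Rightarrow> ('w \<Rightarrow> int \<Rightarrow> real ^ 'd) \<Rightarrow> real \<Rightarrow> 'w set" where
  "exceed N M X u = {\<omega> \<in> space M. N (X \<omega> 0) > u}"

definition regularly_varying ::
  "(real ^ 'd \<Rightarrow> real) \<Rightarrow> 'w measure \<Rightarrow> ('w \<Rightarrow> int \<Rightarrow> real ^ 'd) \<Rightarrow>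
   (int \<Rightarrow> int \<Rightarrow> (int \<Rightarrow> real ^ 'd) measure) \<Rightarrow> bool" where
  "regularly_varying N M X \<nu>fin \<longleftrightarrow>
     (\<forall>s t. s \<le> t \<longrightarrow>
        radon_on (punctured_block {s..t}) (\<nu>fin s t) \<and>
        emeasure (\<nu>fin s t) (punctured_block {s..t}) \<noteq> 0 \<and>
        vaguely_on (punctured_block {s..t})
          (\<lambda>u. scale_measure (ennreal (1 / measure M (exceed N M X u)))
                 (distr M borel (\<lambda>\<omega>. scale_seq (1 / u) (window {s..t} (X \<omega>)))))
          (\<nu>fin s t) at_top)"

definition tail_process ::
  "(real ^ 'd \<Rightarrow> real) \<Rightarrow> real \<Rightarrow> 'w measure \<Rightarrow> ('w \<Rightarrow> int \<Rightarrow> real ^ 'd) \<Rightarrow>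
   'v measure \<Rightarrow> ('v \<Rightarrow> int \<Rightarrow> real ^ 'd) \<Rightarrow> bool" where
  "tail_process N \<alpha> M X P Y \<longleftrightarrow>
     prob_space P \<and> Y \<in> borel_measurable P \<and>
     (\<forall>y\<ge>1. measure P {\<omega> \<in> space P. N (Y \<omega> 0) > y} = y powr (- \<alpha>)) \<and>
     (\<forall>s t. s \<le> t \<longrightarrow>
        weakly
          (\<lambda>u. distr (uniform_measure M (exceed N M X u)) borel
                 (\<lambda>\<omega>. scale_seq (1 / u) (window {s..t} (X \<omega>))))
          (distr P borel (\<lambda>\<omega>. window {s..t} (Y \<omega>))) at_top)"

definition spectral :: "(real ^ 'd \<Rightarrow> real) \<Rightarrow> (int \<Rightarrow> real ^ 'd) \<Rightarrow> (int \<Rightarrow> real ^ 'd)" where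
  "spectral N y = scale_seq (1 / N (y 0)) y"

definition tail_measure ::
  "(int \<Rightarrow> int \<Rightarrow> (int \<Rightarrow> real ^ 'd) measure) \<Rightarrow> (int \<Rightarrow> real ^ 'd) measure \<Rightarrow> bool" where
  "tail_measure \<nu>fin \<nu> \<longleftrightarrow>
     sets \<nu> = sets borel \<and> emeasure \<nu> {\<lambda>_. 0} = 0 \<and>
     (\<forall>s t. s \<le> t \<longrightarrow>
        (\<forall>A \<in> sets borel. A \<subseteq> punctured_block {s..t} \<longrightarrow>
           emeasure \<nu> (window {s..t} -` A) = emeasure (\<nu>fin s t) A))"

definition ext_index ::
  "(real ^ 'd \<Rightarrow> real) \<Rightarrow> 'v measure \<Rightarrow> ('v \<Rightarrow> int \<Rightarrow> real ^ 'd) \<Rightarrow> real" where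
  "ext_index N P Y = measure P {\<omega> \<in> space P. sup_norm_on {1..} N (Y \<omega>) \<le> 1}"

text \<open>
  The supremum is almost surely finite when \<open>Y\<close> is almost surely in \<open>ell0\<close>, so that
  \<open>enn2real\<close> is harmless.
\<close>

definition conditional_spectral ::
  "(real ^ 'd \<Rightarrow> real) \<Rightarrow> 'v measure \<Rightarrow> ('v \<Rightarrow> int \<Rightarrow> real ^ 'd) \<Rightarrow>
   'q measure \<Rightarrow> ('q \<Rightarrow> int \<Rightarrow> real ^ 'd) \<Rightarrow> bool" where
  "conditional_spectral N P Y PQ Q \<longleftrightarrow>
     prob_space PQ \<and> Q \<in> borel_measurable PQ \<and>
     distr PQ borel Q =
       distr (uniform_measure P {\<omega> \<in> space P. sup_norm_on {..-1} N (Y \<omega>) \<le> 1}) borel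
         (\<lambda>\<omega>. scale_seq (1 / enn2real (sup_norm_on UNIV N (Y \<omega>))) (Y \<omega>))"

definition pos_powr :: "((int \<Rightarrow> 'a) \<Rightarrow> real) \<Rightarrow> real \<Rightarrow> (int \<Rightarrow> 'a) \<Rightarrow> real" where
  "pos_powr H \<alpha> x = max (H x) 0 powr \<alpha>"

definition tail_ratio ::
  "(real ^ 'd \<Rightarrow> real) \<Rightarrow> 'w measure \<Rightarrow> ('w \<Rightarrow> int \<Rightarrow> real ^ 'd) \<Rightarrow>
   ((int \<Rightarrow> real ^ 'd) \<Rightarrow> real) \<Rightarrow> nat \<Rightarrow> real \<Rightarrow> real" where
  "tail_ratio N M X H k x =
     measure M {\<omega> \<in> space M. H (window {1..int k} (X \<omega>)) > x} / measure M (exceed N M X x)"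

definition tail_const ::
  "(real ^ 'd \<Rightarrow> real) \<Rightarrow> 'w measure \<Rightarrow> ('w \<Rightarrow> int \<Rightarrow> real ^ 'd) \<Rightarrow>
   ((int \<Rightarrow> real ^ 'd) \<Rightarrow> real) \<Rightarrow> nat \<Rightarrow> real" where
  "tail_const N M X H k = Lim at_top (tail_ratio N M X H k)"

end

theory Submission
  imports Defs
begin

text \<open>
  All formulas are read off the tail measure \<open>\<nu>\<close>. On \<open>{|y\<^sub>j| > \<epsilon>}\<close> it is finite: it is
  \<open>\<epsilon>\<^bsup>-\<alpha>\<^esup>\<close> times the law of \<open>\<epsilon> B\<^sup>j Y\<close> (\<open>tail_measure_restrict\<close>), because both measures are limits of the
  laws of \<open>X / u\<close> divided by \<open>P(|X\<^sub>0| > u)\<close>, one by vague convergence and the other by the definition of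
  \<open>Y\<close> after a shift of the stationary series. Comparing two levels \<open>\<epsilon>\<close> shows that \<open>|Y\<^sub>0|\<close> and \<open>\<Theta>\<close> are
  independent. Hence on \<open>{y\<^sub>0 \<noteq> 0}\<close> the measure \<open>\<nu>\<close> is the image of \<open>\<alpha> r\<^bsup>-\<alpha>-1\<^esup> dr\<close> times the law of \<open>\<Theta>\<close>
  under \<open>(r, \<theta>) \<mapsto> r \<theta>\<close> (\<open>tail_measure_polar\<close>).

  Increments. By \<open>tail_functional\<close> the tail ratios of \<open>H(X\<^bsub>s,t\<^esub>)\<close> converge to \<open>\<nu>{H(y\<^bsub>s,t\<^esub>) > 1}\<close>, and
  stationarity of \<open>X\<close> makes this limit depend on \<open>t - s\<close> only. So \<open>b\<^bsub>k+1\<^esub> - b\<^sub>k\<close> is the difference of the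
  \<open>\<nu>\<close>-masses of \<open>{H(y\<^bsub>0,k\<^esub>) > 1}\<close> and \<open>{H(y\<^bsub>1,k\<^esub>) > 1}\<close>. These events coincide where \<open>y\<^sub>0 = 0\<close>; elsewhere
  the polar form turns their masses into \<open>E H\<^sub>+\<^sup>\<alpha>(\<Theta>\<^bsub>0,k\<^esub>)\<close> and \<open>E H\<^sub>+\<^sup>\<alpha>(\<Theta>\<^bsub>1,k\<^esub>)\<close> (\<open>block_increment\<close>).

  Limit. \<open>b\<^sub>k / k\<close> is a Cesaro mean of increments, and the increments converge to \<open>E g(\<Theta>)\<close> with
  \<open>g(y) = H\<^sub>+\<^sup>\<alpha>(y\<^bsub>0,\<infinity>\<^esub>) - H\<^sub>+\<^sup>\<alpha>(y\<^bsub>1,\<infinity>\<^esub>)\<close> by dominated convergence: the Lipschitz property bounds them by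
  a constant if \<open>\<alpha> \<le> 1\<close> and by a multiple of \<open>(\<Sum>\<^bsub>j\<ge>0\<^esub> |\<Theta>\<^sub>j|)\<^bsup>\<alpha>-1\<^esup>\<close> if \<open>\<alpha> > 1\<close>.

  Identification. If \<open>G \<ge> 0\<close> is \<open>\<alpha>\<close>-homogeneous and vanishes where \<open>y\<^sub>0 = 0\<close>, then
  \<open>E G(\<Theta>) = \<theta> E \<Sum>\<^sub>j G(B\<^sup>j Q)\<close> (\<open>mass_transport\<close>): decompose \<open>{y\<^sup>* > 1}\<close> according to the time of the
  first exceedance of \<open>1\<close>; seen from that time the sequence is \<open>Y\<close> with no earlier exceedance, that
  is, a multiple of \<open>Q\<close>. For \<open>G\<close> the positive and the negative part of \<open>g\<close>, the sum over \<open>j\<close> telescopes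
  to \<open>H\<^sub>+\<^sup>\<alpha>(Q)\<close> (\<open>sum_gain\<close>). The telescoping uses that \<open>Q\<close> is almost surely summable, which is again a
  consequence of \<open>mass_transport\<close> for suitable \<open>G\<close> (\<open>AE_Q_l1\<close>).
\<close>

section \<open>Norms and operations on sequences\<close>

lemma norm_sum_le:
  fixes f :: "'i \<Rightarrow> 'a::real_vector"
  assumes "is_norm N" "finite A"
  shows "N (\<Sum>i\<in>A. f i) \<le> (\<Sum>i\<in>A. N (f i))"
  using assms(2)
proof (induction A rule: finite_induct)
  case empty
  then show ?case using assms(1) by (metis is_norm_def order_refl sum.empty)
next
  case (insert x F)
  then show ?case using assms(1) unfolding is_norm_def
    by (smt (verit, ccfv_SIG) sum.insert)
qed

lemma norm_le_euclidean:
  fixes N :: "real ^ 'd \<Rightarrow> real"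
  assumes "is_norm N"
  obtains K where "K > 0" "\<And>x. N x \<le> K * norm x"
proof -
  define K where "K = (\<Sum>i\<in>UNIV. N (axis i 1)) + 1"
  have nn: "0 \<le> N v" for v using assms by (simp add: is_norm_def)
  have "K > 0" unfolding K_def using nn by (simp add: add_nonneg_pos sum_nonneg)
  moreover have "N x \<le> K * norm x" for x
  proof -
    have "N x = N (\<Sum>i\<in>UNIV. x $ i *\<^sub>R axis i 1)"
      by (subst basis_expansion[symmetric]) (simp add: scalar_mult_eq_scaleR)
    also have "\<dots> \<le> (\<Sum>i\<in>UNIV. N (x $ i *\<^sub>R axis i 1))"
      by (rule norm_sum_le[OF assms]) simp
    also have "\<dots> = (\<Sum>i\<in>UNIV. \<bar>x $ i\<bar> * N (axis i 1))"
      using assms by (simp add: is_norm_def)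
    also have "\<dots> \<le> (\<Sum>i\<in>UNIV. norm x * N (axis i 1))"
      by (intro sum_mono mult_right_mono component_le_norm_cart nn)
    also have "\<dots> \<le> K * norm x"
      by (simp add: K_def sum_distrib_left algebra_simps)
    finally show ?thesis .
  qed
  ultimately show ?thesis using that by blast
qed

lemma continuous_on_is_norm:
  fixes N :: "real ^ 'd \<Rightarrow> real"
  assumes "is_norm N"
  shows "continuous_on UNIV N"
proof -
  obtain K where K: "K > 0" "\<And>x. N x \<le> K * norm x" using norm_le_euclidean[OF assms] by blast
  have tri: "N (x + y) \<le> N x + N y" for x y using assms by (simp add: is_norm_def)
  have neg: "N (- x) = N x" for x
    using assms unfolding is_norm_def by (metis abs_minus_cancel abs_one mult_1 scaleR_minus1_left)
  have "\<bar>N x - N y\<bar> \<le> K * norm (x - y)" for x y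
    using tri[of "x - y" y] tri[of "y - x" x] K(2)[of "x - y"] neg[of "x - y"] by auto
  then have "K-lipschitz_on UNIV N"
    using K by (intro lipschitz_onI) (auto simp: dist_real_def dist_norm)
  then show ?thesis by (rule lipschitz_on_continuous_on)
qed

lemma compact_norm_ball:
  fixes N :: "real ^ 'd \<Rightarrow> real"
  assumes "is_norm N"
  shows "compact {v. N v \<le> c}"
proof -
  have cont: "continuous_on UNIV N" by (rule continuous_on_is_norm[OF assms])
  have "sphere (0::real^'d) 1 \<noteq> {}" by simp
  then obtain v where v: "v \<in> sphere 0 1" "\<And>w. w \<in> sphere 0 1 \<Longrightarrow> N v \<le> N w"
    using continuous_attains_inf[of "sphere (0::real^'d) 1" N] continuous_on_subset[OF cont]
    by (metis compact_sphere subset_UNIV)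
  have "v \<noteq> 0" using v(1) by auto
  then have pos: "N v > 0" using assms unfolding is_norm_def by (metis order_le_less)
  have low: "N v * norm x \<le> N x" for x
  proof (cases "x = 0")
    case False
    have "N v \<le> N ((1 / norm x) *\<^sub>R x)" using False by (intro v(2)) simp
    also have "\<dots> = N x / norm x" using assms by (simp add: is_norm_def)
    finally show ?thesis using False by (simp add: field_simps)
  qed (use assms in \<open>simp add: is_norm_def\<close>)
  have "bounded {v. N v \<le> c}"
  proof (rule boundedI)
    fix x assume "x \<in> {v. N v \<le> c}"
    then show "norm x \<le> c / N v" using low[of x] pos by (simp add: field_simps)
  qed
  moreover have "closed {v. N v \<le> c}"
    using closed_Collect_le[OF cont continuous_on_const] by simp
  ultimately show ?thesis by (simp add: compact_eq_bounded_closed)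
qed

definition shift :: "int \<Rightarrow> (int \<Rightarrow> 'a) \<Rightarrow> (int \<Rightarrow> 'a)" where
  "shift j x = (\<lambda>i. x (i - j))"

lemma shift_0 [simp]: "shift 0 x = x" by (simp add: shift_def)
lemma shift_shift [simp]: "shift i (shift j x) = shift (i + j) x"
  by (simp add: shift_def algebra_simps)
lemma shift_nth [simp]: "shift j x i = x (i - j)" by (simp add: shift_def)
lemma scale_seq_nth [simp]: "scale_seq c x i = c *\<^sub>R x i" by (simp add: scale_seq_def)
lemma scale_seq_scale_seq [simp]: "scale_seq a (scale_seq b x) = scale_seq (a * b) x"
  by (simp add: scale_seq_def)
lemma scale_seq_1 [simp]: "scale_seq 1 x = x" by (simp add: scale_seq_def)
lemma shift_scale_seq: "shift j (scale_seq c x) = scale_seq c (shift j x)"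
  by (simp add: scale_seq_def shift_def)
lemma window_nth: "window S x j = (if j \<in> S then x j else 0)" by (simp add: window_def)
lemma window_scale_seq: "window S (scale_seq c x) = scale_seq c (window S x)"
  by (auto simp: scale_seq_def window_def)
lemma window_window: "window S (window T x) = window (S \<inter> T) x"
  by (auto simp: window_def)
lemma window_shift: "window S (shift j x) = shift j (window {i. i + j \<in> S} x)"
  by (auto simp: window_def shift_def fun_eq_iff)
lemma window_block: "window S x \<in> block S" by (simp add: window_def block_def)

lemma borel_measurable_window [measurable (raw)]:
  fixes f :: "'w \<Rightarrow> int \<Rightarrow> 'a::{second_countable_topology, zero}"
  assumes [measurable]: "f \<in> borel_measurable M"
  shows "(\<lambda>w. window S (f w)) \<in> borel_measurable M"
proof (rule measurable_coordinatewise_then_product)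
  fix i show "(\<lambda>x. window S (f x) i) \<in> borel_measurable M"
    using measurable_product_then_coordinatewise[OF assms, of i]
    by (cases "i \<in> S") (simp_all add: window_def)
qed

lemma borel_measurable_shift [measurable (raw)]:
  fixes f :: "'w \<Rightarrow> int \<Rightarrow> 'a::second_countable_topology"
  assumes [measurable]: "f \<in> borel_measurable M"
  shows "(\<lambda>w. shift j (f w)) \<in> borel_measurable M"
  by (rule measurable_coordinatewise_then_product)
     (use measurable_product_then_coordinatewise[OF assms] in simp)

lemma borel_measurable_scale_seq [measurable (raw)]:
  fixes f :: "'w \<Rightarrow> int \<Rightarrow> 'a::{second_countable_topology, real_normed_vector}"
  assumes [measurable]: "f \<in> borel_measurable M" and [measurable]: "c \<in> borel_measurable M"
  shows "(\<lambda>w. scale_seq (c w) (f w)) \<in> borel_measurable M"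
proof (rule measurable_coordinatewise_then_product)
  fix i
  note [measurable] = measurable_product_then_coordinatewise[OF assms(1), of i]
  show "(\<lambda>x. scale_seq (c x) (f x) i) \<in> borel_measurable M" by simp
qed

lemma continuous_on_window:
  "continuous_on UNIV (window S :: (int \<Rightarrow> 'a::{topological_space, zero}) \<Rightarrow> _)"
proof (rule continuous_on_coordinatewise_then_product)
  fix i show "continuous_on UNIV (\<lambda>x::int \<Rightarrow> 'a. window S x i)"
    by (cases "i \<in> S") (simp_all add: window_def)
qed

lemma continuous_on_shift:
  "continuous_on UNIV (shift j :: (int \<Rightarrow> 'a::topological_space) \<Rightarrow> _)"
  by (rule continuous_on_coordinatewise_then_product) simp

lemma continuous_on_scale_seq:
  "continuous_on UNIV (scale_seq c :: (int \<Rightarrow> 'a::real_normed_vector) \<Rightarrow> _)"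
  by (rule continuous_on_coordinatewise_then_product)
     (simp add: continuous_on_scaleR)

lemma compact_Pi_UNIV:
  fixes B :: "'i \<Rightarrow> 'a::topological_space set"
  assumes "\<And>i. compact (B i)"
  shows "compact {x. \<forall>i. x i \<in> B i}"
proof -
  have "compactin (product_topology (\<lambda>i. euclidean) UNIV) (PiE UNIV B)"
    using assms by (subst compactin_PiE) auto
  then show ?thesis
    by (simp add: euclidean_product_topology PiE_def Pi_def extensional_def)
qed

lemma closed_block: "closed (block S :: (int \<Rightarrow> 'a::{t1_space, zero}) set)"
proof -
  have "block S = (\<Inter>j\<in>-S. {x :: int \<Rightarrow> 'a. x j \<in> {0}})" by (auto simp: block_def)
  also have "closed \<dots>"
  proof (intro closed_INT ballI)
    fix j :: int
    have "closed ((\<lambda>x::int \<Rightarrow> 'a. x j) -` {0})"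
      by (intro closed_vimage) simp_all
    then show "closed {x :: int \<Rightarrow> 'a. x j \<in> {0}}" by (simp add: vimage_def)
  qed
  finally show ?thesis .
qed

section \<open>Bounded continuous functions determine finite measures\<close>

definition ramp :: "real \<Rightarrow> real" where "ramp r = max 0 (min 1 r)"

lemma ramp_simps: "0 \<le> ramp r" "ramp r \<le> 1" "r \<le> 0 \<Longrightarrow> ramp r = 0" "1 \<le> r \<Longrightarrow> ramp r = 1"
  by (auto simp: ramp_def)
lemma ramp_mono: "r \<le> s \<Longrightarrow> ramp r \<le> ramp s" by (auto simp: ramp_def)
lemma continuous_on_ramp [continuous_intros]:
  "continuous_on S f \<Longrightarrow> continuous_on S (\<lambda>x. ramp (f x))"
  unfolding ramp_def by (intro continuous_intros)

lemma ramp_multiple_tendsto: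
  "(\<lambda>m. ramp (real m * r)) \<longlonglongrightarrow> indicator {0<..} r"
proof (cases "r > 0")
  case True
  obtain m0 where m0: "real m0 * r \<ge> 1" using True
    by (metis reals_Archimedean3 order_less_imp_le)
  have "\<forall>\<^sub>F m in sequentially. ramp (real m * r) = 1"
  proof (rule eventually_sequentiallyI[of m0])
    fix m assume "m0 \<le> m"
    then have "real m0 * r \<le> real m * r" using True by simp
    then show "ramp (real m * r) = 1" using m0 by (intro ramp_simps) simp
  qed
  then show ?thesis using True by (simp add: tendsto_eventually)
next
  case False
  then have "ramp (real m * r) = 0" for m by (intro ramp_simps) (simp add: mult_nonneg_nonpos)
  then show ?thesis using False by simp
qed

text \<open>
  The indicator of an open set \<open>U\<close> is the increasing limit of \<open>ramp (m * d x)\<close>, where \<open>d\<close> is the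
  distance to the complement of \<open>U\<close>.
\<close>

lemma finite_measure_eqI_continuous:
  fixes \<mu> \<mu>' :: "'a::metric_space measure"
  assumes sets: "sets \<mu> = sets borel" "sets \<mu>' = sets borel" and fin: "emeasure \<mu> UNIV < \<infinity>"
    and eq: "\<And>f :: 'a \<Rightarrow> real. continuous_on UNIV f \<Longrightarrow> (\<And>x. 0 \<le> f x) \<Longrightarrow> (\<And>x. f x \<le> 1) \<Longrightarrow>
      (\<integral>\<^sup>+x. ennreal (f x) \<partial>\<mu>) = (\<integral>\<^sup>+x. ennreal (f x) \<partial>\<mu>')"
  shows "\<mu> = \<mu>'"
proof (rule measure_eqI_generator_eq[where E="{U. open U}" and \<Omega>=UNIV and A="\<lambda>_. UNIV"])
  show "sets \<mu> = sigma_sets UNIV {U. open U}" "sets \<mu>' = sigma_sets UNIV {U. open U}"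
    using sets by (simp_all add: borel_def)
  fix U :: "'a set" assume "U \<in> {U. open U}"
  then have U: "open U" by simp
  \<comment> \<open>the distance to the empty set is \<open>0\<close> by convention, hence the case distinction\<close>
  define d where "d x = (if U = UNIV then 1 else infdist x (- U))" for x
  have d: "continuous_on UNIV d" unfolding d_def by (cases "U = UNIV") (auto intro: continuous_intros)
  have dpos: "indicator {0<..} (d x) = (indicator U x :: real)" for x
  proof (cases "U = UNIV")
    case False
    then have "d x = 0 \<longleftrightarrow> x \<in> - U" using U in_closed_iff_infdist_zero[of "- U" x]
      by (auto simp: d_def closed_Compl)
    moreover have "d x \<ge> 0" using False by (simp add: d_def infdist_nonneg)
    ultimately show ?thesis by (auto simp: indicator_def)
  qed (simp add: d_def)
  have d0: "d x \<ge> 0" for x by (simp add: d_def infdist_nonneg)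
  have conv: "(\<lambda>m. \<integral>\<^sup>+x. ennreal (ramp (real m * d x)) \<partial>m') \<longlonglongrightarrow> emeasure m' U"
    if m': "sets m' = sets borel" for m' :: "'a measure"
  proof -
    have [measurable]: "d \<in> borel_measurable borel" by (rule borel_measurable_continuous_onI[OF d])
    have [measurable]: "ramp \<in> borel_measurable borel"
      by (rule borel_measurable_continuous_onI) (intro continuous_intros)
    have [measurable_cong]: "sets m' = sets borel" by (rule m')
    have "(\<lambda>m. \<integral>\<^sup>+x. ennreal (ramp (real m * d x)) \<partial>m') \<longlonglongrightarrow> (\<integral>\<^sup>+x. ennreal (indicator U x) \<partial>m')"
    proof (rule nn_integral_LIMSEQ)
      show "incseq (\<lambda>m x. ennreal (ramp (real m * d x)))"
        using d0 by (intro incseq_SucI le_funI ennreal_leI ramp_mono) (simp add: mult_right_mono)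
      show "(\<lambda>m. ennreal (ramp (real m * d x))) \<longlonglongrightarrow> ennreal (indicator U x)" for x
        using ramp_multiple_tendsto[of "d x"] unfolding dpos by (intro tendsto_ennrealI)
    qed measurable
    also have "(\<integral>\<^sup>+x. ennreal (indicator U x) \<partial>m') = emeasure m' U"
      using U m' by (simp add: ennreal_indicator)
    finally show ?thesis .
  qed
  have "(\<lambda>m. \<integral>\<^sup>+x. ennreal (ramp (real m * d x)) \<partial>\<mu>) = (\<lambda>m. \<integral>\<^sup>+x. ennreal (ramp (real m * d x)) \<partial>\<mu>')"
    by (intro ext eq continuous_intros d) (auto simp: ramp_simps)
  then show "emeasure \<mu> U = emeasure \<mu>' U"
    using conv[OF sets(1)] conv[OF sets(2)] LIMSEQ_unique by metis
qed (use fin in \<open>auto simp: Int_stable_def\<close>)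

section \<open>Tails conditioned on an exceedance at time zero\<close>

text \<open>
  Replaces the portmanteau theorem below: indicators are squeezed between continuous test functions
  indexed by \<open>m\<close>, and the limit along \<open>F\<close> is taken for fixed \<open>m\<close>.
\<close>

lemma tendsto_sandwich_family:
  fixes f :: "'i \<Rightarrow> real"
  assumes "\<And>m. \<forall>\<^sub>F u in F. L m u \<le> f u" "\<And>m. \<forall>\<^sub>F u in F. f u \<le> U m u"
    and "\<And>m. (L m \<longlongrightarrow> l m) F" "\<And>m. (U m \<longlongrightarrow> r m) F"
    and "l \<longlonglongrightarrow> c" "r \<longlonglongrightarrow> c"
  shows "(f \<longlongrightarrow> c) F"
proof (rule order_tendstoI)
  fix a assume "a < c"
  then obtain m where "a < l m" using order_tendstoD(1)[OF assms(5)] eventually_happens sequentially_bot by blast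
  then have "\<forall>\<^sub>F u in F. a < L m u" using assms(3) order_tendstoD(1) by blast
  with assms(1)[of m] show "\<forall>\<^sub>F u in F. a < f u" by eventually_elim simp
next
  fix a assume "c < a"
  then obtain m where "r m < a" using order_tendstoD(2)[OF assms(6)] eventually_happens sequentially_bot by blast
  then have "\<forall>\<^sub>F u in F. U m u < a" using assms(4) order_tendstoD(2) by blast
  with assms(2)[of m] show "\<forall>\<^sub>F u in F. f u < a" by eventually_elim simp
qed

lemma integral_uniform_measure:
  fixes f :: "'a \<Rightarrow> real"
  assumes "finite_measure M" and [measurable]: "f \<in> borel_measurable M" "A \<in> sets M"
    and pos: "measure M A > 0"
  shows "(LINT x|uniform_measure M A. f x) = (LINT x|M. indicator A x * f x) / measure M A"
proof -
  interpret finite_measure M by fact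
  have "uniform_measure M A = density M (\<lambda>x. ennreal (indicator A x / measure M A))"
    unfolding uniform_measure_def using pos
    by (intro density_cong) (auto simp: emeasure_eq_measure divide_ennreal indicator_def simp flip: ennreal_1)
  then have "(LINT x|uniform_measure M A. f x) = (LINT x|M. (indicator A x / measure M A) * f x)"
    by (simp add: integral_real_density)
  then show ?thesis by (simp add: field_simps)
qed

locale tail_setting =
  fixes N :: "real ^ 'd \<Rightarrow> real" and \<alpha> :: real
    and M :: "'w measure" and X :: "'w \<Rightarrow> int \<Rightarrow> real ^ 'd"
    and P :: "'v measure" and Y :: "'v \<Rightarrow> int \<Rightarrow> real ^ 'd"
    and \<nu>fin :: "int \<Rightarrow> int \<Rightarrow> (int \<Rightarrow> real ^ 'd) measure"
    and \<nu> :: "(int \<Rightarrow> real ^ 'd) measure"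
  assumes norm: "is_norm N" and prob_M: "prob_space M" and X [measurable]: "X \<in> borel_measurable M"
    and stat: "stationary M X" and rv: "regularly_varying N M X \<nu>fin"
    and alpha: "\<alpha> > 0" and tail: "tail_process N \<alpha> M X P Y" and tailm: "tail_measure \<nu>fin \<nu>"
begin

sublocale M: prob_space M by (rule prob_M)
sublocale P: prob_space P using tail by (simp add: tail_process_def)

lemma Y [measurable]: "Y \<in> borel_measurable P" using tail by (simp add: tail_process_def)
lemma X_nth [measurable]: "(\<lambda>w. X w i) \<in> borel_measurable M"
  by (rule measurable_product_then_coordinatewise[OF X])
lemma Y_nth [measurable]: "(\<lambda>w. Y w i) \<in> borel_measurable P"
  by (rule measurable_product_then_coordinatewise[OF Y])

lemma cont_N: "continuous_on UNIV N" by (rule continuous_on_is_norm[OF norm])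
lemma meas_N [measurable]: "N \<in> borel_measurable borel"
  by (rule borel_measurable_continuous_onI[OF cont_N])
lemma N_nonneg [simp]: "0 \<le> N x" using norm by (simp add: is_norm_def)
lemma N_0 [simp]: "N 0 = 0" using norm by (metis is_norm_def)
lemma N_eq_0 [simp]: "N x = 0 \<longleftrightarrow> x = 0" using norm by (metis is_norm_def)
lemma N_scale: "N (c *\<^sub>R x) = \<bar>c\<bar> * N x" using norm by (simp add: is_norm_def)
lemma sets_\<nu> [measurable_cong]: "sets \<nu> = sets borel" using tailm by (simp add: tail_measure_def)

lemma distr_shift: "distr M borel (\<lambda>w. shift j (X w)) = distr M borel X"
proof -
  have up: "distr M borel (\<lambda>w. shift (int n) (X w)) = distr M borel X" for n
  proof (induction n)
    case (Suc n)
    have "distr M borel (\<lambda>w. shift (int (Suc n)) (X w))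
        = distr (distr M borel X) borel (\<lambda>x. shift (int (Suc n)) x)"
      by (subst distr_distr) (auto simp: comp_def)
    also have "\<dots> = distr (distr M borel (\<lambda>w. backshift (X w))) borel (shift (int n))"
    proof -
      have *: "backshift = (\<lambda>x::int \<Rightarrow> real^'d. shift 1 x)" by (auto simp: backshift_def shift_def)
      have "distr (distr M borel (\<lambda>w. backshift (X w))) borel (shift (int n))
        = distr M borel (\<lambda>w. shift (int (Suc n)) (X w))"
        unfolding * by (subst distr_distr) (auto simp: comp_def ac_simps)
      also have "\<dots> = distr (distr M borel X) borel (\<lambda>x. shift (int (Suc n)) x)"
        by (subst distr_distr) (auto simp: comp_def)
      finally show ?thesis ..
    qed
    also have "\<dots> = distr (distr M borel X) borel (shift (int n))"
      using stat by (simp add: stationary_def)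
    also have "\<dots> = distr M borel (\<lambda>w. shift (int n) (X w))"
      by (subst distr_distr) (auto simp: comp_def)
    finally show ?case unfolding Suc .
  qed simp
  show ?thesis
  proof (cases "j \<ge> 0")
    case True
    then show ?thesis using up[of "nat j"] by simp
  next
    case False
    have "distr M borel X = distr (distr M borel (\<lambda>w. shift (- j) (X w))) borel (shift j)"
      by (subst distr_distr) (auto simp: comp_def)
    also have "\<dots> = distr (distr M borel X) borel (shift j)" using up[of "nat (- j)"] False by simp
    also have "\<dots> = distr M borel (\<lambda>w. shift j (X w))"
      by (subst distr_distr) (auto simp: comp_def)
    finally show ?thesis ..
  qed
qed

lemma measure_shift:
  assumes [measurable]: "A \<in> sets borel"
  shows "measure M {w \<in> space M. shift j (X w) \<in> A} = measure M {w \<in> space M. X w \<in> A}"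
proof -
  have "measure (distr M borel (\<lambda>w. shift j (X w))) A = measure (distr M borel X) A"
    by (simp add: distr_shift)
  then show ?thesis by (simp add: measure_distr vimage_def Int_def conj_commute)
qed

lemma integral_shift:
  fixes f :: "_ \<Rightarrow> real"
  assumes [measurable]: "f \<in> borel_measurable borel"
  shows "(LINT w|M. f (shift j (X w))) = (LINT w|M. f (X w))"
proof -
  have "integral\<^sup>L (distr M borel (\<lambda>w. shift j (X w))) f = integral\<^sup>L (distr M borel X) f"
    by (simp add: distr_shift)
  then show ?thesis by (simp add: integral_distr)
qed

definition p :: "real \<Rightarrow> real" where "p u = measure M (exceed N M X u)"

lemma sets_exceed [measurable]: "exceed N M X u \<in> sets M"
  unfolding exceed_def by measurable

lemma p_antimono: "u \<le> v \<Longrightarrow> p v \<le> p u"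
  unfolding p_def by (intro M.finite_measure_mono) (auto simp: exceed_def)

lemma weak_tail:
  fixes f :: "_ \<Rightarrow> real"
  assumes "s \<le> t" "continuous_on UNIV f" "bounded (range f)"
  shows "((\<lambda>u. LINT w|uniform_measure M (exceed N M X u). f (scale_seq (1 / u) (window {s..t} (X w))))
     \<longlongrightarrow> (LINT w|P. f (window {s..t} (Y w)))) at_top"
proof -
  have [measurable]: "f \<in> borel_measurable borel" by (rule borel_measurable_continuous_onI[OF assms(2)])
  have "((\<lambda>u. LINT x|distr (uniform_measure M (exceed N M X u)) borel
                 (\<lambda>w. scale_seq (1 / u) (window {s..t} (X w))). f x)
     \<longlongrightarrow> (LINT x|distr P borel (\<lambda>w. window {s..t} (Y w)). f x)) at_top"
  proof -
    have "weakly (\<lambda>u. distr (uniform_measure M (exceed N M X u)) borel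
             (\<lambda>w. scale_seq (1 / u) (window {s..t} (X w))))
          (distr P borel (\<lambda>w. window {s..t} (Y w))) at_top"
      using tail assms(1) by (simp add: tail_process_def)
    from this[unfolded weakly_def, rule_format, of f] assms(2,3) show ?thesis by blast
  qed
  then show ?thesis by (simp add: integral_distr)
qed

text \<open>
  If \<open>P(|X\<^sub>0| > u) = 0\<close> for some \<open>u\<close>, then the conditional laws given \<open>|X\<^sub>0| > v\<close> are null measures for
  all \<open>v \<ge> u\<close> and cannot converge weakly to the probability law of \<open>Y\<close>.
\<close>

lemma p_pos: "p u > 0"
proof (rule ccontr)
  assume "\<not> p u > 0"
  then have "p u = 0" by (simp add: p_def zero_less_measure_iff)
  have z: "(LINT w|uniform_measure M (exceed N M X v). (1::real)) = 0" if "u \<le> v" for v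
  proof -
    have "p v = 0" using p_antimono[OF that] \<open>p u = 0\<close> by (simp add: p_def measure_le_0_iff)
    then have "emeasure M (exceed N M X v) = 0" by (simp add: p_def M.emeasure_eq_measure)
    then have "emeasure (uniform_measure M (exceed N M X v)) (space M) = 0"
    proof -
      have ae: "AE x in M. x \<notin> exceed N M X v"
        using \<open>emeasure M (exceed N M X v) = 0\<close> by (intro AE_not_in) (auto simp: null_sets_def)
      have "(\<integral>\<^sup>+x. indicator (exceed N M X v) x / emeasure M (exceed N M X v) * indicator (space M) x \<partial>M)
          = (\<integral>\<^sup>+x. 0 \<partial>M)"
        using ae by (intro nn_integral_cong_AE) (auto elim!: eventually_mono)
      then show ?thesis by (simp add: uniform_measure_def emeasure_density)
    qed
    then have "measure (uniform_measure M (exceed N M X v)) (space M) = 0" by (simp add: measure_def)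
    then show ?thesis by simp
  qed
  have "((\<lambda>v. LINT w|uniform_measure M (exceed N M X v). (1::real)) \<longlongrightarrow> (LINT w|P. 1)) at_top"
    using weak_tail[of 0 0 "\<lambda>_. 1"] by (simp add: image_constant_conv)
  moreover have "\<forall>\<^sub>F v in at_top. (LINT w|uniform_measure M (exceed N M X v). (1::real)) = 0"
    using z by (auto simp: eventually_at_top_linorder)
  ultimately have "((\<lambda>v::real. 0::real) \<longlongrightarrow> (LINT w|P. 1)) at_top"
    by (rule Lim_transform_eventually)
  then have "(LINT w|P. 1) = (0::real)" by (simp add: tendsto_const_iff)
  then show False by (simp add: P.prob_space)
qed

lemma exceedance_limit:
  fixes f :: "_ \<Rightarrow> real"
  assumes "s \<le> t" "continuous_on UNIV f" "bounded (range f)" "\<And>x. f (window {s..t} x) = f x"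
  shows "((\<lambda>u. (LINT w|M. indicator {u<..} (N (X w 0)) * f (scale_seq (1 / u) (X w))) / p u)
     \<longlongrightarrow> (LINT w|P. f (Y w))) at_top"
proof -
  have [measurable]: "f \<in> borel_measurable borel" by (rule borel_measurable_continuous_onI[OF assms(2)])
  have fs: "f (scale_seq c (window {s..t} x)) = f (scale_seq c x)" for c x
    using assms(4)[of "scale_seq c x"] by (simp add: window_scale_seq)
  have "(LINT w|uniform_measure M (exceed N M X u). f (scale_seq (1 / u) (window {s..t} (X w))))
     = (LINT w|M. indicator {u<..} (N (X w 0)) * f (scale_seq (1 / u) (X w))) / p u" for u
    unfolding fs p_def
    apply (subst integral_uniform_measure)
        apply (use p_pos[of u] in \<open>auto simp: p_def M.finite_measure_axioms\<close>)
    apply (auto simp: exceed_def indicator_def intro!: Bochner_Integration.integral_cong)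
    done
  with weak_tail[OF assms(1-3)] show ?thesis by (simp add: assms(4))
qed

lemma pareto_tail: "y \<ge> 1 \<Longrightarrow> measure P {w \<in> space P. N (Y w 0) > y} = y powr (- \<alpha>)"
  using tail by (simp add: tail_process_def)

text \<open>
  Regular variation of the tail of \<open>|X\<^sub>0|\<close> follows by testing the weak convergence to \<open>Y\<^sub>0\<close> with ramps
  around the level \<open>y\<close>: the distribution function of \<open>|Y\<^sub>0|\<close> is known and continuous at \<open>y\<close>.
\<close>

lemma p_ratio_ge1:
  assumes y: "y > 1"
  shows "((\<lambda>u. p (y * u) / p u) \<longlongrightarrow> y powr (-\<alpha>)) at_top"
proof -
  define g where "g a b x = ramp ((N (x 0) - a) / (b - a))" for a b :: real and x :: "int \<Rightarrow> real^'d"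
  have gc: "continuous_on UNIV (g a b)" if "a < b" for a b
    unfolding g_def using that
    by (intro continuous_intros continuous_on_compose2[OF cont_N]) auto
  have gm [measurable]: "g a b \<in> borel_measurable borel" if "a < b" for a b
    by (rule borel_measurable_continuous_onI[OF gc[OF that]])
  have g01: "0 \<le> g a b x" "g a b x \<le> 1" for a b x by (simp_all add: g_def ramp_simps)
  have g0: "N (x 0) \<le> a \<Longrightarrow> a < b \<Longrightarrow> g a b x = 0" for a b x
    by (auto simp: g_def divide_le_0_iff intro!: ramp_simps)
  have g1: "b \<le> N (x 0) \<Longrightarrow> a < b \<Longrightarrow> g a b x = 1" for a b x
    by (auto simp: g_def intro!: ramp_simps)
  have glim: "((\<lambda>u. (LINT w|M. indicator {u<..} (N (X w 0)) * g a b (scale_seq (1 / u) (X w))) / p u)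
     \<longlongrightarrow> (LINT w|P. g a b (Y w))) at_top" if "a < b" for a b
  proof (rule exceedance_limit[of 0 0])
    show "bounded (range (g a b))" using g01 by (intro boundedI[of _ 1]) auto
  qed (use gc[OF that] in \<open>auto simp: g_def window_nth\<close>)
  have ub: "(LINT w|P. g a b (Y w)) \<le> measure P {w \<in> space P. N (Y w 0) > a}" if "a < b" for a b
  proof -
    have "(LINT w|P. g a b (Y w)) \<le> (LINT w|P. indicator {w \<in> space P. N (Y w 0) > a} w)"
      using that g01 g0[OF _ that]
      by (intro integral_mono P.integrable_const_bound[where B=1]) (auto simp: indicator_def not_less)
    then show ?thesis by simp
  qed
  have lb: "measure P {w \<in> space P. N (Y w 0) > b} \<le> (LINT w|P. g a b (Y w))" if "a < b" for a b
  proof -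
    have "(LINT w|P. indicator {w \<in> space P. N (Y w 0) > b} w) \<le> (LINT w|P. g a b (Y w))"
      using that g01 g1[OF _ that]
      by (intro integral_mono P.integrable_const_bound[where B=1]) (auto simp: indicator_def)
    then show ?thesis by simp
  qed
  \<comment> \<open>half-width of the ramps, small enough to keep them above the level \<open>1\<close>\<close>
  define d where "d m = (y - 1) / (real m + 2)" for m
  have d: "d m > 0" "d m < y - 1" for m
  proof -
    show "d m > 0" using y by (simp add: d_def)
    have "(y - 1) * 1 < (y - 1) * (real m + 2)" using y by (intro mult_strict_left_mono) auto
    then show "d m < y - 1" by (simp add: d_def divide_less_eq)
  qed
  have dl: "d \<longlonglongrightarrow> 0" unfolding d_def by real_asymp
  have nX: "N (scale_seq (1 / u) x 0) = N (x 0) / u" if "u > 0" for x u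
    using that by (simp add: N_scale)
  have low: "(LINT w|M. indicator {u<..} (N (X w 0)) * g y b (scale_seq (1 / u) (X w))) / p u
      \<le> p (y * u) / p u" if "u > 0" "y < b" for u b
  proof -
    have "g y b (scale_seq (1 / u) x) = 0" if "N (x 0) \<le> u * y" for x
      using that \<open>u > 0\<close> \<open>y < b\<close> by (intro g0) (simp_all add: N_scale field_simps)
    then have "(LINT w|M. indicator {u<..} (N (X w 0)) * g y b (scale_seq (1 / u) (X w)))
       \<le> (LINT w|M. indicator (exceed N M X (y * u)) w)"
      using that g01 g0[OF _ that(2)]
      by (intro integral_mono M.integrable_const_bound[where B=1])
         (auto simp: indicator_def exceed_def not_less nX field_simps)
    then show ?thesis using p_pos[of u] unfolding p_def by (simp add: divide_right_mono)
  qed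
  have upp: "p (y * u) / p u \<le> (LINT w|M. indicator {u<..} (N (X w 0)) * g a y (scale_seq (1 / u) (X w))) / p u"
    if "u > 0" "a < y" for u a
  proof -
    have 1: "g a y (scale_seq (1 / u) x) = 1" if "y * u < N (x 0)" for x
      using that \<open>u > 0\<close> \<open>a < y\<close> by (intro g1) (simp_all add: N_scale field_simps)
    have 2: "u < r" if "y * u < r" for r
      using that mult_strict_right_mono[OF y \<open>u > 0\<close>] by simp
    have "(LINT w|M. indicator (exceed N M X (y * u)) w) \<le>
        (LINT w|M. indicator {u<..} (N (X w 0)) * g a y (scale_seq (1 / u) (X w)))"
      using g01 gm[OF that(2)] by (intro integral_mono M.integrable_const_bound[where B=1])
         (auto simp: indicator_def exceed_def 1 2)
    then show ?thesis using p_pos[of u] unfolding p_def by (simp add: divide_right_mono)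
  qed
  have evpos: "\<forall>\<^sub>F u in at_top. u > (0::real)" by (rule eventually_gt_at_top)
  have yd: "(LINT w|P. g y (y + d m) (Y w)) \<ge> (y + d m) powr (-\<alpha>)" "(LINT w|P. g y (y + d m) (Y w)) \<le> y powr (-\<alpha>)"
    "(LINT w|P. g (y - d m) y (Y w)) \<le> (y - d m) powr (-\<alpha>)" "(LINT w|P. g (y - d m) y (Y w)) \<ge> y powr (-\<alpha>)" for m
    using lb[of y "y + d m"] ub[of "y - d m" y] ub[of y "y + d m"] lb[of "y - d m" y] d[of m] y
    by (simp_all add: pareto_tail)
  have t1: "(\<lambda>m. (y + d m) powr (-\<alpha>)) \<longlonglongrightarrow> y powr (-\<alpha>)"
    using y tendsto_powr[OF tendsto_add[OF tendsto_const dl, of y] tendsto_const, of "-\<alpha>"] by simp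
  have t2: "(\<lambda>m. (y - d m) powr (-\<alpha>)) \<longlonglongrightarrow> y powr (-\<alpha>)"
    using y tendsto_powr[OF tendsto_diff[OF tendsto_const dl, of y] tendsto_const, of "-\<alpha>"] by simp
  show ?thesis
  proof (rule tendsto_sandwich_family[OF _ _ glim glim])
    show "y < y + d m" "y - d m < y" for m using d by auto
    show "\<forall>\<^sub>F u in at_top. (LINT w|M. indicator {u<..} (N (X w 0)) * g y (y + d m) (scale_seq (1 / u) (X w))) / p u
      \<le> p (y * u) / p u" for m
      using evpos by eventually_elim (rule low, use d in auto)
    show "\<forall>\<^sub>F u in at_top. p (y * u) / p u
      \<le> (LINT w|M. indicator {u<..} (N (X w 0)) * g (y - d m) y (scale_seq (1 / u) (X w))) / p u" for m
      using evpos by eventually_elim (rule upp, use d in auto)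
    show "(\<lambda>m. LINT w|P. g y (y + d m) (Y w)) \<longlonglongrightarrow> y powr - \<alpha>"
      by (rule tendsto_sandwich[OF _ _ t1 tendsto_const]) (use yd in auto)
    show "(\<lambda>m. LINT w|P. g (y - d m) y (Y w)) \<longlonglongrightarrow> y powr - \<alpha>"
      by (rule tendsto_sandwich[OF _ _ tendsto_const t2]) (use yd in auto)
  qed
qed

lemma p_ratio:
  assumes e: "e > 0"
  shows "((\<lambda>u. p (e * u) / p u) \<longlongrightarrow> e powr (-\<alpha>)) at_top"
proof -
  consider "e = 1" | "e > 1" | "e < 1" by linarith
  then show ?thesis
  proof cases
    case 1
    have "p u / p u = 1" for u using p_pos[of u] by simp
    then show ?thesis using 1 by simp
  next
    case 2
    then show ?thesis by (rule p_ratio_ge1)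
  next
    case 3
    have "((\<lambda>v. p ((1/e) * v) / p v) \<longlongrightarrow> (1/e) powr (-\<alpha>)) at_top"
      using e 3 by (intro p_ratio_ge1) simp
    then have "((\<lambda>u. p ((1/e) * (e * u)) / p (e * u)) \<longlongrightarrow> (1/e) powr (-\<alpha>)) at_top"
      by (rule filterlim_compose) (use e in \<open>real_asymp\<close>)
    then have "((\<lambda>u. inverse (p u / p (e * u))) \<longlongrightarrow> inverse ((1/e) powr (-\<alpha>))) at_top"
      using e by (intro tendsto_inverse) auto
    then show ?thesis using e by (simp add: powr_minus powr_divide)
  qed
qed

end

section \<open>The tail measure in terms of the tail process\<close>

context tail_setting
begin

text \<open>
  A shift by \<open>j\<close>, harmless by stationarity, moves the coordinate \<open>j\<close> to time \<open>0\<close>. Since \<open>f\<close> vanishes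
  unless \<open>|X\<^sub>0| > e u\<close> after the shift, one may condition on this event at the price of the factor
  \<open>p (e * u) / p u\<close>, which tends to \<open>e\<^bsup>-\<alpha>\<^esup>\<close>; the conditional law of \<open>X / u = e X / (e u)\<close> tends to
  the law of \<open>e Y\<close>.
\<close>

lemma tail_limit:
  fixes f :: "(int \<Rightarrow> real ^ 'd) \<Rightarrow> real"
  assumes st: "s \<le> t" and cont: "continuous_on UNIV f" and bdd: "bounded (range f)"
    and win: "\<And>x. f (window {s..t} x) = f x" and e: "e > 0" and van: "\<And>x. N (x j) \<le> e \<Longrightarrow> f x = 0"
  shows "((\<lambda>u. (LINT w|M. f (scale_seq (1 / u) (X w))) / p u)
     \<longlongrightarrow> e powr (-\<alpha>) * (LINT w|P. f (scale_seq e (shift j (Y w))))) at_top"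
proof -
  have [measurable]: "f \<in> borel_measurable borel" by (rule borel_measurable_continuous_onI[OF cont])
  define h where "h x = f (scale_seq e (shift j x))" for x
  define A where "A v = (LINT w|M. indicator {v<..} (N (X w 0)) * h (scale_seq (1 / v) (X w))) / p v" for v
  have "(A \<longlongrightarrow> (LINT w|P. h (Y w))) at_top"
    unfolding A_def
  proof (rule exceedance_limit[of "s - j" "t - j"])
    show "continuous_on UNIV h" unfolding h_def
      by (intro continuous_on_compose2[OF cont] continuous_on_compose2[OF continuous_on_scale_seq]
          continuous_on_shift) auto
    show "bounded (range h)" by (rule bounded_subset[OF bdd]) (auto simp: h_def)
    fix x :: "int \<Rightarrow> real ^ 'd"
    have "{i. i + j \<in> {s..t}} = {s - j..t - j}" by auto
    then have "window {s..t} (scale_seq e (shift j x)) = scale_seq e (shift j (window {s - j..t - j} x))"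
      using window_shift[of "{s..t}" j x] by (simp add: window_scale_seq)
    then show "h (window {s - j..t - j} x) = h x" unfolding h_def using win by metis
  qed (use st in simp)
  then have "((\<lambda>u. A (e * u)) \<longlongrightarrow> (LINT w|P. h (Y w))) at_top"
    by (rule filterlim_compose) (use e in real_asymp)
  then have "((\<lambda>u. p (e * u) / p u * A (e * u)) \<longlongrightarrow> e powr (-\<alpha>) * (LINT w|P. h (Y w))) at_top"
    by (intro tendsto_mult p_ratio e)
  moreover have "\<forall>\<^sub>F u in at_top. p (e * u) / p u * A (e * u) = (LINT w|M. f (scale_seq (1 / u) (X w))) / p u"
    using eventually_gt_at_top[of 0]
  proof eventually_elim
    case (elim u)
    have *: "indicator {e * u<..} (N (x 0)) * h (scale_seq (1 / (e * u)) x) = f (scale_seq (1 / u) (shift j x))"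
      for x
    proof (cases "e * u < N (x 0)")
      case True
      then show ?thesis using e elim by (simp add: h_def shift_scale_seq)
    next
      case False
      then have "f (scale_seq (1 / u) (shift j x)) = 0"
        using elim by (intro van) (simp add: N_scale field_simps)
      then show ?thesis using False by simp
    qed
    have "(LINT w|M. f (scale_seq (1 / u) (X w))) = (LINT w|M. f (scale_seq (1 / u) (shift j (X w))))"
      using integral_shift[of "\<lambda>x. f (scale_seq (1 / u) x)" j] by simp
    then show ?case using p_pos[of "e * u"] unfolding A_def * by simp
  qed
  ultimately show ?thesis unfolding h_def by (rule Lim_transform_eventually)
qed

lemma \<nu>fin:
  assumes "s \<le> t"
  shows "radon_on (punctured_block {s..t}) (\<nu>fin s t)"
    and "vaguely_on (punctured_block {s..t})
          (\<lambda>u. scale_measure (ennreal (1 / p u))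
                 (distr M borel (\<lambda>w. scale_seq (1 / u) (window {s..t} (X w)))))
          (\<nu>fin s t) at_top"
  using rv assms unfolding regularly_varying_def p_def by blast+

lemma sets_punctured_block [measurable]:
  "(punctured_block S :: (int \<Rightarrow> real ^ 'd) set) \<in> sets borel"
  unfolding punctured_block_def by (intro sets.Diff borel_closed closed_block) simp

text \<open>
  The projection of \<open>\<nu>\<close> may put infinite mass at \<open>0\<close>; a function that vanishes off the punctured
  block does not see it.
\<close>

lemma nn_integral_\<nu>fin:
  assumes st: "s \<le> t" and [measurable]: "f \<in> borel_measurable borel"
    and van: "\<And>x. x \<notin> punctured_block {s..t} \<Longrightarrow> f x = 0"
  shows "(\<integral>\<^sup>+x. f x \<partial>\<nu>fin s t) = (\<integral>\<^sup>+y. f (window {s..t} y) \<partial>\<nu>)"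
proof -
  let ?E = "punctured_block {s..t} :: (int \<Rightarrow> real ^ 'd) set"
  have sets [measurable_cong]: "sets (\<nu>fin s t) = sets borel" and null: "emeasure (\<nu>fin s t) (- ?E) = 0"
    using \<nu>fin(1)[OF st] by (auto simp: radon_on_def)
  have "\<nu>fin s t = density (distr \<nu> borel (window {s..t})) (indicator ?E)"
  proof (rule measure_eqI)
    fix A assume "A \<in> sets (\<nu>fin s t)"
    then have A [measurable]: "A \<in> sets borel" by (simp add: sets)
    have "emeasure (\<nu>fin s t) A = emeasure (\<nu>fin s t) (A \<inter> ?E)"
      using null by (intro emeasure_eq_AE AE_I[where N="- ?E"]) (auto simp: sets)
    also have "\<dots> = emeasure \<nu> (window {s..t} -` (A \<inter> ?E))"
      using tailm st unfolding tail_measure_def by (metis A Int_lower2 sets.Int sets_punctured_block)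
    also have "\<dots> = emeasure (distr \<nu> borel (window {s..t})) (A \<inter> ?E)"
      using sets_eq_imp_space_eq[OF sets_\<nu>] by (simp add: emeasure_distr)
    also have "\<dots> = emeasure (density (distr \<nu> borel (window {s..t})) (indicator ?E)) A"
      by (subst emeasure_density) (auto simp: nn_integral_indicator[symmetric] indicator_inter_arith ac_simps)
    finally show "emeasure (\<nu>fin s t) A = emeasure (density (distr \<nu> borel (window {s..t})) (indicator ?E)) A" .
  qed (simp add: sets)
  then have "(\<integral>\<^sup>+x. f x \<partial>\<nu>fin s t) = (\<integral>\<^sup>+y. indicator ?E (window {s..t} y) * f (window {s..t} y) \<partial>\<nu>)"
    by (simp add: nn_integral_density nn_integral_distr)
  also have "\<dots> = (\<integral>\<^sup>+y. f (window {s..t} y) \<partial>\<nu>)"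
    using van by (intro nn_integral_cong) (auto simp: indicator_def)
  finally show ?thesis .
qed

text \<open>
  Both sides are the limit of \<open>E f(X / u) / p u\<close>: the left one by vague convergence, which requires
  compact support in the punctured block (ensured by \<open>van\<close> near \<open>0\<close> and by \<open>big\<close> near infinity),
  the right one by \<open>tail_limit\<close>.
\<close>

lemma tail_measure_compact_test:
  fixes f :: "(int \<Rightarrow> real ^ 'd) \<Rightarrow> real"
  assumes st: "s \<le> t" and cont: "continuous_on UNIV f" and f01: "\<And>x. 0 \<le> f x" "\<And>x. f x \<le> 1"
    and win: "\<And>x. f (window {s..t} x) = f x" and e: "e > 0" and j: "j \<in> {s..t}"
    and van: "\<And>x. N (x j) \<le> e \<Longrightarrow> f x = 0" and big: "\<And>x i. i \<in> {s..t} \<Longrightarrow> N (x i) \<ge> c \<Longrightarrow> f x = 0"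
  shows "(\<integral>\<^sup>+y. ennreal (f y) \<partial>\<nu>) = ennreal (e powr (-\<alpha>)) * (\<integral>\<^sup>+w. ennreal (f (scale_seq e (shift j (Y w)))) \<partial>P)"
proof -
  have [measurable]: "f \<in> borel_measurable borel" by (rule borel_measurable_continuous_onI[OF cont])
  let ?E = "punctured_block {s..t} :: (int \<Rightarrow> real ^ 'd) set"
  let ?B = "block {s..t} :: (int \<Rightarrow> real ^ 'd) set"
  define g where "g x = indicator ?B x * f x" for x
  have [measurable]: "?B \<in> sets borel" by (rule borel_closed[OF closed_block])
  have [measurable]: "g \<in> borel_measurable borel" unfolding g_def by measurable
  have gw: "g (window {s..t} x) = f x" for x using win window_block[of "{s..t}" x] by (simp add: g_def)
  have g01: "0 \<le> g x" "g x \<le> 1" for x using f01 by (auto simp: g_def indicator_def)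
  define K where "K = {x. \<forall>i. x i \<in> (if i \<in> {s..t} then {v. N v \<le> c} else {0})} \<inter> {x. e \<le> N (x j)}"
  have "compact K" unfolding K_def
  proof (rule compact_Int_closed)
    show "compact {x. \<forall>i. x i \<in> (if i \<in> {s..t} then {v. N v \<le> c} else {0})}"
      by (rule compact_Pi_UNIV) (simp add: compact_norm_ball[OF norm])
    have "continuous_on UNIV (\<lambda>x. N (x j))" by (intro continuous_on_compose2[OF cont_N]) auto
    then show "closed {x. e \<le> N (x j)}" by (intro closed_Collect_le) auto
  qed
  have KE: "K \<subseteq> ?E"
  proof
    fix x assume x: "x \<in> K"
    then have "x j \<noteq> 0" using e by (auto simp: K_def)
    moreover have "x \<in> ?B" using x by (auto simp: K_def block_def split: if_splits)
    ultimately show "x \<in> ?E" by (auto simp: punctured_block_def fun_eq_iff)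
  qed
  have gK: "g x = 0" if "x \<notin> K" for x
  proof (rule ccontr)
    assume "g x \<noteq> 0"
    then have "x \<in> ?B" "f x \<noteq> 0" by (auto simp: g_def indicator_def split: if_splits)
    then have "N (x j) > e" "\<And>i. i \<in> {s..t} \<Longrightarrow> N (x i) < c" using van big by (meson not_less)+
    then have "x \<in> K" using \<open>x \<in> ?B\<close> by (auto simp: K_def block_def less_imp_le)
    with that show False by simp
  qed
  have gE0: "g x = 0" if "x \<notin> ?E" for x using that gK KE by blast
  have sets [measurable_cong]: "sets (\<nu>fin s t) = sets borel" and fin: "emeasure (\<nu>fin s t) K < \<infinity>"
    using \<nu>fin(1)[OF st] \<open>compact K\<close> KE by (auto simp: radon_on_def)
  have gE: "continuous_on ?E g"
  proof -
    have "continuous_on ?E f" using cont continuous_on_subset by blast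
    then show ?thesis
      by (rule continuous_on_cong[THEN iffD1, rotated -1]) (auto simp: g_def punctured_block_def)
  qed
  have "((\<lambda>u. LINT x|scale_measure (ennreal (1 / p u))
            (distr M borel (\<lambda>w. scale_seq (1 / u) (window {s..t} (X w)))). g x)
     \<longlongrightarrow> (LINT x|\<nu>fin s t. g x)) at_top"
    using \<nu>fin(2)[OF st] gE gK \<open>compact K\<close> KE unfolding vaguely_on_def by blast
  moreover have "(LINT x|scale_measure (ennreal (1 / p u))
            (distr M borel (\<lambda>w. scale_seq (1 / u) (window {s..t} (X w)))). g x)
      = (LINT w|M. f (scale_seq (1 / u) (X w))) / p u" for u
  proof -
    let ?D = "distr M borel (\<lambda>w. scale_seq (1 / u) (window {s..t} (X w)))"
    have "(LINT x|scale_measure (ennreal (1 / p u)) ?D. g x) = (1 / p u) * (LINT x|?D. g x)"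
      using p_pos[of u] g01
      by (subst (1 2) integral_eq_nn_integral) (auto simp: nn_integral_scale_measure enn2real_mult)
    also have "(LINT x|?D. g x) = (LINT w|M. g (scale_seq (1 / u) (window {s..t} (X w))))"
      by (simp add: integral_distr)
    also have "\<dots> = (LINT w|M. f (scale_seq (1 / u) (X w)))"
      by (simp add: gw flip: window_scale_seq)
    also have "1 / p u * \<dots> = \<dots> / p u" by simp
    finally show ?thesis .
  qed
  moreover have "((\<lambda>u. (LINT w|M. f (scale_seq (1 / u) (X w))) / p u)
     \<longlongrightarrow> e powr (-\<alpha>) * (LINT w|P. f (scale_seq e (shift j (Y w))))) at_top"
    using f01 by (intro tail_limit[OF st cont _ win e van] boundedI[of _ 1]) auto
  ultimately have eq: "(LINT x|\<nu>fin s t. g x) = e powr (-\<alpha>) * (LINT w|P. f (scale_seq e (shift j (Y w))))"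
    using tendsto_unique[of "at_top :: real filter"] by simp
  have "integrable (\<nu>fin s t) g"
  proof (rule integrableI_bounded_set[where A=K and B=1])
    show "AE x in \<nu>fin s t. x \<in> K \<longrightarrow> norm (g x) \<le> 1" using g01 by auto
    show "K \<in> sets (\<nu>fin s t)" using \<open>compact K\<close> by (simp add: sets borel_compact)
  qed (use fin gK in auto)
  then have "(\<integral>\<^sup>+x. ennreal (g x) \<partial>\<nu>fin s t) = ennreal (LINT x|\<nu>fin s t. g x)"
    using g01 by (intro nn_integral_eq_integral) auto
  also have "\<dots> = ennreal (e powr (-\<alpha>)) * (\<integral>\<^sup>+w. ennreal (f (scale_seq e (shift j (Y w)))) \<partial>P)"
    unfolding eq using f01
    by (subst nn_integral_eq_integral) (auto intro!: P.integrable_const_bound[where B=1] simp: ennreal_mult)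
  also have "(\<integral>\<^sup>+x. ennreal (g x) \<partial>\<nu>fin s t) = (\<integral>\<^sup>+y. ennreal (f y) \<partial>\<nu>)"
    using gE0 by (subst nn_integral_\<nu>fin[OF st]) (auto simp: gw)
  finally show ?thesis .
qed

text \<open>
  Increasing continuous cutoffs, at \<open>|x\<^sub>j| = e\<close> and at large values, remove the support condition.
  Monotone rather than dominated convergence is needed because the finiteness of \<open>\<nu>\<close> on
  \<open>{|y\<^sub>j| > e}\<close> is itself a consequence of this identity (take \<open>g = 1\<close>).
\<close>

lemma tail_measure_window_test:
  fixes g :: "(int \<Rightarrow> real ^ 'd) \<Rightarrow> real"
  assumes st: "s \<le> t" and cont: "continuous_on UNIV g" and g01: "\<And>x. 0 \<le> g x" "\<And>x. g x \<le> 1"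
    and win: "\<And>x. g (window {s..t} x) = g x" and e: "e > 0" and j: "j \<in> {s..t}"
  shows "(\<integral>\<^sup>+y. ennreal (g y) * indicator {e<..} (N (y j)) \<partial>\<nu>)
    = ennreal (e powr (-\<alpha>)) * (\<integral>\<^sup>+w. ennreal (g (scale_seq e (shift j (Y w)))) * indicator {e<..} (e * N (Y w 0)) \<partial>P)"
proof -
  have [measurable]: "g \<in> borel_measurable borel" by (rule borel_measurable_continuous_onI[OF cont])
  define f where "f m x = g x * ramp (real m * (N (x j) - e)) * ramp (real m + 1 - (\<Sum>i\<in>{s..t}. N (x i)))"
    for m and x :: "int \<Rightarrow> real ^ 'd"
  have cN: "continuous_on UNIV (\<lambda>x. N (x i))" for i by (intro continuous_on_compose2[OF cont_N]) auto
  have fc: "continuous_on UNIV (f m)" for m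
    unfolding f_def by (intro continuous_intros cont cN)
  have fm [measurable]: "f m \<in> borel_measurable borel" for m by (rule borel_measurable_continuous_onI[OF fc])
  have inc: "incseq (\<lambda>m. ennreal (f m x))" for x
  proof (intro incseq_SucI ennreal_leI)
    fix m
    have "ramp (real m * (N (x j) - e)) \<le> ramp (real (Suc m) * (N (x j) - e))"
    proof (cases "N (x j) \<le> e")
      case True
      then show ?thesis by (simp add: ramp_simps mult_nonneg_nonpos)
    next
      case False
      then show ?thesis by (intro ramp_mono mult_right_mono) auto
    qed
    then show "f m x \<le> f (Suc m) x" unfolding f_def
      by (intro mult_mono) (auto simp: g01 ramp_simps intro: ramp_mono)
  qed
  have lim: "(\<lambda>m. ennreal (f m x)) \<longlonglongrightarrow> ennreal (g x) * indicator {e<..} (N (x j))" for x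
  proof -
    have 1: "(\<lambda>m. ramp (real m + 1 - (\<Sum>i\<in>{s..t}. N (x i)))) \<longlonglongrightarrow> 1"
    proof (rule tendsto_eventually)
      obtain n where "(\<Sum>i\<in>{s..t}. N (x i)) \<le> real n" using real_arch_simple by blast
      then show "\<forall>\<^sub>F m in sequentially. ramp (real m + 1 - (\<Sum>i\<in>{s..t}. N (x i))) = 1"
        by (intro eventually_sequentiallyI[of n] ramp_simps) auto
    qed
    have "(\<lambda>m. f m x) \<longlonglongrightarrow> g x * indicator {0<..} (N (x j) - e) * 1" unfolding f_def
      by (intro tendsto_mult ramp_multiple_tendsto 1 tendsto_const)
    then have "(\<lambda>m. ennreal (f m x)) \<longlonglongrightarrow> ennreal (g x * indicator {0<..} (N (x j) - e) * 1)"
      by (rule tendsto_ennrealI)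
    then show ?thesis by (cases "e < N (x j)") simp_all
  qed
  have eq: "(\<integral>\<^sup>+y. ennreal (f m y) \<partial>\<nu>) = ennreal (e powr (-\<alpha>)) * (\<integral>\<^sup>+w. ennreal (f m (scale_seq e (shift j (Y w)))) \<partial>P)"
    for m
  proof (rule tail_measure_compact_test[OF st fc _ _ _ e j])
    fix x :: "int \<Rightarrow> real ^ 'd"
    show "0 \<le> f m x" by (simp add: f_def g01 ramp_simps)
    show "f m x \<le> 1" unfolding f_def
      by (intro mult_le_one) (auto simp: g01 ramp_simps)
    show "f m (window {s..t} x) = f m x" using j by (simp add: f_def win window_nth)
    show "f m x = 0" if "N (x j) \<le> e" using that by (simp add: f_def ramp_simps mult_nonneg_nonpos)
    show "f m x = 0" if "i \<in> {s..t}" "N (x i) \<ge> real m + 1" for i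
    proof -
      have "real m + 1 \<le> (\<Sum>i\<in>{s..t}. N (x i))"
        using member_le_sum[of i "{s..t}" "\<lambda>i. N (x i)"] that by auto
      then show ?thesis by (simp add: f_def ramp_simps)
    qed
  qed
  have "(\<lambda>m. \<integral>\<^sup>+y. ennreal (f m y) \<partial>\<nu>) \<longlonglongrightarrow> (\<integral>\<^sup>+y. ennreal (g y) * indicator {e<..} (N (y j)) \<partial>\<nu>)"
    using inc by (intro nn_integral_LIMSEQ lim) (auto simp: incseq_def le_fun_def)
  moreover have "(\<lambda>m. \<integral>\<^sup>+w. ennreal (f m (scale_seq e (shift j (Y w)))) \<partial>P) \<longlonglongrightarrow>
      (\<integral>\<^sup>+w. ennreal (g (scale_seq e (shift j (Y w)))) * indicator {e<..} (N (scale_seq e (shift j (Y w)) j)) \<partial>P)"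
    using inc by (intro nn_integral_LIMSEQ lim) (auto simp: incseq_def le_fun_def)
  then have "(\<lambda>m. ennreal (e powr (-\<alpha>)) * (\<integral>\<^sup>+w. ennreal (f m (scale_seq e (shift j (Y w)))) \<partial>P)) \<longlonglongrightarrow>
      ennreal (e powr (-\<alpha>)) * (\<integral>\<^sup>+w. ennreal (g (scale_seq e (shift j (Y w)))) * indicator {e<..} (N (scale_seq e (shift j (Y w)) j)) \<partial>P)"
    by (intro ennreal_tendsto_cmult) auto
  ultimately have "(\<integral>\<^sup>+y. ennreal (g y) * indicator {e<..} (N (y j)) \<partial>\<nu>) = ennreal (e powr (-\<alpha>)) *
     (\<integral>\<^sup>+w. ennreal (g (scale_seq e (shift j (Y w)))) * indicator {e<..} (N (scale_seq e (shift j (Y w)) j)) \<partial>P)"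
    unfolding eq by (rule LIMSEQ_unique)
  then show ?thesis using e by (simp add: N_scale)
qed

lemma AE_Y0: "AE w in P. N (Y w 0) > 1"
proof -
  have "measure P {w \<in> space P. N (Y w 0) > 1} = 1" using pareto_tail[of 1] by simp
  then show ?thesis by (subst (asm) P.prob_Collect_eq_1) auto
qed

lemma window_tendsto: "(\<lambda>n. window {- int n..int n} x) \<longlonglongrightarrow> x" for x :: "int \<Rightarrow> 'a::{topological_space, zero}"
proof -
  have "(\<lambda>n. window {- int n..int n} x i) \<longlonglongrightarrow> x i" for i
  proof (rule tendsto_eventually)
    show "\<forall>\<^sub>F n in sequentially. window {- int n..int n} x i = x i"
      by (intro eventually_sequentiallyI[of "nat \<bar>i\<bar>"]) (auto simp: window_nth)
  qed
  then have "limitin (product_topology (\<lambda>_. euclidean) UNIV) (\<lambda>n. window {- int n..int n} x) x sequentially"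
    by (simp add: limitin_componentwise)
  then show ?thesis by (simp add: euclidean_product_topology)
qed

text \<open>
  The windows over \<open>{-n..n}\<close> of a sequence converge to it in the product topology, so the identity
  for functions of finitely many coordinates extends to all bounded continuous functions, and these
  determine the two finite measures.
\<close>

theorem tail_measure_restrict:
  assumes e: "e > 0" and [measurable]: "f \<in> borel_measurable borel"
  shows "(\<integral>\<^sup>+y. f y * indicator {e<..} (N (y j)) \<partial>\<nu>)
    = ennreal (e powr (-\<alpha>)) * (\<integral>\<^sup>+w. f (scale_seq e (shift j (Y w))) \<partial>P)"
proof -
  define \<mu> where "\<mu> = density \<nu> (\<lambda>y. indicator {e<..} (N (y j)))"
  define \<mu>' where "\<mu>' = scale_measure (ennreal (e powr (-\<alpha>))) (distr P borel (\<lambda>w. scale_seq e (shift j (Y w))))"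
  have s1 [measurable_cong]: "sets \<mu> = sets borel" by (simp add: \<mu>_def sets_\<nu>)
  have s2 [measurable_cong]: "sets \<mu>' = sets borel" by (simp add: \<mu>'_def)
  have i1: "(\<integral>\<^sup>+y. f y \<partial>\<mu>) = (\<integral>\<^sup>+y. f y * indicator {e<..} (N (y j)) \<partial>\<nu>)"
    if [measurable]: "f \<in> borel_measurable borel" for f :: "_ \<Rightarrow> ennreal"
    unfolding \<mu>_def by (subst nn_integral_density) (auto simp: ac_simps)
  have i2: "(\<integral>\<^sup>+y. f y \<partial>\<mu>') = ennreal (e powr (-\<alpha>)) * (\<integral>\<^sup>+w. f (scale_seq e (shift j (Y w))) \<partial>P)"
    if [measurable]: "f \<in> borel_measurable borel" for f :: "_ \<Rightarrow> ennreal"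
    unfolding \<mu>'_def by (simp add: nn_integral_scale_measure nn_integral_distr)
  have win: "(\<integral>\<^sup>+y. ennreal (g (window {- int n..int n} y)) \<partial>\<mu>) = (\<integral>\<^sup>+y. ennreal (g (window {- int n..int n} y)) \<partial>\<mu>')"
    if g: "continuous_on UNIV g" "\<And>x. 0 \<le> g x" "\<And>x. g x \<le> 1" and n: "int n \<ge> \<bar>j\<bar>" for g n
  proof -
    have [measurable]: "g \<in> borel_measurable borel" by (rule borel_measurable_continuous_onI[OF g(1)])
    have cont: "continuous_on UNIV (\<lambda>y. g (window {- int n..int n} y))"
      by (intro continuous_on_compose2[OF g(1)] continuous_on_window) auto
    show ?thesis
      apply (subst i1, measurable)
      apply (subst i2, measurable)
      apply (subst tail_measure_window_test[OF _ cont _ _ _ e, of "- int n" "int n" j])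
      using g n apply (auto simp: window_window)
      apply (intro arg_cong2[where f="(*)"] refl nn_integral_cong_AE)
      using AE_Y0 by eventually_elim (use e in auto)
  qed
  have fin2: "emeasure \<mu>' UNIV < \<infinity>"
    using i2[of "\<lambda>_. 1"] P.emeasure_space_1 sets_eq_imp_space_eq[OF s2] by (simp add: ennreal_mult_less_top)
  have fin1: "emeasure \<mu> UNIV < \<infinity>"
  proof -
    have "(\<integral>\<^sup>+y. ennreal 1 \<partial>\<mu>) = (\<integral>\<^sup>+y. ennreal 1 \<partial>\<mu>')"
      by (rule win[of "\<lambda>_. 1" "nat \<bar>j\<bar>"]) auto
    then show ?thesis using fin2 sets_eq_imp_space_eq[OF s1] sets_eq_imp_space_eq[OF s2] by simp
  qed
  have "\<mu> = \<mu>'"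
  proof (rule finite_measure_eqI_continuous[OF s1 s2 fin1])
    fix g :: "(int \<Rightarrow> real ^ 'd) \<Rightarrow> real"
    assume g: "continuous_on UNIV g" "\<And>x. 0 \<le> g x" "\<And>x. g x \<le> 1"
    have [measurable]: "g \<in> borel_measurable borel" by (rule borel_measurable_continuous_onI[OF g(1)])
    have lim: "(\<lambda>n. \<integral>\<^sup>+y. ennreal (g (window {- int n..int n} y)) \<partial>m) \<longlonglongrightarrow> (\<integral>\<^sup>+y. ennreal (g y) \<partial>m)"
      if m [measurable_cong]: "sets m = sets borel" and "emeasure m UNIV < \<infinity>" for m
    proof (rule nn_integral_dominated_convergence[where w="\<lambda>_. 1"])
      show "AE y in m. (\<lambda>n. ennreal (g (window {- int n..int n} y))) \<longlonglongrightarrow> ennreal (g y)"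
        by (intro AE_I2 tendsto_ennrealI continuous_on_tendsto_compose[OF g(1) window_tendsto]) auto
    qed (use that g sets_eq_imp_space_eq[OF m] in auto)
    have "\<forall>\<^sub>F n in sequentially. (\<integral>\<^sup>+y. ennreal (g (window {- int n..int n} y)) \<partial>\<mu>)
        = (\<integral>\<^sup>+y. ennreal (g (window {- int n..int n} y)) \<partial>\<mu>')"
      by (intro eventually_sequentiallyI[of "nat \<bar>j\<bar>"] win g) auto
    then have "(\<lambda>n. \<integral>\<^sup>+y. ennreal (g (window {- int n..int n} y)) \<partial>\<mu>') \<longlonglongrightarrow> (\<integral>\<^sup>+y. ennreal (g y) \<partial>\<mu>)"
      by (rule Lim_transform_eventually[OF lim[OF s1 fin1]])
    with lim[OF s2 fin2] show "(\<integral>\<^sup>+y. ennreal (g y) \<partial>\<mu>) = (\<integral>\<^sup>+y. ennreal (g y) \<partial>\<mu>')"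
      using LIMSEQ_unique by blast
  qed
  then show ?thesis using i1[of f] i2[of f] assms(2) by simp
qed

end

section \<open>Polar decomposition of the tail measure\<close>

lemma nn_integral_eq_emeasure:
  assumes "{w \<in> space M. Q w} \<in> sets M" "\<And>w. w \<in> space M \<Longrightarrow> f w = (if Q w then 1 else 0)"
  shows "(\<integral>\<^sup>+w. f w \<partial>M) = emeasure M {w \<in> space M. Q w}"
proof -
  have "(\<integral>\<^sup>+w. f w \<partial>M) = (\<integral>\<^sup>+w. indicator {w \<in> space M. Q w} w \<partial>M)"
    using assms(2) by (intro nn_integral_cong) (auto simp: indicator_def)
  then show ?thesis using assms(1) by simp
qed

context tail_setting
begin

abbreviation \<Theta> :: "'v \<Rightarrow> int \<Rightarrow> real ^ 'd" where "\<Theta> w \<equiv> spectral N (Y w)"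

lemma borel_measurable_spectral [measurable]: "spectral N \<in> borel_measurable borel"
  unfolding spectral_def by measurable

lemma spectral_scale_seq: "c > 0 \<Longrightarrow> spectral N (scale_seq c y) = spectral N y"
  by (simp add: spectral_def N_scale)

lemma Y_eq: "N (Y w 0) > 1 \<Longrightarrow> scale_seq (N (Y w 0)) (\<Theta> w) = Y w"
  by (cases "Y w 0 = 0") (simp_all add: spectral_def)

lemma N_spectral_0: "N (y 0) > 0 \<Longrightarrow> N (spectral N y 0) = 1"
  by (cases "y 0 = 0") (simp_all add: spectral_def N_scale)

definition radius :: "real measure" where "radius = distr P borel (\<lambda>w. N (Y w 0))"

lemma sets_radius [measurable_cong, simp]: "sets radius = sets borel" by (simp add: radius_def)
lemma space_radius [simp]: "space radius = UNIV" by (simp add: radius_def)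
sublocale radius: prob_space radius unfolding radius_def by (rule P.prob_space_distr) measurable

lemma emeasure_radius_gt: "emeasure radius {r<..} = ennreal (if r \<ge> 1 then r powr (-\<alpha>) else 1)"
proof -
  have "emeasure radius {r<..} = ennreal (measure P {w \<in> space P. N (Y w 0) > r})"
    unfolding radius_def by (subst emeasure_distr) (auto simp: P.emeasure_eq_measure intro!: arg_cong[where f="measure P"])
  also have "measure P {w \<in> space P. N (Y w 0) > r} = (if r \<ge> 1 then r powr (-\<alpha>) else 1)"
  proof (cases "r \<ge> 1")
    case False
    have "measure P {w \<in> space P. N (Y w 0) > r} = 1"
      using AE_Y0 False by (subst P.prob_Collect_eq_1) (auto elim!: eventually_mono)
    then show ?thesis using False by simp
  qed (simp add: pareto_tail)
  finally show ?thesis .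
qed

text \<open>
  The event \<open>{|y\<^sub>0| > r, \<Theta> \<in> B}\<close> has the same \<open>\<nu>\<close>-mass whether \<open>\<nu>\<close> is described at level \<open>1\<close> or at
  level \<open>r\<close>. At level \<open>r\<close> the condition on \<open>|y\<^sub>0|\<close> disappears, since \<open>|Y\<^sub>0| > 1\<close> almost surely, and
  rescaling does not change the spectral part; this is the independence of radius and spectral part.
\<close>

lemma radius_spectral_gt:
  assumes [measurable]: "B \<in> sets borel"
  shows "emeasure P {w \<in> space P. N (Y w 0) > r \<and> \<Theta> w \<in> B}
    = emeasure radius {r<..} * emeasure P {w \<in> space P. \<Theta> w \<in> B}"
proof (cases "r \<ge> 1")
  case True
  define F where "F y = (indicator B (spectral N y) :: ennreal)" for y
  have [measurable]: "F \<in> borel_measurable borel" unfolding F_def by measurable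
  have "(\<integral>\<^sup>+w. F (Y w) * indicator {r<..} (N (Y w 0)) \<partial>P)
      = (\<integral>\<^sup>+y. (F y * indicator {r<..} (N (y 0))) * indicator {1<..} (N (y 0)) \<partial>\<nu>)"
    by (subst tail_measure_restrict) auto
  also have "\<dots> = (\<integral>\<^sup>+y. F y * indicator {r<..} (N (y 0)) \<partial>\<nu>)"
    using True by (intro nn_integral_cong) (auto simp: indicator_def)
  also have "\<dots> = ennreal (r powr (-\<alpha>)) * (\<integral>\<^sup>+w. F (Y w) \<partial>P)"
    using True by (subst tail_measure_restrict) (auto simp: F_def spectral_scale_seq)
  finally have *: "(\<integral>\<^sup>+w. F (Y w) * indicator {r<..} (N (Y w 0)) \<partial>P) = ennreal (r powr (-\<alpha>)) * (\<integral>\<^sup>+w. F (Y w) \<partial>P)" .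
  have "(\<integral>\<^sup>+w. F (Y w) * indicator {r<..} (N (Y w 0)) \<partial>P) = emeasure P {w \<in> space P. N (Y w 0) > r \<and> \<Theta> w \<in> B}"
    by (rule nn_integral_eq_emeasure) (auto simp: F_def)
  moreover have "(\<integral>\<^sup>+w. F (Y w) \<partial>P) = emeasure P {w \<in> space P. \<Theta> w \<in> B}"
    by (rule nn_integral_eq_emeasure) (auto simp: F_def)
  ultimately show ?thesis using * True by (simp add: emeasure_radius_gt)
next
  case False
  have "emeasure P {w \<in> space P. N (Y w 0) > r \<and> \<Theta> w \<in> B} = emeasure P {w \<in> space P. \<Theta> w \<in> B}"
    using AE_Y0 False by (intro emeasure_eq_AE) (auto elim!: eventually_mono)
  then show ?thesis using False by (simp add: emeasure_radius_gt)
qed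

lemma radius_spectral_indep:
  "radius \<Otimes>\<^sub>M distr P borel \<Theta> = distr P (borel \<Otimes>\<^sub>M borel) (\<lambda>w. (N (Y w 0), \<Theta> w))"
proof -
  interpret T: prob_space "distr P borel \<Theta>" by (rule P.prob_space_distr) measurable
  show ?thesis
  proof (rule pair_measure_eqI)
    fix A B assume "A \<in> sets radius" "B \<in> sets (distr P borel \<Theta>)"
    then have [measurable]: "A \<in> sets borel" "B \<in> sets borel" by simp_all
    define \<kappa> where "\<kappa> = distr (density P (\<lambda>w. indicator B (\<Theta> w))) borel (\<lambda>w. N (Y w 0))"
    have \<kappa>: "emeasure \<kappa> S = emeasure P {w \<in> space P. N (Y w 0) \<in> S \<and> \<Theta> w \<in> B}"
      if [measurable]: "S \<in> sets borel" for S
    proof -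
      have "emeasure \<kappa> S = (\<integral>\<^sup>+w. indicator B (\<Theta> w) * indicator ((\<lambda>w. N (Y w 0)) -` S \<inter> space P) w \<partial>P)"
        unfolding \<kappa>_def by (simp add: emeasure_distr emeasure_density)
      also have "\<dots> = (\<integral>\<^sup>+w. indicator {w \<in> space P. N (Y w 0) \<in> S \<and> \<Theta> w \<in> B} w \<partial>P)"
        by (intro nn_integral_cong) (auto simp: indicator_def)
      finally show ?thesis by simp
    qed
    have "\<kappa> = scale_measure (emeasure P {w \<in> space P. \<Theta> w \<in> B}) radius"
    proof (rule measure_eqI_lessThan)
      show "emeasure \<kappa> {x<..} < \<infinity>" for x by (simp add: \<kappa> P.emeasure_eq_measure)
      show "emeasure \<kappa> {x<..} = emeasure (scale_measure (emeasure P {w \<in> space P. \<Theta> w \<in> B}) radius) {x<..}" for x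
        using radius_spectral_gt[of B x] by (simp add: \<kappa> mult.commute)
    qed (simp_all add: \<kappa>_def)
    then have "emeasure P {w \<in> space P. N (Y w 0) \<in> A \<and> \<Theta> w \<in> B} = emeasure P {w \<in> space P. \<Theta> w \<in> B} * emeasure radius A"
      using \<kappa>[of A] by simp
    moreover have "emeasure (distr P borel \<Theta>) B = emeasure P {w \<in> space P. \<Theta> w \<in> B}"
      by (subst emeasure_distr) (auto intro!: arg_cong[where f="emeasure P"])
    moreover have "emeasure (distr P (borel \<Otimes>\<^sub>M borel) (\<lambda>w. (N (Y w 0), \<Theta> w))) (A \<times> B)
        = emeasure P {w \<in> space P. N (Y w 0) \<in> A \<and> \<Theta> w \<in> B}"
      by (subst emeasure_distr) (auto intro!: arg_cong[where f="emeasure P"])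
    ultimately show "emeasure radius A * emeasure (distr P borel \<Theta>) B
       = emeasure (distr P (borel \<Otimes>\<^sub>M borel) (\<lambda>w. (N (Y w 0), \<Theta> w))) (A \<times> B)"
      by (simp add: mult.commute)
  qed (simp_all add: radius.sigma_finite_measure_axioms T.sigma_finite_measure_axioms cong: sets_pair_measure_cong)
qed

lemma nn_integral_radius_spectral:
  assumes [measurable]: "f \<in> borel_measurable (borel \<Otimes>\<^sub>M borel)"
  shows "(\<integral>\<^sup>+w. f (N (Y w 0), \<Theta> w) \<partial>P) = (\<integral>\<^sup>+w. (\<integral>\<^sup>+r. f (r, \<Theta> w) \<partial>radius) \<partial>P)"
proof -
  interpret T: prob_space "distr P borel \<Theta>" by (rule P.prob_space_distr) measurable
  interpret pair_sigma_finite radius "distr P borel \<Theta>" ..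
  have [measurable]: "f \<in> borel_measurable (radius \<Otimes>\<^sub>M distr P borel \<Theta>)"
    using assms by (simp cong: measurable_cong_sets sets_pair_measure_cong)
  have "(\<integral>\<^sup>+w. f (N (Y w 0), \<Theta> w) \<partial>P) = integral\<^sup>N (radius \<Otimes>\<^sub>M distr P borel \<Theta>) f"
    unfolding radius_spectral_indep by (subst nn_integral_distr) auto
  also have "\<dots> = (\<integral>\<^sup>+\<theta>. (\<integral>\<^sup>+r. f (r, \<theta>) \<partial>radius) \<partial>distr P borel \<Theta>)"
    by (subst nn_integral_snd[symmetric]) auto
  also have "\<dots> = (\<integral>\<^sup>+w. (\<integral>\<^sup>+r. f (r, \<Theta> w) \<partial>radius) \<partial>P)"
    by (subst nn_integral_distr) auto
  finally show ?thesis .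
qed

lemma emeasure_radius_singleton: "emeasure radius {a} = 0"
proof (cases "a > 1")
  case False
  have "measure P {w \<in> space P. N (Y w 0) = a} = 0"
    using AE_Y0 False by (subst P.prob_Collect_eq_0) (auto elim!: eventually_mono)
  then have "emeasure P {w \<in> space P. N (Y w 0) = a} = 0" by (simp add: P.emeasure_eq_measure)
  then show ?thesis unfolding radius_def
    by (subst emeasure_distr) (auto simp: vimage_def Int_def conj_commute)
next
  case True
  define b where "b n = a - (a - 1) / (real n + 1)" for n
  have b: "1 \<le> b n" "b n < a" for n
  proof -
    have "(a - 1) / (real n + 1) \<le> (a - 1) / 1" using True by (intro divide_left_mono) auto
    then show "1 \<le> b n" "b n < a" using True by (simp_all add: b_def)
  qed
  have bl: "b \<longlonglongrightarrow> a" unfolding b_def by real_asymp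
  have "measure radius {a} \<le> b n powr (-\<alpha>) - a powr (-\<alpha>)" for n
  proof -
    have m: "measure radius {r<..} = r powr (-\<alpha>)" if "r \<ge> 1" for r
      using emeasure_radius_gt[of r] that by (simp add: radius.emeasure_eq_measure)
    have "measure radius {a} \<le> measure radius ({b n<..} - {a<..})"
      using b[of n] by (intro radius.finite_measure_mono) auto
    also have "\<dots> = b n powr (-\<alpha>) - a powr (-\<alpha>)"
      using b[of n] True by (subst radius.finite_measure_Diff) (auto simp: m)
    finally show ?thesis .
  qed
  moreover have "(\<lambda>n. b n powr (-\<alpha>) - a powr (-\<alpha>)) \<longlonglongrightarrow> 0"
    using True tendsto_diff[OF tendsto_powr[OF bl tendsto_const] tendsto_const, of "-\<alpha>" "a powr (-\<alpha>)"] by simp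
  ultimately have "measure radius {a} \<le> 0" by (intro LIMSEQ_le_const) auto
  then show ?thesis by (simp add: radius.emeasure_eq_measure measure_le_0_iff)
qed

text \<open>
  Given \<open>\<Theta>\<close>, the variable \<open>V(Y) = |Y\<^sub>0| V(\<Theta>)\<close> is a multiple of the radius, whose law has no atoms.
\<close>

lemma radius_null:
  fixes V :: "(int \<Rightarrow> real ^ 'd) \<Rightarrow> real"
  assumes [measurable]: "V \<in> borel_measurable borel" and hom: "\<And>c y. c > 0 \<Longrightarrow> V (scale_seq c y) = c * V y" and c: "c \<noteq> 0"
  shows "emeasure P {w \<in> space P. V (Y w) = c} = 0"
proof -
  have "emeasure P {w \<in> space P. V (Y w) = c} = emeasure P {w \<in> space P. N (Y w 0) * V (\<Theta> w) = c}"
  proof (rule emeasure_eq_AE)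
    show "AE w in P. (w \<in> {w \<in> space P. V (Y w) = c}) = (w \<in> {w \<in> space P. N (Y w 0) * V (\<Theta> w) = c})"
      using AE_Y0
    proof eventually_elim
      case (elim w)
      then have "V (Y w) = N (Y w 0) * V (\<Theta> w)" using hom[of "N (Y w 0)" "\<Theta> w"] by (simp add: Y_eq)
      then show ?case by simp
    qed
  qed measurable
  also have "\<dots> = (\<integral>\<^sup>+w. (\<lambda>(r, \<theta>). indicator {c} (r * V \<theta>)) (N (Y w 0), \<Theta> w) \<partial>P)"
    by (rule nn_integral_eq_emeasure[symmetric]) auto
  also have "\<dots> = (\<integral>\<^sup>+w. (\<integral>\<^sup>+r. indicator {c} (r * V (\<Theta> w)) \<partial>radius) \<partial>P)"
    by (subst nn_integral_radius_spectral) auto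
  also have "\<dots> = (\<integral>\<^sup>+w. 0 \<partial>P)"
  proof (intro nn_integral_cong)
    fix w
    have "(\<integral>\<^sup>+r. indicator {c} (r * V (\<Theta> w)) \<partial>radius) \<le> (\<integral>\<^sup>+r. indicator {c / V (\<Theta> w)} r \<partial>radius)"
      using c by (intro nn_integral_mono) (auto simp: indicator_def field_simps split: if_splits)
    also have "\<dots> = 0" by (simp add: emeasure_radius_singleton)
    finally show "(\<integral>\<^sup>+r. indicator {c} (r * V (\<Theta> w)) \<partial>radius) = 0" by simp
  qed
  finally show ?thesis by simp
qed

text \<open>
  Integrating \<open>1{r V(\<theta>) > 1}\<close> against \<open>\<alpha> r\<^bsup>-\<alpha>-1\<^esup> dr\<close> gives \<open>V\<^sub>+(\<theta>)\<^sup>\<alpha>\<close>. On \<open>{|y\<^sub>0| > e}\<close> the law of the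
  radius is cut off below \<open>e\<close>, which replaces \<open>V\<^sub>+\<^sup>\<alpha>\<close> by its minimum with \<open>e\<^bsup>-\<alpha>\<^esup>\<close>; let \<open>e\<close> decrease to \<open>0\<close>.
\<close>

theorem tail_measure_polar:
  fixes V :: "(int \<Rightarrow> real ^ 'd) \<Rightarrow> real" and W :: "(int \<Rightarrow> real ^ 'd) \<Rightarrow> ennreal"
  assumes [measurable]: "V \<in> borel_measurable borel" "W \<in> borel_measurable borel"
    and V: "\<And>c y. c > 0 \<Longrightarrow> V (scale_seq c y) = c * V y" and W: "\<And>c y. c > 0 \<Longrightarrow> W (scale_seq c y) = W y"
  shows "(\<integral>\<^sup>+y. W y * indicator {1<..} (V y) * indicator {0<..} (N (y 0)) \<partial>\<nu>)
    = (\<integral>\<^sup>+w. W (\<Theta> w) * ennreal (max (V (\<Theta> w)) 0 powr \<alpha>) \<partial>P)"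
proof -
  define e where "e n = 1 / (real n + 1)" for n
  have e: "e n > 0" for n by (simp add: e_def)
  have edec: "e (Suc n) \<le> e n" for n by (simp add: e_def field_simps)
  have elim0: "e \<longlonglongrightarrow> 0" unfolding e_def by real_asymp
  define q where "q n v = min (e n powr (-\<alpha>)) (max v 0 powr \<alpha>)" for n v
  have step: "(\<integral>\<^sup>+y. W y * indicator {1<..} (V y) * indicator {e n<..} (N (y 0)) \<partial>\<nu>)
      = (\<integral>\<^sup>+w. W (\<Theta> w) * ennreal (q n (V (\<Theta> w))) \<partial>P)" for n
  proof -
    have "(\<integral>\<^sup>+y. W y * indicator {1<..} (V y) * indicator {e n<..} (N (y 0)) \<partial>\<nu>)
       = ennreal (e n powr (-\<alpha>)) * (\<integral>\<^sup>+w. W (Y w) * indicator {1<..} (e n * V (Y w)) \<partial>P)"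
      using e by (subst tail_measure_restrict) (auto simp: V W)
    also have "(\<integral>\<^sup>+w. W (Y w) * indicator {1<..} (e n * V (Y w)) \<partial>P)
       = (\<integral>\<^sup>+w. (\<lambda>(r, \<theta>). W \<theta> * indicator {1<..} (e n * (r * V \<theta>))) (N (Y w 0), \<Theta> w) \<partial>P)"
    proof (rule nn_integral_cong_AE)
      show "AE w in P. W (Y w) * indicator {1<..} (e n * V (Y w))
         = (\<lambda>(r, \<theta>). W \<theta> * indicator {1<..} (e n * (r * V \<theta>))) (N (Y w 0), \<Theta> w)"
        using AE_Y0
      proof eventually_elim
        case (elim w)
        then have "V (Y w) = N (Y w 0) * V (\<Theta> w)" "W (Y w) = W (\<Theta> w)"
          using V[of "N (Y w 0)" "\<Theta> w"] W[of "N (Y w 0)" "\<Theta> w"] by (simp_all add: Y_eq)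
        then show ?case by simp
      qed
    qed
    also have "\<dots> = (\<integral>\<^sup>+w. (\<integral>\<^sup>+r. W (\<Theta> w) * indicator {1<..} (e n * (r * V (\<Theta> w))) \<partial>radius) \<partial>P)"
      by (subst nn_integral_radius_spectral) auto
    also have "\<dots> = (\<integral>\<^sup>+w. W (\<Theta> w) * ennreal (if V (\<Theta> w) > 0 then min 1 ((e n * V (\<Theta> w)) powr \<alpha>) else 0) \<partial>P)"
    proof (intro nn_integral_cong)
      fix w
      define v where "v = V (\<Theta> w)"
      have "(\<integral>\<^sup>+r. indicator {1<..} (e n * (r * v)) \<partial>radius) = ennreal (if v > 0 then min 1 ((e n * v) powr \<alpha>) else 0)"
      proof (cases "v > 0")
        case True
        have "(\<integral>\<^sup>+r. indicator {1<..} (e n * (r * v)) \<partial>radius) = (\<integral>\<^sup>+r. indicator {1 / (e n * v)<..} r \<partial>radius)"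
          using True e[of n] by (intro nn_integral_cong) (auto simp: indicator_def field_simps)
        also have "\<dots> = ennreal (if 1 / (e n * v) \<ge> 1 then (1 / (e n * v)) powr (-\<alpha>) else 1)"
          by (simp add: emeasure_radius_gt)
        also have "(if 1 / (e n * v) \<ge> 1 then (1 / (e n * v)) powr (-\<alpha>) else 1) = min 1 ((e n * v) powr \<alpha>)"
        proof (cases "e n * v \<le> 1")
          case le: True
          have pos: "e n * v > 0" using True e[of n] by simp
          then have "(1 / (e n * v)) powr (-\<alpha>) = (e n * v) powr \<alpha>" by (simp add: powr_minus powr_divide)
          moreover have "(e n * v) powr \<alpha> \<le> 1" using le pos alpha by (intro powr_le1) auto
          ultimately show ?thesis using le pos by simp
        next
          case False
          then have "1 \<le> (e n * v) powr \<alpha>" using alpha by (intro ge_one_powr_ge_zero) auto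
          then show ?thesis using False by simp
        qed
        finally show ?thesis using True by simp
      next
        case False
        have "(\<integral>\<^sup>+r. indicator {1<..} (e n * (r * v)) \<partial>radius) = (\<integral>\<^sup>+w. indicator {1<..} (e n * (N (Y w 0) * v)) \<partial>P)"
          unfolding radius_def by (subst nn_integral_distr) auto
        also have "\<dots> = (\<integral>\<^sup>+w. 0 \<partial>P)"
        proof (intro nn_integral_cong)
          fix w
          have "e n * (N (Y w 0) * v) \<le> 0" using False e[of n]
            by (intro mult_nonneg_nonpos) auto
          then show "indicator {1<..} (e n * (N (Y w 0) * v)) = (0::ennreal)" by simp
        qed
        finally show ?thesis using False by simp
      qed
      then show "(\<integral>\<^sup>+r. W (\<Theta> w) * indicator {1<..} (e n * (r * V (\<Theta> w))) \<partial>radius)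
         = W (\<Theta> w) * ennreal (if V (\<Theta> w) > 0 then min 1 ((e n * V (\<Theta> w)) powr \<alpha>) else 0)"
        unfolding v_def by (subst nn_integral_cmult) auto
    qed
    also have "ennreal (e n powr (-\<alpha>)) * \<dots> = (\<integral>\<^sup>+w. W (\<Theta> w) * ennreal (q n (V (\<Theta> w))) \<partial>P)"
    proof (subst nn_integral_cmult[symmetric], measurable, intro nn_integral_cong)
      fix w
      define v where "v = V (\<Theta> w)"
      have "e n powr (-\<alpha>) * (if v > 0 then min 1 ((e n * v) powr \<alpha>) else 0) = q n v"
      proof (cases "v > 0")
        case True
        have "e n powr (-\<alpha>) * min 1 ((e n * v) powr \<alpha>) = min (e n powr (-\<alpha>)) (e n powr (-\<alpha>) * (e n * v) powr \<alpha>)"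
          by (subst min_mult_distrib_left) auto
        also have "e n powr (-\<alpha>) * (e n * v) powr \<alpha> = v powr \<alpha>"
          using e[of n] True by (simp add: powr_mult powr_minus field_simps)
        finally show ?thesis using True by (simp add: q_def)
      qed (simp add: q_def max_def)
      then show "ennreal (e n powr (-\<alpha>)) * (W (\<Theta> w) * ennreal (if V (\<Theta> w) > 0 then min 1 ((e n * V (\<Theta> w)) powr \<alpha>) else 0))
         = W (\<Theta> w) * ennreal (q n (V (\<Theta> w)))"
        unfolding v_def by (simp add: mult.left_commute[of _ "W _"] flip: ennreal_mult')
    qed
    finally show ?thesis .
  qed
  have "(\<lambda>n. \<integral>\<^sup>+y. W y * indicator {1<..} (V y) * indicator {e n<..} (N (y 0)) \<partial>\<nu>)
      \<longlonglongrightarrow> (\<integral>\<^sup>+y. W y * indicator {1<..} (V y) * indicator {0<..} (N (y 0)) \<partial>\<nu>)"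
  proof (rule nn_integral_LIMSEQ)
    show "incseq (\<lambda>n y. W y * indicator {1<..} (V y) * indicator {e n<..} (N (y 0)))"
      using edec by (intro incseq_SucI le_funI mult_left_mono) (auto simp: indicator_def intro: le_less_trans)
    show "(\<lambda>n. W y * indicator {1<..} (V y) * indicator {e n<..} (N (y 0)))
      \<longlonglongrightarrow> W y * indicator {1<..} (V y) * indicator {0<..} (N (y 0))" for y
    proof (rule tendsto_eventually)
      show "\<forall>\<^sub>F n in sequentially. W y * indicator {1<..} (V y) * indicator {e n<..} (N (y 0))
         = W y * indicator {1<..} (V y) * indicator {0<..} (N (y 0))"
      proof (cases "N (y 0) > 0")
        case True
        then have "\<forall>\<^sub>F n in sequentially. e n < N (y 0)" using elim0 order_tendstoD(2) by blast
          then show ?thesis by (rule eventually_mono) (use True in simp)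
      next
        case False
        then have "\<not> e n < N (y 0)" for n using e[of n] by simp
        then show ?thesis using False by simp
      qed
    qed
  qed measurable
  moreover have "(\<lambda>n. \<integral>\<^sup>+w. W (\<Theta> w) * ennreal (q n (V (\<Theta> w))) \<partial>P)
     \<longlonglongrightarrow> (\<integral>\<^sup>+w. W (\<Theta> w) * ennreal (max (V (\<Theta> w)) 0 powr \<alpha>) \<partial>P)"
  proof (rule nn_integral_LIMSEQ)
    have "e n powr (-\<alpha>) \<le> e (Suc n) powr (-\<alpha>)" for n
      using alpha e edec by (intro powr_mono2') auto
    then show "incseq (\<lambda>n w. W (\<Theta> w) * ennreal (q n (V (\<Theta> w))))"
      unfolding q_def by (intro incseq_SucI le_funI mult_left_mono ennreal_leI min.mono) auto
    show "(\<lambda>n. W (\<Theta> w) * ennreal (q n (V (\<Theta> w)))) \<longlonglongrightarrow> W (\<Theta> w) * ennreal (max (V (\<Theta> w)) 0 powr \<alpha>)" for w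
    proof (rule tendsto_eventually)
      have "filterlim (\<lambda>n. e n powr (-\<alpha>)) at_top sequentially"
        unfolding e_def using alpha by real_asymp
      then have "\<forall>\<^sub>F n in sequentially. max (V (\<Theta> w)) 0 powr \<alpha> \<le> e n powr (-\<alpha>)"
        by (simp add: filterlim_at_top)
      then show "\<forall>\<^sub>F n in sequentially. W (\<Theta> w) * ennreal (q n (V (\<Theta> w))) = W (\<Theta> w) * ennreal (max (V (\<Theta> w)) 0 powr \<alpha>)"
        by eventually_elim (simp add: q_def min_absorb2)
    qed
  qed (unfold q_def, measurable)
  ultimately show ?thesis unfolding step by (rule LIMSEQ_unique)
qed

end

section \<open>Tails of continuous homogeneous functionals\<close>

context tail_setting
begin

lemma emeasure_\<nu>_gt: "e > 0 \<Longrightarrow> emeasure \<nu> {y. N (y j) > e} = ennreal (e powr (-\<alpha>))"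
proof -
  assume e: "e > 0"
  have "(\<integral>\<^sup>+y. 1 * indicator {e<..} (N (y j)) \<partial>\<nu>) = ennreal (e powr (-\<alpha>)) * (\<integral>\<^sup>+w. 1 \<partial>P)"
    by (rule tail_measure_restrict[OF e]) simp
  moreover have "(\<integral>\<^sup>+y. 1 * indicator {e<..} (N (y j)) \<partial>\<nu>) = emeasure \<nu> {y \<in> space \<nu>. N (y j) > e}"
    by (rule nn_integral_eq_emeasure) auto
  ultimately show ?thesis using sets_eq_imp_space_eq[OF sets_\<nu>] by (simp add: P.emeasure_space_1)
qed

text \<open>
  By the bound on \<open>V\<close>, the event \<open>{V > 1/2}\<close> forces some coordinate to exceed \<open>2 e\<close>. A continuous
  function of \<open>V\<close> supported there is therefore split by a partition of unity into pieces supported on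
  \<open>{|x\<^sub>i| > e}\<close>, to which \<open>tail_limit\<close> and \<open>tail_measure_restrict\<close> apply. The indicator of \<open>{V > 1}\<close> is
  squeezed between such functions, and its boundary \<open>{V = 1}\<close> is \<open>\<nu>\<close>-null by \<open>radius_null\<close>.
\<close>

theorem tail_functional:
  fixes V :: "(int \<Rightarrow> real ^ 'd) \<Rightarrow> real"
  assumes st: "s \<le> t" and cont: "continuous_on UNIV V" and win: "\<And>x. V (window {s..t} x) = V x"
    and hom: "\<And>c x. c > 0 \<Longrightarrow> V (scale_seq c x) = c * V x"
    and C: "C > 0" and bound: "\<And>x. \<bar>V x\<bar> \<le> C * (\<Sum>i\<in>{s..t}. N (x i))"
  shows "((\<lambda>u. measure M {w \<in> space M. V (X w) > u} / p u) \<longlongrightarrow> measure \<nu> {y. V y > 1}) at_top"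
    and "emeasure \<nu> {y. V y > 1} < \<infinity>"
proof -
  have [measurable]: "V \<in> borel_measurable borel" by (rule borel_measurable_continuous_onI[OF cont])
  have sp [simp]: "space \<nu> = UNIV" using sets_eq_imp_space_eq[OF sets_\<nu>] by simp
  have V0: "V x = 0" if "\<And>i. i \<in> {s..t} \<Longrightarrow> x i = 0" for x
    using bound[of x] that by simp
  define n where "n = real (card {s..t})"
  have n: "n \<ge> 1" unfolding n_def using st by simp
  \<comment> \<open>if all coordinates are below \<open>2 * e\<close>, then \<open>V \<le> C * n * (2 * e) = 1/2\<close>\<close>
  define e where "e = 1 / (4 * C * n)"
  have e: "e > 0" using C n by (simp add: e_def)
  have big: "\<exists>i\<in>{s..t}. N (x i) \<ge> 2 * e" if "V x > 1/2" for x
  proof (rule ccontr)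
    assume "\<not> ?thesis"
    then have "(\<Sum>i\<in>{s..t}. N (x i)) \<le> (\<Sum>i\<in>{s..t}. 2 * e)" by (intro sum_mono) (meson linear)
    also have "\<dots> = n * (2 * e)" by (simp add: n_def)
    finally have "C * (\<Sum>i\<in>{s..t}. N (x i)) \<le> C * (n * (2 * e))" using C by simp
    also have "\<dots> = 1/2" using C n by (simp add: e_def)
    finally show False using bound[of x] that by simp
  qed
  have fin: "emeasure \<nu> {y. V y > 1/2} < \<infinity>"
  proof -
    have "emeasure \<nu> {y. V y > 1/2} \<le> emeasure \<nu> (\<Union>i\<in>{s..t}. {y. N (y i) > e})"
    proof (rule emeasure_mono)
      have "\<exists>i\<in>{s..t}. N (y i) > e" if "V y > 1/2" for y
        using big[OF that] e by (smt (verit) half_gt_zero_iff)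
      then show "{y. V y > 1/2} \<subseteq> (\<Union>i\<in>{s..t}. {y. N (y i) > e})" by blast
    qed auto
    also have "\<dots> \<le> (\<Sum>i\<in>{s..t}. emeasure \<nu> {y. N (y i) > e})"
      by (intro emeasure_subadditive_finite) auto
    also have "\<dots> < \<infinity>" using e by (simp add: emeasure_\<nu>_gt ennreal_of_nat_eq_real_of_nat ennreal_mult_less_top)
    finally show ?thesis .
  qed
  have null: "emeasure \<nu> {y. V y = 1} = 0"
  proof -
    have "emeasure \<nu> ({y. V y = 1} \<inter> {y. N (y i) > e}) = 0" for i
    proof -
      have "emeasure \<nu> ({y. V y = 1} \<inter> {y. N (y i) > e})
          = (\<integral>\<^sup>+y. indicator {1} (V y) * indicator {e<..} (N (y i)) \<partial>\<nu>)"
        by (subst nn_integral_eq_emeasure[where Q="\<lambda>y. V y = 1 \<and> N (y i) > e"]) (auto simp: Int_def)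
      also have "\<dots> = ennreal (e powr (-\<alpha>)) * (\<integral>\<^sup>+w. indicator {1} (V (scale_seq e (shift i (Y w)))) \<partial>P)"
        by (rule tail_measure_restrict[OF e]) measurable
      also have "(\<integral>\<^sup>+w. indicator {1} (V (scale_seq e (shift i (Y w)))) \<partial>P)
         = emeasure P {w \<in> space P. V (scale_seq e (shift i (Y w))) = 1}"
        by (rule nn_integral_eq_emeasure) auto
      also have "\<dots> = 0"
      proof (rule radius_null[where V="\<lambda>y. V (scale_seq e (shift i y))"])
        fix c :: real and y :: "int \<Rightarrow> real ^ 'd"
        assume c: "c > 0"
        have "scale_seq e (shift i (scale_seq c y)) = scale_seq c (scale_seq e (shift i y))"
          by (simp add: shift_scale_seq mult.commute)
        then show "V (scale_seq e (shift i (scale_seq c y))) = c * V (scale_seq e (shift i y))"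
          using hom[OF c] by metis
      qed auto
      finally show ?thesis by simp
    qed
    then have "emeasure \<nu> (\<Union>i\<in>{s..t}. {y. V y = 1} \<inter> {y. N (y i) > e}) = 0"
      by (intro null_setsD1 null_sets.finite_UN) (auto simp: null_sets_def)
    moreover have "{y. V y = 1} = (\<Union>i\<in>{s..t}. {y. V y = 1} \<inter> {y. N (y i) > e})"
    proof -
      have "\<exists>i\<in>{s..t}. N (y i) > e" if "V y = 1" for y
        using big[of y] that e by (smt (verit) half_gt_zero_iff field_sum_of_halves)
      then show ?thesis by blast
    qed
    ultimately show ?thesis by simp
  qed
  define \<phi> where "\<phi> r = ramp ((r - e) / e)" for r
  have \<phi>: "0 \<le> \<phi> r" "r \<le> e \<Longrightarrow> \<phi> r = 0" "2 * e \<le> r \<Longrightarrow> \<phi> r = 1" for r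
    using e by (auto simp: \<phi>_def divide_le_0_iff le_divide_eq intro!: ramp_simps)
  have \<phi>c: "continuous_on UNIV (\<lambda>x. \<phi> (N (x i)))" for i :: int
    unfolding \<phi>_def using e by (intro continuous_intros continuous_on_compose2[OF cont_N]) auto
  have lim: "((\<lambda>u. (LINT w|M. \<psi> (V (scale_seq (1 / u) (X w)))) / p u) \<longlongrightarrow> enn2real (\<integral>\<^sup>+y. ennreal (\<psi> (V y)) \<partial>\<nu>)) at_top"
    if \<psi>: "continuous_on UNIV \<psi>" "\<And>v. 0 \<le> \<psi> v" "\<And>v. \<psi> v \<le> 1" "\<And>v. v \<le> 1/2 \<Longrightarrow> \<psi> v = 0" for \<psi> :: "real \<Rightarrow> real"
  proof -
    \<comment> \<open>the maximum with \<open>1\<close> keeps the denominator continuous and positive where no coordinate is large\<close>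
    define S where "S x = max 1 (\<Sum>i\<in>{s..t}. \<phi> (N (x i)))" for x :: "int \<Rightarrow> real ^ 'd"
    have S1: "S x \<ge> 1" for x by (simp add: S_def)
    define g where "g i x = \<psi> (V x) * \<phi> (N (x i)) / S x" for i x
    have gc: "continuous_on UNIV (g i)" for i
      unfolding g_def S_def
      by (intro continuous_intros \<phi>c continuous_on_compose2[OF \<psi>(1)] cont) auto
    have gm [measurable]: "g i \<in> borel_measurable borel" for i by (rule borel_measurable_continuous_onI[OF gc])
    have g0: "0 \<le> g i x" for i x using \<psi>(2) \<phi>(1) S1[of x] by (simp add: g_def)
    have gsum: "(\<Sum>i\<in>{s..t}. g i x) = \<psi> (V x)" for x
    proof (cases "V x \<le> 1/2")
      case True
      then show ?thesis by (simp add: g_def \<psi>)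
    next
      case False
      then obtain i where i: "i \<in> {s..t}" "2 * e \<le> N (x i)" using big[of x] by auto
      have "1 \<le> (\<Sum>i\<in>{s..t}. \<phi> (N (x i)))"
        using member_le_sum[of i "{s..t}" "\<lambda>i. \<phi> (N (x i))"] i \<phi> by simp
      then have "(\<Sum>i\<in>{s..t}. \<phi> (N (x i))) = S x" by (simp add: S_def)
      then have "(\<Sum>i\<in>{s..t}. g i x) = \<psi> (V x) * S x / S x"
        unfolding g_def by (metis sum_distrib_left sum_divide_distrib)
      then show ?thesis using S1[of x] by simp
    qed
    have g1: "g i x \<le> 1" if "i \<in> {s..t}" for i x
      using member_le_sum[of i "{s..t}" "\<lambda>i. g i x"] that g0 gsum[of x] \<psi>(3)[of "V x"] by force
    define L where "L i = e powr (-\<alpha>) * (LINT w|P. g i (scale_seq e (shift i (Y w))))" for i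
    have L0: "L i \<ge> 0" for i by (simp add: L_def g0)
    have gl: "((\<lambda>u. (LINT w|M. g i (scale_seq (1 / u) (X w))) / p u) \<longlongrightarrow> L i) at_top" if i: "i \<in> {s..t}" for i
      unfolding L_def
    proof (rule tail_limit[OF st gc])
      show "bounded (range (g i))" using g0 g1[OF i] by (intro boundedI[of _ 1]) auto
      show "g i (window {s..t} x) = g i x" for x using i by (simp add: g_def S_def win window_nth)
    qed (use e in \<open>auto simp: g_def \<phi>\<close>)
    have "ennreal (L i) = (\<integral>\<^sup>+y. ennreal (g i y) \<partial>\<nu>)" if i: "i \<in> {s..t}" for i
    proof -
      have "ennreal (L i) = ennreal (e powr (-\<alpha>)) * (\<integral>\<^sup>+w. ennreal (g i (scale_seq e (shift i (Y w)))) \<partial>P)"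
        unfolding L_def using g0 g1[OF i]
        by (subst nn_integral_eq_integral) (auto intro!: P.integrable_const_bound[where B=1] simp: ennreal_mult)
      also have "\<dots> = (\<integral>\<^sup>+y. ennreal (g i y) * indicator {e<..} (N (y i)) \<partial>\<nu>)"
        by (rule tail_measure_restrict[OF e, symmetric]) measurable
      also have "\<dots> = (\<integral>\<^sup>+y. ennreal (g i y) \<partial>\<nu>)"
        using \<phi>(2) by (intro nn_integral_cong) (auto simp: indicator_def g_def)
      finally show ?thesis .
    qed
    then have "ennreal (\<Sum>i\<in>{s..t}. L i) = (\<Sum>i\<in>{s..t}. \<integral>\<^sup>+y. ennreal (g i y) \<partial>\<nu>)"
      using L0 by (subst sum_ennreal[symmetric]) auto
    also have "\<dots> = (\<integral>\<^sup>+y. ennreal (\<psi> (V y)) \<partial>\<nu>)"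
      using g0 by (subst nn_integral_sum[symmetric]) (auto simp: gsum)
    finally have Leq: "(\<Sum>i\<in>{s..t}. L i) = enn2real (\<integral>\<^sup>+y. ennreal (\<psi> (V y)) \<partial>\<nu>)"
      using L0 by (metis enn2real_ennreal sum_nonneg)
    have "((\<lambda>u. \<Sum>i\<in>{s..t}. (LINT w|M. g i (scale_seq (1 / u) (X w))) / p u) \<longlongrightarrow> (\<Sum>i\<in>{s..t}. L i)) at_top"
      by (intro tendsto_sum gl)
    moreover have "(\<Sum>i\<in>{s..t}. (LINT w|M. g i (scale_seq (1 / u) (X w))) / p u)
        = (LINT w|M. \<psi> (V (scale_seq (1 / u) (X w)))) / p u" for u
      using g0 g1
      by (subst sum_divide_distrib[symmetric], subst Bochner_Integration.integral_sum[symmetric])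
         (auto intro!: M.integrable_const_bound[where B=1] simp: gsum)
    ultimately show ?thesis unfolding Leq by simp
  qed
  \<comment> \<open>\<open>\<psi>1\<close> increases to the indicator of \<open>(1,\<infinity>)\<close>; \<open>\<psi>2\<close> decreases to that of \<open>[1,\<infinity>)\<close> and is supported in \<open>(1/2,\<infinity>)\<close>\<close>
  define \<psi>1 where "\<psi>1 m v = ramp ((real m + 1) * (v - 1))" for m v
  define \<psi>2 where "\<psi>2 m v = ramp (1 + (real m + 2) * (v - 1))" for m v
  have \<psi>1: "continuous_on UNIV (\<psi>1 m)" "0 \<le> \<psi>1 m v" "\<psi>1 m v \<le> 1" "v \<le> 1 \<Longrightarrow> \<psi>1 m v = 0" for m v
    unfolding \<psi>1_def by (auto intro!: continuous_intros simp: ramp_simps mult_nonneg_nonpos)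
  have half: "1 + (real m + 2) * (v - 1) \<le> 0" if "v \<le> 1/2" for m v
  proof -
    have "(real m + 2) * (v - 1) \<le> 2 * (v - 1)" using that by (intro mult_right_mono_neg) auto
    then show ?thesis using that by simp
  qed
  have \<psi>2: "continuous_on UNIV (\<psi>2 m)" "0 \<le> \<psi>2 m v" "\<psi>2 m v \<le> 1" "v \<le> 1/2 \<Longrightarrow> \<psi>2 m v = 0" "1 \<le> v \<Longrightarrow> \<psi>2 m v = 1" for m v
    unfolding \<psi>2_def by (auto intro!: continuous_intros simp: ramp_simps half)
  have [measurable]: "\<psi>1 m \<in> borel_measurable borel" "\<psi>2 m \<in> borel_measurable borel" for m
    using \<psi>1(1) \<psi>2(1) by (auto intro: borel_measurable_continuous_onI)
  have l1: "(\<lambda>m. \<psi>1 m v) \<longlonglongrightarrow> indicator {1<..} v" for v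
  proof -
    have "(\<lambda>m. ramp (real (Suc m) * (v - 1))) \<longlonglongrightarrow> indicator {0<..} (v - 1)"
      using LIMSEQ_Suc[OF ramp_multiple_tendsto] .
    then show ?thesis by (simp add: \<psi>1_def indicator_def add.commute)
  qed
  have l2: "(\<lambda>m. \<psi>2 m v) \<longlonglongrightarrow> indicator {1..} v" for v
  proof (cases "v \<ge> 1")
    case True
    then show ?thesis by (simp add: \<psi>2)
  next
    case False
    have "filterlim (\<lambda>m. 1 + (real m + 2) * (v - 1)) at_bot sequentially"
      using False by real_asymp
    then have "\<forall>\<^sub>F m in sequentially. 1 + (real m + 2) * (v - 1) \<le> 0"
      by (simp add: filterlim_at_bot)
    then have "\<forall>\<^sub>F m in sequentially. \<psi>2 m v = 0"
      by (rule eventually_mono) (simp add: \<psi>2_def ramp_simps)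
    then show ?thesis using False by (simp add: tendsto_eventually)
  qed
  have conv: "(\<lambda>m. enn2real (\<integral>\<^sup>+y. ennreal (\<psi> m (V y)) \<partial>\<nu>)) \<longlonglongrightarrow> measure \<nu> {y. V y \<in> A}"
    if [measurable]: "\<And>m. \<psi> m \<in> borel_measurable borel" "A \<in> sets borel"
      and "\<And>m v. v \<le> 1/2 \<Longrightarrow> \<psi> m v = 0" "\<And>m v. \<psi> m v \<le> 1" "\<And>v. (\<lambda>m. \<psi> m v) \<longlonglongrightarrow> indicator A v" "A \<subseteq> {1/2<..}"
    for \<psi> :: "nat \<Rightarrow> real \<Rightarrow> real" and A
  proof -
    have "(\<lambda>m. \<integral>\<^sup>+y. ennreal (\<psi> m (V y)) \<partial>\<nu>) \<longlonglongrightarrow> (\<integral>\<^sup>+y. ennreal (indicator A (V y)) \<partial>\<nu>)"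
    proof (rule nn_integral_dominated_convergence[where w="\<lambda>y. indicator {1/2<..} (V y)"])
      show "(\<integral>\<^sup>+y. indicator {1/2<..} (V y) \<partial>\<nu>) < \<infinity>"
        using fin by (subst nn_integral_eq_emeasure[where Q="\<lambda>y. V y > 1/2"]) auto
      show "AE y in \<nu>. ennreal (\<psi> j (V y)) \<le> indicator {1/2<..} (V y)" for j
        using that by (intro AE_I2) (auto simp: indicator_def not_less)
      show "AE y in \<nu>. (\<lambda>m. ennreal (\<psi> m (V y))) \<longlonglongrightarrow> ennreal (indicator A (V y))"
        using that by (intro AE_I2 tendsto_ennrealI) auto
    qed measurable
    moreover have "(\<integral>\<^sup>+y. ennreal (indicator A (V y)) \<partial>\<nu>) = emeasure \<nu> {y. V y \<in> A}"
      by (subst nn_integral_eq_emeasure[where Q="\<lambda>y. V y \<in> A"]) auto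
    moreover have "emeasure \<nu> {y. V y \<in> A} < \<infinity>"
      by (rule le_less_trans[OF emeasure_mono fin]) (use that(6) in auto)
    ultimately show ?thesis
      unfolding measure_def by (intro tendsto_enn2real) (auto simp: less_top)
  qed
  have eq: "measure \<nu> {y. V y \<in> {1..}} = measure \<nu> {y. V y > 1}"
  proof -
    have "emeasure \<nu> {y. V y \<in> {1..}} = emeasure \<nu> {y. V y > 1}"
      using null by (intro emeasure_eq_AE AE_I[where N="{y. V y = 1}"]) auto
    then show ?thesis by (simp add: measure_def)
  qed
  have Vu: "V (scale_seq (1 / u) x) = V x / u" if "u > 0" for u x using that by (simp add: hom)
  show "emeasure \<nu> {y. V y > 1} < \<infinity>"
    by (rule le_less_trans[OF emeasure_mono fin]) auto
  show "((\<lambda>u. measure M {w \<in> space M. V (X w) > u} / p u) \<longlongrightarrow> measure \<nu> {y. V y > 1}) at_top"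
  proof (rule tendsto_sandwich_family)
    show "((\<lambda>u. (LINT w|M. \<psi>1 m (V (scale_seq (1 / u) (X w)))) / p u) \<longlongrightarrow> enn2real (\<integral>\<^sup>+y. ennreal (\<psi>1 m (V y)) \<partial>\<nu>)) at_top" for m
      by (rule lim) (use \<psi>1 in auto)
    show "((\<lambda>u. (LINT w|M. \<psi>2 m (V (scale_seq (1 / u) (X w)))) / p u) \<longlongrightarrow> enn2real (\<integral>\<^sup>+y. ennreal (\<psi>2 m (V y)) \<partial>\<nu>)) at_top" for m
      by (rule lim) (use \<psi>2 in auto)
    show "(\<lambda>m. enn2real (\<integral>\<^sup>+y. ennreal (\<psi>1 m (V y)) \<partial>\<nu>)) \<longlonglongrightarrow> measure \<nu> {y. V y > 1}"
      using conv[of \<psi>1 "{1<..}"] \<psi>1 l1 by auto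
    show "(\<lambda>m. enn2real (\<integral>\<^sup>+y. ennreal (\<psi>2 m (V y)) \<partial>\<nu>)) \<longlonglongrightarrow> measure \<nu> {y. V y > 1}"
    proof -
      have "{1..} \<subseteq> {1/2 :: real<..}" by (auto intro: less_le_trans[of _ 1])
      then show ?thesis using conv[of \<psi>2 "{1..}"] \<psi>2 l2 unfolding eq by auto
    qed
    show "\<forall>\<^sub>F u in at_top. (LINT w|M. \<psi>1 m (V (scale_seq (1 / u) (X w)))) / p u
        \<le> measure M {w \<in> space M. V (X w) > u} / p u" for m
      using eventually_gt_at_top[of 0]
    proof eventually_elim
      case (elim u)
      have "(LINT w|M. \<psi>1 m (V (scale_seq (1 / u) (X w)))) \<le> (LINT w|M. indicator {w \<in> space M. V (X w) > u} w)"
      proof (intro integral_mono M.integrable_const_bound[where B=1])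
        fix w assume "w \<in> space M"
        then show "\<psi>1 m (V (scale_seq (1 / u) (X w))) \<le> indicator {w \<in> space M. V (X w) > u} w"
          using elim \<psi>1(3) \<psi>1(4)[of "V (X w) / u" m] by (auto simp: indicator_def Vu not_less)
      qed (use \<psi>1(2,3) in \<open>auto simp: indicator_def\<close>)
      then show ?case using p_pos[of u] by (simp add: divide_right_mono)
    qed
    show "\<forall>\<^sub>F u in at_top. measure M {w \<in> space M. V (X w) > u} / p u
        \<le> (LINT w|M. \<psi>2 m (V (scale_seq (1 / u) (X w)))) / p u" for m
      using eventually_gt_at_top[of 0]
    proof eventually_elim
      case (elim u)
      have "(LINT w|M. indicator {w \<in> space M. V (X w) > u} w) \<le> (LINT w|M. \<psi>2 m (V (scale_seq (1 / u) (X w))))"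
      proof (intro integral_mono M.integrable_const_bound[where B=1])
        fix w assume "w \<in> space M"
        then show "indicator {w \<in> space M. V (X w) > u} w \<le> \<psi>2 m (V (scale_seq (1 / u) (X w)))"
          using elim \<psi>2(2) \<psi>2(5)[of "V (X w) / u" m] by (auto simp: indicator_def Vu not_less)
      qed (use \<psi>2(2,3) in \<open>auto simp: indicator_def\<close>)
      then show ?case using p_pos[of u] by (simp add: divide_right_mono)
    qed
  qed
qed

end

section \<open>Increments over finite blocks\<close>

lemma sum_tendsto_nn_integral_count_space:
  fixes f :: "int \<Rightarrow> ennreal"
  shows "(\<lambda>n. \<Sum>j\<in>{- int n..int n}. f j) \<longlonglongrightarrow> (\<integral>\<^sup>+j. f j \<partial>count_space UNIV)"
proof -
  have "(\<lambda>n. \<integral>\<^sup>+j. f j * indicator {- int n..int n} j \<partial>count_space UNIV) \<longlonglongrightarrow> (\<integral>\<^sup>+j. f j \<partial>count_space UNIV)"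
  proof (rule nn_integral_LIMSEQ)
    show "incseq (\<lambda>n j. f j * indicator {- int n..int n} j)"
      by (intro incseq_SucI le_funI mult_left_mono) (auto simp: indicator_def)
    show "(\<lambda>n. f j * indicator {- int n..int n} j) \<longlonglongrightarrow> f j" for j
    proof (rule tendsto_eventually)
      show "\<forall>\<^sub>F n in sequentially. f j * indicator {- int n..int n} j = f j"
        by (intro eventually_sequentiallyI[of "nat \<bar>j\<bar>"]) (auto simp: indicator_def)
    qed
  qed auto
  moreover have "(\<integral>\<^sup>+j. f j * indicator {- int n..int n} j \<partial>count_space UNIV) = (\<Sum>j\<in>{- int n..int n}. f j)" for n
  proof -
    have "(\<integral>\<^sup>+j. f j * indicator {- int n..int n} j \<partial>count_space UNIV) = (\<integral>\<^sup>+j. f j \<partial>count_space {- int n..int n})"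
      by (simp add: nn_integral_count_space_indicator)
    then show ?thesis by (simp add: nn_integral_count_space_finite)
  qed
  ultimately show ?thesis by simp
qed

lemma l1_norm_nn_integral: "l1_norm N x = (\<integral>\<^sup>+j. ennreal (N (x j)) \<partial>count_space UNIV)"
proof -
  let ?f = "\<lambda>j. ennreal (N (x j))"
  have "(?f has_sum l1_norm N x) UNIV" unfolding l1_norm_def
    by (rule has_sum_infsum) (simp add: nonneg_summable_on_complete)
  then have "(sum ?f \<longlongrightarrow> l1_norm N x) (finite_subsets_at_top UNIV)" by (simp add: has_sum_def)
  moreover have "filterlim (\<lambda>n. {- int n..int n}) (finite_subsets_at_top UNIV) sequentially"
    unfolding filterlim_finite_subsets_at_top
  proof safe
    fix S :: "int set" assume S: "finite S"
    define m where "m = Max (insert 0 (abs ` S))"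
    have m: "\<bar>i\<bar> \<le> m" if "i \<in> S" for i unfolding m_def using S that by (intro Max_ge) auto
    show "\<forall>\<^sub>F n in sequentially. finite {- int n..int n} \<and> S \<subseteq> {- int n..int n} \<and> {- int n..int n} \<subseteq> UNIV"
      by (intro eventually_sequentiallyI[of "nat m"]) (use m in force)
  qed
  ultimately have "(\<lambda>n. \<Sum>j\<in>{- int n..int n}. ?f j) \<longlonglongrightarrow> l1_norm N x"
    by (rule filterlim_compose)
  then show ?thesis using sum_tendsto_nn_integral_count_space LIMSEQ_unique by blast
qed

lemma l1_norm_window_finite:
  assumes "finite S" "N 0 = 0" "\<And>v. 0 \<le> N v"
  shows "l1_norm N (window S x) = ennreal (\<Sum>j\<in>S. N (x j))"
proof -
  have "l1_norm N (window S x) = (\<integral>\<^sup>+j. ennreal (N (x j)) * indicator S j \<partial>count_space UNIV)"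
    unfolding l1_norm_nn_integral using assms(2)
    by (intro nn_integral_cong) (auto simp: window_nth indicator_def)
  also have "\<dots> = (\<Sum>j\<in>S. ennreal (N (x j)))"
    using assms(1) by (simp add: nn_integral_count_space_finite flip: nn_integral_count_space_indicator)
  finally show ?thesis using assms(3) by (simp add: sum_ennreal)
qed

locale tail_functional_setting = tail_setting N \<alpha> M X P Y \<nu>fin \<nu>
  for N :: "real ^ 'd \<Rightarrow> real" and \<alpha> :: real and M :: "'w measure" and X
    and P :: "'v measure" and Y and \<nu>fin \<nu> +
  fixes H :: "(int \<Rightarrow> real ^ 'd) \<Rightarrow> real" and C :: real
  assumes H_meas [measurable]: "H \<in> borel_measurable borel"
    and H_backshift: "\<And>x. H (backshift x) = H x"
    and H_scale: "\<And>c x. c > 0 \<Longrightarrow> H (scale_seq c x) = c * H x"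
    and H_cont: "\<And>k::nat. k \<ge> 1 \<Longrightarrow> continuous_on (block {1..int k}) H"
    and C: "C > 0" and H_bound: "\<And>x. ennreal \<bar>H x\<bar> \<le> ennreal C * l1_norm N x"
begin

lemma H_shift: "H (shift j x) = H x"
proof -
  have b: "backshift y = shift 1 y" for y :: "int \<Rightarrow> real ^ 'd" by (auto simp: backshift_def shift_def)
  have up: "H (shift (int n) y) = H y" for n y
  proof (induction n)
    case (Suc n)
    have "shift (int (Suc n)) y = backshift (shift (int n) y)" by (simp add: b)
    then show ?case using Suc H_backshift by metis
  qed simp
  show ?thesis
  proof (cases "j \<ge> 0")
    case True
    then show ?thesis using up[of "nat j" x] by simp
  next
    case False
    then show ?thesis using up[of "nat (- j)" "shift j x"] by simp
  qed
qed

lemma H_window_continuous: assumes "s \<le> t" shows "continuous_on UNIV (\<lambda>x. H (window {s..t} x))"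
proof -
  have "continuous_on UNIV (\<lambda>x. H (shift (1 - s) (window {s..t} x)))"
  proof (rule continuous_on_compose2[OF H_cont])
    show "1 \<le> nat (t - s + 1)" using assms by simp
    show "continuous_on UNIV (\<lambda>x::int \<Rightarrow> real ^ 'd. shift (1 - s) (window {s..t} x))"
      by (rule continuous_on_compose2[OF continuous_on_shift continuous_on_window]) auto
    show "(\<lambda>x::int \<Rightarrow> real ^ 'd. shift (1 - s) (window {s..t} x)) ` UNIV \<subseteq> block {1..int (nat (t - s + 1))}"
      using assms by (auto simp: block_def window_nth)
  qed
  then show ?thesis by (simp add: H_shift)
qed

lemma H_window_bound: "\<bar>H (window {s..t} x)\<bar> \<le> C * (\<Sum>i\<in>{s..t}. N (x i))"
proof -
  have "ennreal \<bar>H (window {s..t} x)\<bar> \<le> ennreal (C * (\<Sum>i\<in>{s..t}. N (x i)))"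
    using H_bound[of "window {s..t} x"] C by (simp add: l1_norm_window_finite ennreal_mult sum_nonneg)
  then show ?thesis using C by (subst (asm) ennreal_le_iff) (auto intro!: mult_nonneg_nonneg sum_nonneg)
qed

lemma window_functional:
  assumes "s \<le> t"
  shows "((\<lambda>u. measure M {w \<in> space M. H (window {s..t} (X w)) > u} / p u)
      \<longlongrightarrow> measure \<nu> {y. H (window {s..t} y) > 1}) at_top"
    and "emeasure \<nu> {y. H (window {s..t} y) > 1} < \<infinity>"
proof -
  have hom: "H (window {s..t} (scale_seq c x)) = c * H (window {s..t} x)" if "c > 0" for c x
    unfolding window_scale_seq by (rule H_scale[OF that])
  note tf = tail_functional[OF assms H_window_continuous[OF assms] _ hom C H_window_bound]
  show "((\<lambda>u. measure M {w \<in> space M. H (window {s..t} (X w)) > u} / p u)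
      \<longlongrightarrow> measure \<nu> {y. H (window {s..t} y) > 1}) at_top"
    by (rule tf(1)) (simp add: window_window)
  show "emeasure \<nu> {y. H (window {s..t} y) > 1} < \<infinity>"
    by (rule tf(2)) (simp add: window_window)
qed

text \<open>
  Both sides are limits of tail ratios, which agree by stationarity of \<open>X\<close> and shift invariance of \<open>H\<close>.
\<close>

lemma measure_window_shift:
  assumes "s \<le> t"
  shows "measure \<nu> {y. H (window {s + j..t + j} y) > 1} = measure \<nu> {y. H (window {s..t} y) > 1}"
proof -
  have eq: "measure M {w \<in> space M. H (window {s + j..t + j} (X w)) > u} = measure M {w \<in> space M. H (window {s..t} (X w)) > u}" for u
  proof -
    have "{i. i + j \<in> {s + j..t + j}} = {s..t}" by auto
    then have "H (window {s + j..t + j} (shift j x)) = H (window {s..t} x)" for x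
      by (simp add: window_shift H_shift)
    then show ?thesis using measure_shift[of "{x. H (window {s + j..t + j} x) > u}" j] by simp
  qed
  have "((\<lambda>u. measure M {w \<in> space M. H (window {s..t} (X w)) > u} / p u)
      \<longlongrightarrow> measure \<nu> {y. H (window {s + j..t + j} y) > 1}) at_top"
    using window_functional(1)[of "s + j" "t + j"] assms by (simp add: eq)
  from tendsto_unique[OF _ this window_functional(1)[OF assms]] show ?thesis by simp
qed

lemma borel_measurable_pos_powr [measurable]: "pos_powr H \<alpha> \<in> borel_measurable borel"
  unfolding pos_powr_def[abs_def] by measurable

abbreviation block_gain :: "int \<Rightarrow> (int \<Rightarrow> real ^ 'd) \<Rightarrow> real" where
  "block_gain k y \<equiv> pos_powr H \<alpha> (window {0..k} y) - pos_powr H \<alpha> (window {1..k} y)"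

text \<open>
  The two events differ only on \<open>{y\<^sub>0 \<noteq> 0}\<close>. There each of them has a finite mass, given by the polar
  form of \<open>\<nu>\<close>, so that the difference of masses is a difference of expectations.
\<close>

lemma block_increment:
  assumes k: "1 \<le> (k::int)"
  shows "integrable P (\<lambda>w. block_gain k (\<Theta> w))"
    and "measure \<nu> {y. H (window {0..k} y) > 1} - measure \<nu> {y. H (window {1..k} y) > 1}
      = (LINT w|P. block_gain k (\<Theta> w))"
proof -
  have sp [simp]: "space \<nu> = UNIV" using sets_eq_imp_space_eq[OF sets_\<nu>] by simp
  define A where "A s = {y. H (window {s..k} y) > 1}" for s
  have [measurable]: "A s \<in> sets \<nu>" for s unfolding A_def by measurable
  have fin: "emeasure \<nu> (A s) < \<infinity>" if "s \<in> {0, 1}" for s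
    unfolding A_def by (rule window_functional(2)) (use that k in auto)
  define Z :: "(int \<Rightarrow> real ^ 'd) set" where "Z = {y. N (y 0) > 0}"
  have [measurable]: "Z \<in> sets \<nu>" unfolding Z_def by measurable
  have polar: "emeasure \<nu> (A s \<inter> Z) = (\<integral>\<^sup>+w. ennreal (pos_powr H \<alpha> (window {s..k} (\<Theta> w))) \<partial>P)" for s
  proof -
    have "(\<integral>\<^sup>+y. 1 * indicator {1<..} (H (window {s..k} y)) * indicator {0<..} (N (y 0)) \<partial>\<nu>)
       = emeasure \<nu> {y \<in> space \<nu>. y \<in> A s \<inter> Z}"
      by (rule nn_integral_eq_emeasure) (auto simp: A_def Z_def)
    then have "emeasure \<nu> (A s \<inter> Z) = (\<integral>\<^sup>+y. 1 * indicator {1<..} (H (window {s..k} y)) * indicator {0<..} (N (y 0)) \<partial>\<nu>)"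
      by (simp add: Int_def)
    also have "\<dots> = (\<integral>\<^sup>+w. 1 * ennreal (max (H (window {s..k} (\<Theta> w))) 0 powr \<alpha>) \<partial>P)"
      by (rule tail_measure_polar) (auto simp: window_scale_seq H_scale)
    finally show ?thesis by (simp add: pos_powr_def)
  qed
  have sub: "emeasure \<nu> (A s - Z) < \<infinity>" "emeasure \<nu> (A s \<inter> Z) < \<infinity>" if "s \<in> {0, 1}" for s
    by (rule le_less_trans[OF emeasure_mono fin[OF that]]; auto)+
  have int: "integrable P (\<lambda>w. pos_powr H \<alpha> (window {s..k} (\<Theta> w)))" if "s \<in> {0, 1}" for s
  proof (rule integrableI_nonneg)
    show "(\<integral>\<^sup>+w. ennreal (pos_powr H \<alpha> (window {s..k} (\<Theta> w))) \<partial>P) < \<infinity>"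
      using sub(2)[OF that] by (simp add: polar)
  qed (auto simp: pos_powr_def)
  have split: "measure \<nu> (A s) = measure \<nu> (A s - Z) + (LINT w|P. pos_powr H \<alpha> (window {s..k} (\<Theta> w)))" if "s \<in> {0, 1}" for s
  proof -
    have "measure \<nu> ((A s - Z) \<union> (A s \<inter> Z)) = measure \<nu> (A s - Z) + measure \<nu> (A s \<inter> Z)"
      using sub[OF that] by (intro measure_Union) (auto simp: less_top)
    moreover have "(A s - Z) \<union> (A s \<inter> Z) = A s" by blast
    moreover have "measure \<nu> (A s \<inter> Z) = (LINT w|P. pos_powr H \<alpha> (window {s..k} (\<Theta> w)))"
      by (subst integral_eq_nn_integral) (auto simp: measure_def polar pos_powr_def)
    ultimately show ?thesis by simp
  qed
  have weq: "window {0..k} y = window {1..k} y" if "y 0 = 0" for y :: "int \<Rightarrow> real ^ 'd"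
  proof
    fix i show "window {0..k} y i = window {1..k} y i"
      using that k by (cases "i = 0") (auto simp: window_nth)
  qed
  have "A 0 - Z = {y \<in> A 0. y 0 = 0}" "A 1 - Z = {y \<in> A 1. y 0 = 0}"
    by (auto simp: Z_def less_le[of 0 "N _"])
  with weq have "A 0 - Z = A 1 - Z" by (auto simp: A_def)
  then have "measure \<nu> (A 0) - measure \<nu> (A 1) = (LINT w|P. pos_powr H \<alpha> (window {0..k} (\<Theta> w)))
     - (LINT w|P. pos_powr H \<alpha> (window {1..k} (\<Theta> w)))"
    using split[of 0] split[of 1] by simp
  then show "measure \<nu> {y. H (window {0..k} y) > 1} - measure \<nu> {y. H (window {1..k} y) > 1}
      = (LINT w|P. block_gain k (\<Theta> w))"
    using int[of 0] int[of 1] by (simp add: A_def)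
  show "integrable P (\<lambda>w. block_gain k (\<Theta> w))"
    using int[of 0] int[of 1] by simp
qed

end

section \<open>Anchoring and mass transport\<close>

lemma incseq_sum_symmetric:
  fixes f :: "int \<Rightarrow> ennreal"
  shows "incseq (\<lambda>n. \<Sum>j\<in>{- int n..int n}. f j)"
  by (intro incseq_SucI sum_mono2) auto

lemma borel_measurable_nn_integral_int [measurable (raw)]:
  fixes f :: "int \<Rightarrow> 'a \<Rightarrow> ennreal"
  assumes [measurable]: "\<And>j. f j \<in> borel_measurable M"
  shows "(\<lambda>w. \<integral>\<^sup>+j. f j w \<partial>count_space UNIV) \<in> borel_measurable M"
proof -
  have "(\<integral>\<^sup>+j. f j w \<partial>count_space UNIV) = (SUP n. \<Sum>j\<in>{- int n..int n}. f j w)" for w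
    using sum_tendsto_nn_integral_count_space LIMSEQ_SUP[OF incseq_sum_symmetric] LIMSEQ_unique by blast
  then show ?thesis by simp
qed

lemma nn_integral_int_swap:
  fixes f :: "int \<Rightarrow> 'a \<Rightarrow> ennreal"
  assumes [measurable]: "\<And>j. f j \<in> borel_measurable M"
  shows "(\<integral>\<^sup>+w. \<integral>\<^sup>+j. f j w \<partial>count_space UNIV \<partial>M) = (\<integral>\<^sup>+j. \<integral>\<^sup>+w. f j w \<partial>M \<partial>count_space UNIV)"
proof -
  have "(\<lambda>n. \<integral>\<^sup>+w. (\<Sum>j\<in>{- int n..int n}. f j w) \<partial>M) \<longlonglongrightarrow> (\<integral>\<^sup>+w. \<integral>\<^sup>+j. f j w \<partial>count_space UNIV \<partial>M)"
    using incseq_sum_symmetric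
    by (intro nn_integral_LIMSEQ sum_tendsto_nn_integral_count_space) (auto simp: incseq_def le_fun_def)
  moreover have "(\<integral>\<^sup>+w. (\<Sum>j\<in>{- int n..int n}. f j w) \<partial>M) = (\<Sum>j\<in>{- int n..int n}. \<integral>\<^sup>+w. f j w \<partial>M)" for n
    by (rule nn_integral_sum) simp
  ultimately have "(\<lambda>n. \<Sum>j\<in>{- int n..int n}. \<integral>\<^sup>+w. f j w \<partial>M) \<longlonglongrightarrow> (\<integral>\<^sup>+w. \<integral>\<^sup>+j. f j w \<partial>count_space UNIV \<partial>M)"
    by simp
  then show ?thesis using sum_tendsto_nn_integral_count_space LIMSEQ_unique by blast
qed

lemma nn_integral_count_space_Ex1:
  fixes Q :: "int \<Rightarrow> bool"
  assumes "\<exists>!j. Q j"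
  shows "(\<integral>\<^sup>+j. (if Q j then 1 else 0) \<partial>count_space UNIV) = (1::ennreal)"
proof -
  obtain k where k: "\<And>j. Q j \<longleftrightarrow> j = k" using assms by metis
  have "(\<integral>\<^sup>+j. (if Q j then 1 else 0) \<partial>count_space UNIV) = (\<integral>\<^sup>+j. indicator {k} j \<partial>count_space UNIV)"
    by (intro nn_integral_cong) (auto simp: k indicator_def)
  also have "\<dots> = 1" by simp
  finally show ?thesis .
qed

text \<open>
  Membership in \<open>ell0\<close> written with countable quantifiers, so that measurability is immediate.
\<close>

definition vanishing :: "('a \<Rightarrow> real) \<Rightarrow> (int \<Rightarrow> 'a) \<Rightarrow> bool" where
  "vanishing N y \<longleftrightarrow> (\<forall>n::nat. \<exists>m::nat. \<forall>j. int m < \<bar>j\<bar> \<longrightarrow> N (y j) \<le> 1 / (real n + 1))"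

lemma vanishing_finite: "vanishing N y \<longleftrightarrow> (\<forall>c>0. finite {j. N (y j) > c})"
proof safe
  fix c :: real assume v: "vanishing N y" and c: "c > 0"
  obtain n where n: "1 / (real n + 1) < c"
    using c reals_Archimedean[of c] by (auto simp: inverse_eq_divide add.commute)
  obtain m where m: "\<And>j. int m < \<bar>j\<bar> \<Longrightarrow> N (y j) \<le> 1 / (real n + 1)" using v unfolding vanishing_def by blast
  have "{j. N (y j) > c} \<subseteq> {- int m..int m}"
  proof
    fix j assume "j \<in> {j. N (y j) > c}"
    then have "\<not> int m < \<bar>j\<bar>" using m[of j] n by auto
    then show "j \<in> {- int m..int m}" by auto
  qed
  then show "finite {j. N (y j) > c}" by (rule finite_subset) simp
next
  assume f: "\<forall>c>0. finite {j. N (y j) > c}"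
  show "vanishing N y" unfolding vanishing_def
  proof
    fix n :: nat
    define A where "A = {j. N (y j) > 1 / (real n + 1)}"
    have A: "finite A" unfolding A_def using f by simp
    define m where "m = Max (insert 0 (abs ` A))"
    have m: "\<bar>j\<bar> \<le> m" if "j \<in> A" for j unfolding m_def using A that by (intro Max_ge) auto
    have "\<forall>j. int (nat m) < \<bar>j\<bar> \<longrightarrow> N (y j) \<le> 1 / (real n + 1)"
    proof (intro allI impI)
      fix j :: int assume "int (nat m) < \<bar>j\<bar>"
      then have "j \<notin> A" using m[of j] by (auto split: if_splits)
      then show "N (y j) \<le> 1 / (real n + 1)" by (simp add: A_def not_less)
    qed
    then show "\<exists>m::nat. \<forall>j. int m < \<bar>j\<bar> \<longrightarrow> N (y j) \<le> 1 / (real n + 1)" by blast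
  qed
qed

lemma ell0_vanishing:
  assumes "y \<in> ell0 N" shows "vanishing N y"
  unfolding vanishing_def
proof
  fix n :: nat
  have pos: "0 < 1 / (real n + 1)" by simp
  from assms have "\<forall>\<^sub>F j in at_top. N (y j) < 1 / (real n + 1)" "\<forall>\<^sub>F j in at_bot. N (y j) < 1 / (real n + 1)"
    using order_tendstoD(2)[OF _ pos] by (auto simp: ell0_def)
  then obtain a b where "\<And>j. j \<ge> a \<Longrightarrow> N (y j) < 1 / (real n + 1)" "\<And>j. j \<le> b \<Longrightarrow> N (y j) < 1 / (real n + 1)"
    unfolding eventually_at_top_linorder eventually_at_bot_linorder by blast
  then have "\<forall>j. int (nat (max a (- b))) < \<bar>j\<bar> \<longrightarrow> N (y j) \<le> 1 / (real n + 1)"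
    by (smt (verit) int_nat_eq)
  then show "\<exists>m::nat. \<forall>j. int m < \<bar>j\<bar> \<longrightarrow> N (y j) \<le> 1 / (real n + 1)" by blast
qed

lemma first_exceedance:
  fixes y :: "int \<Rightarrow> 'a"
  assumes "finite {j. N (y j) > (1::real)}" "N (y k) > 1"
  shows "\<exists>!j. N (y j) > 1 \<and> (\<forall>i<j. N (y i) \<le> 1)"
proof (rule ex1I)
  let ?A = "{j. N (y j) > 1}"
  have ne: "?A \<noteq> {}" using assms(2) by auto
  show "N (y (Min ?A)) > 1 \<and> (\<forall>i<Min ?A. N (y i) \<le> 1)"
    using Min_in[OF assms(1) ne] Min_le[OF assms(1)] by (auto simp: not_le[symmetric])
  fix j assume "N (y j) > 1 \<and> (\<forall>i<j. N (y i) \<le> 1)"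
  then show "j = Min ?A"
    using Min_in[OF assms(1) ne] Min_le[OF assms(1), of j] by (force simp: not_le[symmetric])
qed

lemma last_exceedance:
  fixes y :: "int \<Rightarrow> 'a"
  assumes "finite {j. N (y j) > (1::real)}" "N (y k) > 1"
  shows "\<exists>!j. N (y j) > 1 \<and> (\<forall>i>j. N (y i) \<le> 1)"
proof (rule ex1I)
  let ?A = "{j. N (y j) > 1}"
  have ne: "?A \<noteq> {}" using assms(2) by auto
  show "N (y (Max ?A)) > 1 \<and> (\<forall>i>Max ?A. N (y i) \<le> 1)"
    using Max_in[OF assms(1) ne] Max_ge[OF assms(1)] by (auto simp: not_le[symmetric])
  fix j assume "N (y j) > 1 \<and> (\<forall>i>j. N (y i) \<le> 1)"
  then show "j = Max ?A"
    using Max_in[OF assms(1) ne] Max_ge[OF assms(1), of j] by (force simp: not_le[symmetric])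
qed

locale anchored_setting = tail_setting N \<alpha> M X P Y \<nu>fin \<nu>
  for N :: "real ^ 'd \<Rightarrow> real" and \<alpha> :: real and M :: "'w measure" and X
    and P :: "'v measure" and Y and \<nu>fin \<nu> +
  fixes PQ :: "'q measure" and Q :: "'q \<Rightarrow> int \<Rightarrow> real ^ 'd"
  assumes ell0: "AE w in P. Y w \<in> ell0 N"
    and cs: "conditional_spectral N P Y PQ Q"
begin

sublocale PQ: prob_space PQ using cs by (simp add: conditional_spectral_def)
lemma Q [measurable]: "Q \<in> borel_measurable PQ" using cs by (simp add: conditional_spectral_def)

text \<open>
  The value \<open>0\<close> at sequences with infinite supremum is a default; \<open>Y\<close> has a finite supremum almost surely.
\<close>

definition peak :: "(int \<Rightarrow> real ^ 'd) \<Rightarrow> real" where "peak y = enn2real (sup_norm_on UNIV N y)"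

lemma borel_measurable_sup_norm [measurable]: "sup_norm_on S N \<in> borel_measurable borel"
  unfolding sup_norm_on_def[abs_def] by measurable
lemma borel_measurable_peak [measurable]: "peak \<in> borel_measurable borel"
  unfolding peak_def[abs_def] by measurable
lemma pred_vanishing [measurable]: "Measurable.pred borel (vanishing N)"
  unfolding vanishing_def[abs_def] by measurable

lemma sup_norm_le_1: "sup_norm_on S N y \<le> 1 \<longleftrightarrow> (\<forall>i\<in>S. N (y i) \<le> 1)"
  unfolding sup_norm_on_def SUP_le_iff using ennreal_le_1 by simp

lemma peak_scale: "c > 0 \<Longrightarrow> peak (scale_seq c y) = c * peak y"
  by (simp add: peak_def sup_norm_on_def N_scale ennreal_mult enn2real_mult flip: SUP_mult_left_ennreal)

lemma peak_shift: "peak (shift j y) = peak y"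
proof -
  have "(\<lambda>i. ennreal (N (y (i - j)))) ` UNIV = (\<lambda>i. ennreal (N (y i))) ` UNIV"
  proof safe
    fix i show "ennreal (N (y i)) \<in> range (\<lambda>i. ennreal (N (y (i - j))))"
      by (rule range_eqI[of _ _ "i + j"]) simp
  qed auto
  then show ?thesis unfolding peak_def sup_norm_on_def shift_nth by simp
qed

lemma sup_norm_finite: assumes "vanishing N y" shows "sup_norm_on UNIV N y < \<top>"
proof -
  have f: "finite {j. N (y j) > 1}" using assms by (simp add: vanishing_finite)
  define m where "m = Max (insert 1 ((\<lambda>j. N (y j)) ` {j. N (y j) > 1}))"
  have "N (y j) \<le> m" for j
  proof (cases "N (y j) > 1")
    case True
    then show ?thesis unfolding m_def using f by (intro Max_ge) auto
  next
    case False
    moreover have "1 \<le> m" unfolding m_def using f by (intro Max_ge) auto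
    ultimately show ?thesis by simp
  qed
  then have "sup_norm_on UNIV N y \<le> ennreal m"
    unfolding sup_norm_on_def by (intro SUP_least ennreal_leI)
  then show ?thesis by (rule le_less_trans) simp
qed

lemma le_peak: assumes "vanishing N y" shows "N (y j) \<le> peak y"
proof -
  have "ennreal (N (y j)) \<le> sup_norm_on UNIV N y" unfolding sup_norm_on_def by (rule SUP_upper) simp
  also have "\<dots> = ennreal (peak y)" using sup_norm_finite[OF assms] by (simp add: peak_def)
  finally show ?thesis by (simp add: peak_def)
qed

lemma peak_gt_1: assumes "vanishing N y" shows "peak y > 1 \<longleftrightarrow> (\<exists>j. N (y j) > 1)"
proof -
  have "\<not> (\<exists>j. N (y j) > 1) \<longleftrightarrow> sup_norm_on UNIV N y \<le> 1" by (auto simp: sup_norm_le_1 not_less)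
  also have "\<dots> \<longleftrightarrow> peak y \<le> 1" unfolding peak_def using sup_norm_finite[OF assms] by (subst enn2real_le_iff) auto
  finally show ?thesis by auto
qed

lemma vanishing_scale: assumes "c > 0" "vanishing N y" shows "vanishing N (scale_seq c y)"
proof -
  have "{j. N (scale_seq c y j) > d} = {j. N (y j) > d / c}" for d
    using assms by (auto simp: N_scale field_simps)
  then show ?thesis using assms by (simp add: vanishing_finite)
qed

lemma AE_vanishing: "AE w in P. vanishing N (Y w)"
  using ell0 by eventually_elim (rule ell0_vanishing)

lemma AE_\<nu>_vanishing: "AE y in \<nu>. N (y 0) > 0 \<longrightarrow> vanishing N y"
proof -
  have "AE y in \<nu>. N (y 0) > 1 / (real n + 1) \<longrightarrow> vanishing N y" for n
  proof -
    let ?e = "1 / (real n + 1)"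
    define f where "f y = (if vanishing N y then 0 else 1 :: ennreal)" for y
    have [measurable]: "f \<in> borel_measurable borel" unfolding f_def[abs_def] by measurable
    have "(\<integral>\<^sup>+y. f y * indicator {?e<..} (N (y 0)) \<partial>\<nu>) = ennreal (?e powr (-\<alpha>)) * (\<integral>\<^sup>+w. f (scale_seq ?e (shift 0 (Y w))) \<partial>P)"
      by (rule tail_measure_restrict) auto
    also have "(\<integral>\<^sup>+w. f (scale_seq ?e (shift 0 (Y w))) \<partial>P) = (\<integral>\<^sup>+w. 0 \<partial>P)"
      using AE_vanishing by (intro nn_integral_cong_AE) (auto simp: f_def intro: vanishing_scale elim!: eventually_mono)
    finally have "(\<integral>\<^sup>+y. f y * indicator {?e<..} (N (y 0)) \<partial>\<nu>) = 0" by simp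
    then have "AE y in \<nu>. f y * indicator {?e<..} (N (y 0)) = 0"
      by (subst (asm) nn_integral_0_iff_AE) auto
    then show ?thesis by eventually_elim (auto simp: f_def indicator_def split: if_splits)
  qed
  then have "AE y in \<nu>. \<forall>n::nat. N (y 0) > 1 / (real n + 1) \<longrightarrow> vanishing N y"
    unfolding AE_all_countable ..
  then show ?thesis
  proof eventually_elim
    case (elim y)
    then show ?case using reals_Archimedean[of "N (y 0)"] by (auto simp: inverse_eq_divide add.commute)
  qed
qed

text \<open>
  The candidate extremal index, computed from the past of \<open>Y\<close> because \<open>Q\<close> is anchored at a first
  exceedance; \<open>extremal_index_past\<close> shows that the future gives the same value.
\<close>

definition \<theta> :: ennreal where "\<theta> = emeasure P {w \<in> space P. \<forall>i<0. N (Y w i) \<le> 1}"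

lemma tail_measure_restrict_1: "f \<in> borel_measurable borel \<Longrightarrow> (\<integral>\<^sup>+y. f y * indicator {1<..} (N (y j)) \<partial>\<nu>) = (\<integral>\<^sup>+w. f (shift j (Y w)) \<partial>P)"
  using tail_measure_restrict[of 1 f j] by simp

text \<open>
  An exchange between first and last exceedances of level \<open>1\<close>. Described at time \<open>0\<close>, the set of
  sequences with first exceedance at \<open>0\<close> and last exceedance at \<open>j\<close> has the \<open>\<nu>\<close>-mass of the event that
  \<open>Y\<close> has no exceedance before \<open>0\<close> and its last one at \<open>j\<close>; described at time \<open>j\<close>, it has the mass of
  the event that \<open>Y\<close> has its first exceedance at \<open>-j\<close> and none after \<open>0\<close>. Sum over \<open>j\<close>.
\<close>

lemma extremal_index_past: "ennreal (ext_index N P Y) = \<theta>"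
proof -
  define a where "a j w = (if N (Y w j) > 1 \<and> (\<forall>i<0. N (Y w i) \<le> 1) \<and> (\<forall>i>j. N (Y w i) \<le> 1) then 1 else 0 :: ennreal)" for j w
  define b where "b j w = (if N (Y w (- j)) > 1 \<and> (\<forall>i<(- j). N (Y w i) \<le> 1) \<and> (\<forall>i>0. N (Y w i) \<le> 1) then 1 else 0 :: ennreal)" for j w
  have [measurable]: "a j \<in> borel_measurable P" "b j \<in> borel_measurable P" for j
    unfolding a_def[abs_def] b_def[abs_def] by measurable
  have ab: "(\<integral>\<^sup>+w. a j w \<partial>P) = (\<integral>\<^sup>+w. b j w \<partial>P)" for j
  proof -
    define f where "f y = (if (\<forall>i<0. N (y i) \<le> 1) \<and> (\<forall>i>j. N (y i) \<le> 1) then 1 else 0 :: ennreal)" for y :: "int \<Rightarrow> real ^ 'd"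
    have [measurable]: "f \<in> borel_measurable borel" unfolding f_def[abs_def] by measurable
    have "(\<integral>\<^sup>+w. a j w \<partial>P) = (\<integral>\<^sup>+w. f (shift 0 (Y w)) * indicator {1<..} (N (shift 0 (Y w) j)) \<partial>P)"
      by (intro nn_integral_cong) (auto simp: a_def f_def indicator_def)
    also have "\<dots> = (\<integral>\<^sup>+y. (f y * indicator {1<..} (N (y j))) * indicator {1<..} (N (y 0)) \<partial>\<nu>)"
      by (rule tail_measure_restrict_1[symmetric]) measurable
    also have "\<dots> = (\<integral>\<^sup>+y. (f y * indicator {1<..} (N (y 0))) * indicator {1<..} (N (y j)) \<partial>\<nu>)"
      by (simp add: ac_simps)
    also have "\<dots> = (\<integral>\<^sup>+w. f (shift j (Y w)) * indicator {1<..} (N (shift j (Y w) 0)) \<partial>P)"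
      by (rule tail_measure_restrict_1) measurable
    also have "\<dots> = (\<integral>\<^sup>+w. b j w \<partial>P)"
    proof (intro nn_integral_cong)
      fix w
      have "(\<forall>i<0. N (Y w (i - j)) \<le> 1) \<longleftrightarrow> (\<forall>i<(- j). N (Y w i) \<le> 1)"
        by (metis add_diff_cancel add_less_same_cancel2 diff_add_cancel less_diff_eq minus_less_iff neg_less_iff_less uminus_add_conv_diff)
      moreover have "(\<forall>i>j. N (Y w (i - j)) \<le> 1) \<longleftrightarrow> (\<forall>i>0. N (Y w i) \<le> 1)"
        by (metis add_diff_cancel diff_gt_0_iff_gt less_add_same_cancel2)
      ultimately show "f (shift j (Y w)) * indicator {1<..} (N (shift j (Y w) 0)) = b j w"
        by (auto simp: f_def b_def indicator_def)
    qed
    finally show ?thesis .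
  qed
  have "ennreal (ext_index N P Y) = emeasure P {w \<in> space P. \<forall>i>0. N (Y w i) \<le> 1}"
  proof -
    have "{w \<in> space P. sup_norm_on {1..} N (Y w) \<le> 1} = {w \<in> space P. \<forall>i>0. N (Y w i) \<le> 1}"
      by (auto simp: sup_norm_le_1)
    then show ?thesis by (simp add: ext_index_def P.emeasure_eq_measure)
  qed
  also have "\<dots> = (\<integral>\<^sup>+w. (if \<forall>i>0. N (Y w i) \<le> 1 then 1 else 0) \<partial>P)"
    by (rule nn_integral_eq_emeasure[symmetric]) auto
  also have "\<dots> = (\<integral>\<^sup>+w. \<integral>\<^sup>+j. b j w \<partial>count_space UNIV \<partial>P)"
  proof (rule nn_integral_cong_AE)
    show "AE w in P. (if \<forall>i>0. N (Y w i) \<le> 1 then 1 else 0) = (\<integral>\<^sup>+j. b j w \<partial>count_space UNIV)"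
      using AE_vanishing AE_Y0
    proof eventually_elim
      case (elim w)
      have "\<exists>!j. N (Y w j) > 1 \<and> (\<forall>i<j. N (Y w i) \<le> 1)"
        using elim by (intro first_exceedance[of N]) (auto simp: vanishing_finite)
      then have "\<exists>!j. N (Y w (- j)) > 1 \<and> (\<forall>i<(- j). N (Y w i) \<le> 1)"
        by (metis minus_minus)
      note one = nn_integral_count_space_Ex1[OF this]
      show ?case
      proof (cases "\<forall>i>0. N (Y w i) \<le> 1")
        case True
        then show ?thesis using one by (simp add: b_def)
      next
        case False
        then have "b j w = 0" for j by (auto simp: b_def)
        then show ?thesis using False by simp
      qed
    qed
  qed
  also have "\<dots> = (\<integral>\<^sup>+w. \<integral>\<^sup>+j. a j w \<partial>count_space UNIV \<partial>P)"
    by (simp add: nn_integral_int_swap ab)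
  also have "\<dots> = (\<integral>\<^sup>+w. (if \<forall>i<0. N (Y w i) \<le> 1 then 1 else 0) \<partial>P)"
  proof (rule nn_integral_cong_AE)
    show "AE w in P. (\<integral>\<^sup>+j. a j w \<partial>count_space UNIV) = (if \<forall>i<0. N (Y w i) \<le> 1 then 1 else 0)"
      using AE_vanishing AE_Y0
    proof eventually_elim
      case (elim w)
      have "\<exists>!j. N (Y w j) > 1 \<and> (\<forall>i>j. N (Y w i) \<le> 1)"
        using elim by (intro last_exceedance[of N]) (auto simp: vanishing_finite)
      note one = nn_integral_count_space_Ex1[OF this]
      show ?case
      proof (cases "\<forall>i<0. N (Y w i) \<le> 1")
        case True
        then show ?thesis using one by (simp add: a_def)
      next
        case False
        then have "a j w = 0" for j by (auto simp: a_def)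
        then show ?thesis using False by simp
      qed
    qed
  qed
  also have "\<dots> = \<theta>" unfolding \<theta>_def by (rule nn_integral_eq_emeasure) auto
  finally show ?thesis .
qed

lemma \<theta>_finite: "\<theta> < \<top>" by (simp add: \<theta>_def P.emeasure_eq_measure)

lemma nn_integral_Q_quotient:
  assumes [measurable]: "f \<in> borel_measurable borel"
  shows "(\<integral>\<^sup>+w. f (Q w) \<partial>PQ)
    = (\<integral>\<^sup>+w. f (scale_seq (1 / peak (Y w)) (Y w)) * indicator {y. \<forall>i<0. N (y i) \<le> 1} (Y w) \<partial>P) / \<theta>"
proof -
  let ?E = "{w \<in> space P. sup_norm_on {..-1} N (Y w) \<le> 1}"
  have E: "?E = {w \<in> space P. \<forall>i<0. N (Y w i) \<le> 1}" by (auto simp: sup_norm_le_1)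
  have Em [measurable]: "?E \<in> sets P" by measurable
  have \<theta>E: "\<theta> = emeasure P ?E" unfolding E by (simp add: \<theta>_def)
  have eq: "distr PQ borel Q = distr (uniform_measure P ?E) borel (\<lambda>w. scale_seq (1 / peak (Y w)) (Y w))"
    using cs by (simp add: conditional_spectral_def peak_def)
  have "(\<integral>\<^sup>+w. f (Q w) \<partial>PQ) = integral\<^sup>N (distr PQ borel Q) f" by (simp add: nn_integral_distr)
  also have "\<dots> = (\<integral>\<^sup>+w. f (scale_seq (1 / peak (Y w)) (Y w)) \<partial>uniform_measure P ?E)"
    unfolding eq by (subst nn_integral_distr) auto
  also have "\<dots> = (\<integral>\<^sup>+w. f (scale_seq (1 / peak (Y w)) (Y w)) * indicator ?E w \<partial>P) / \<theta>"
    unfolding \<theta>E by (simp add: nn_integral_uniform_measure)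
  also have "(\<integral>\<^sup>+w. f (scale_seq (1 / peak (Y w)) (Y w)) * indicator ?E w \<partial>P)
     = (\<integral>\<^sup>+w. f (scale_seq (1 / peak (Y w)) (Y w)) * indicator {y. \<forall>i<0. N (y i) \<le> 1} (Y w) \<partial>P)"
    unfolding E by (intro nn_integral_cong) (auto simp: indicator_def)
  finally show ?thesis .
qed

text \<open>
  Conditioning on a null event would make the law of \<open>Q\<close> the null measure.
\<close>

lemma \<theta>_nonzero: "\<theta> \<noteq> 0"
proof
  assume "\<theta> = 0"
  moreover have "(\<integral>\<^sup>+w. 1 * indicator {y. \<forall>i<0. N (y i) \<le> 1} (Y w) \<partial>P) = \<theta>"
    unfolding \<theta>_def by (rule nn_integral_eq_emeasure) auto
  ultimately show False using nn_integral_Q_quotient[of "\<lambda>_. 1"] by (simp add: PQ.emeasure_space_1)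
qed

lemma nn_integral_Q:
  assumes "f \<in> borel_measurable borel"
  shows "\<theta> * (\<integral>\<^sup>+w. f (Q w) \<partial>PQ)
    = (\<integral>\<^sup>+w. f (scale_seq (1 / peak (Y w)) (Y w)) * indicator {y. \<forall>i<0. N (y i) \<le> 1} (Y w) \<partial>P)"
  using \<theta>_nonzero \<theta>_finite
  by (simp add: nn_integral_Q_quotient[OF assms] ennreal_times_divide mult.commute[of \<theta>] ennreal_mult_divide_eq)

lemma AE_Q:
  assumes [measurable]: "Measurable.pred borel R" and "AE w in P. R (scale_seq (1 / peak (Y w)) (Y w))"
  shows "AE w in PQ. R (Q w)"
proof -
  define f where "f y = (if R y then 0 else 1 :: ennreal)" for y
  have [measurable]: "f \<in> borel_measurable borel" unfolding f_def[abs_def] by measurable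
  have "\<theta> * (\<integral>\<^sup>+w. f (Q w) \<partial>PQ) = (\<integral>\<^sup>+w. 0 \<partial>P)"
    unfolding nn_integral_Q[OF \<open>f \<in> borel_measurable borel\<close>]
    using assms(2) by (intro nn_integral_cong_AE) (auto simp: f_def elim!: eventually_mono)
  then have "(\<integral>\<^sup>+w. f (Q w) \<partial>PQ) = 0" using \<theta>_nonzero by simp
  then have "AE w in PQ. f (Q w) = 0" by (subst (asm) nn_integral_0_iff_AE) auto
  then show ?thesis by eventually_elim (simp add: f_def split: if_splits)
qed

abbreviation orbit_sum :: "((int \<Rightarrow> real ^ 'd) \<Rightarrow> ennreal) \<Rightarrow> (int \<Rightarrow> real ^ 'd) \<Rightarrow> ennreal" where
  "orbit_sum G q \<equiv> \<integral>\<^sup>+j. G (shift j q) \<partial>count_space UNIV"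

text \<open>
  Normalising by the peak turns \<open>G\<close> into the \<open>0\<close>-homogeneous function \<open>W(y) = G(y / y\<^sup>*)\<close>. The right-hand
  side is the sum over \<open>j\<close> of the \<open>\<nu>\<close>-integrals of \<open>W\<close> over the sequences whose first exceedance of \<open>1\<close>
  is at time \<open>j\<close>. Where \<open>y\<^sub>0 \<noteq> 0\<close> the sequence vanishes at infinity almost everywhere, so these
  sets partition \<open>{y\<^sup>* > 1}\<close>, and the polar form gives \<open>E[W(\<Theta>) (\<Theta>\<^sup>*)\<^sup>\<alpha>] = E G(\<Theta>)\<close>.
\<close>

theorem mass_transport:
  fixes G :: "(int \<Rightarrow> real ^ 'd) \<Rightarrow> ennreal"
  assumes [measurable]: "G \<in> borel_measurable borel"
    and hom: "\<And>c y. c > 0 \<Longrightarrow> G (scale_seq c y) = ennreal (c powr \<alpha>) * G y"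
    and van: "\<And>y. y 0 = 0 \<Longrightarrow> G y = 0"
  shows "(\<integral>\<^sup>+w. G (\<Theta> w) \<partial>P) = \<theta> * (\<integral>\<^sup>+w. orbit_sum G (Q w) \<partial>PQ)"
proof -
  define W where "W y = G (scale_seq (1 / peak y) y)" for y
  have [measurable]: "W \<in> borel_measurable borel" unfolding W_def by measurable
  have W: "W (scale_seq c y) = W y" if "c > 0" for c y
    using that by (simp add: W_def peak_scale)
  have W0: "W y = 0" if "y 0 = 0" for y unfolding W_def using that by (intro van) simp
  define F where "F j y = W y * (if \<forall>i<j. N (y i) \<le> 1 then 1 else 0)" for j :: int and y :: "int \<Rightarrow> real ^ 'd"
  have [measurable]: "F j \<in> borel_measurable borel" for j unfolding F_def by measurable
  have "\<theta> * (\<integral>\<^sup>+w. orbit_sum G (Q w) \<partial>PQ)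
     = (\<integral>\<^sup>+w. (orbit_sum G (scale_seq (1 / peak (Y w)) (Y w)))
          * indicator {y. \<forall>i<0. N (y i) \<le> 1} (Y w) \<partial>P)"
    by (rule nn_integral_Q) measurable
  also have "\<dots> = (\<integral>\<^sup>+w. \<integral>\<^sup>+j. F j (shift j (Y w)) \<partial>count_space UNIV \<partial>P)"
  proof (intro nn_integral_cong)
    fix w
    have "F j (shift j (Y w)) = G (shift j (scale_seq (1 / peak (Y w)) (Y w))) * indicator {y. \<forall>i<0. N (y i) \<le> 1} (Y w)" for j
    proof -
      have "(\<forall>i<j. N (Y w (i - j)) \<le> 1) \<longleftrightarrow> (\<forall>i<0. N (Y w i) \<le> 1)"
        by (metis add_diff_cancel add_less_same_cancel2 diff_less_0_iff_less)
      then show ?thesis by (simp add: F_def W_def peak_shift shift_scale_seq indicator_def)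
    qed
    then show "(orbit_sum G (scale_seq (1 / peak (Y w)) (Y w)))
          * indicator {y. \<forall>i<0. N (y i) \<le> 1} (Y w) = (\<integral>\<^sup>+j. F j (shift j (Y w)) \<partial>count_space UNIV)"
      by (simp add: nn_integral_multc)
  qed
  also have "\<dots> = (\<integral>\<^sup>+j. \<integral>\<^sup>+w. F j (shift j (Y w)) \<partial>P \<partial>count_space UNIV)"
    by (rule nn_integral_int_swap) measurable
  also have "\<dots> = (\<integral>\<^sup>+j. \<integral>\<^sup>+y. F j y * indicator {1<..} (N (y j)) \<partial>\<nu> \<partial>count_space UNIV)"
    by (simp add: tail_measure_restrict_1)
  also have "\<dots> = (\<integral>\<^sup>+y. \<integral>\<^sup>+j. F j y * indicator {1<..} (N (y j)) \<partial>count_space UNIV \<partial>\<nu>)"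
    by (rule nn_integral_int_swap[symmetric]) measurable
  also have "\<dots> = (\<integral>\<^sup>+y. W y * indicator {1<..} (peak y) * indicator {0<..} (N (y 0)) \<partial>\<nu>)"
  proof (rule nn_integral_cong_AE)
    show "AE y in \<nu>. (\<integral>\<^sup>+j. F j y * indicator {1<..} (N (y j)) \<partial>count_space UNIV)
        = W y * indicator {1<..} (peak y) * indicator {0<..} (N (y 0))"
      using AE_\<nu>_vanishing
    proof eventually_elim
      case (elim y)
      show ?case
      proof (cases "y 0 = 0")
        case True
        then show ?thesis by (simp add: F_def W0)
      next
        case False
        then have v: "vanishing N y" and pos: "N (y 0) > 0"
          using elim N_nonneg[of "y 0"] N_eq_0[of "y 0"] by (auto simp: less_le simp del: N_eq_0 N_nonneg)
        have "(\<integral>\<^sup>+j. F j y * indicator {1<..} (N (y j)) \<partial>count_space UNIV)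
          = (\<integral>\<^sup>+j. W y * (if N (y j) > 1 \<and> (\<forall>i<j. N (y i) \<le> 1) then 1 else 0) \<partial>count_space UNIV)"
          by (intro nn_integral_cong) (auto simp: F_def indicator_def)
        also have "\<dots> = W y * (\<integral>\<^sup>+j. (if N (y j) > 1 \<and> (\<forall>i<j. N (y i) \<le> 1) then 1 else 0) \<partial>count_space UNIV)"
          by (rule nn_integral_cmult) simp
        also have "(\<integral>\<^sup>+j. (if N (y j) > 1 \<and> (\<forall>i<j. N (y i) \<le> 1) then 1 else 0) \<partial>count_space UNIV) = indicator {1<..} (peak y)"
        proof (cases "\<exists>k. N (y k) > 1")
          case True
          then obtain k where "N (y k) > 1" ..
          then have "\<exists>!j. N (y j) > 1 \<and> (\<forall>i<j. N (y i) \<le> 1)"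
            using v by (intro first_exceedance[of N]) (auto simp: vanishing_finite)
          from nn_integral_count_space_Ex1[OF this] show ?thesis using True peak_gt_1[OF v] by simp
        next
          case False
          then show ?thesis using peak_gt_1[OF v] by simp
        qed
        finally show ?thesis using pos by simp
      qed
    qed
  qed
  also have "\<dots> = (\<integral>\<^sup>+w. W (\<Theta> w) * ennreal (max (peak (\<Theta> w)) 0 powr \<alpha>) \<partial>P)"
    by (rule tail_measure_polar) (auto simp: W peak_scale)
  also have "\<dots> = (\<integral>\<^sup>+w. G (\<Theta> w) \<partial>P)"
  proof (rule nn_integral_cong_AE)
    show "AE w in P. W (\<Theta> w) * ennreal (max (peak (\<Theta> w)) 0 powr \<alpha>) = G (\<Theta> w)"
      using AE_vanishing AE_Y0
    proof eventually_elim
      case (elim w)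
      have "vanishing N (\<Theta> w)" unfolding spectral_def using elim by (intro vanishing_scale) auto
      then have pk: "peak (\<Theta> w) \<ge> 1" using le_peak[of "\<Theta> w" 0] N_spectral_0[of "Y w"] elim by simp
      then have "W (\<Theta> w) = ennreal ((1 / peak (\<Theta> w)) powr \<alpha>) * G (\<Theta> w)" unfolding W_def by (intro hom) simp
      moreover have "(1 / peak (\<Theta> w)) powr \<alpha> * peak (\<Theta> w) powr \<alpha> = 1"
        using pk by (simp flip: powr_mult)
      ultimately show ?case using pk
        by (simp add: max_absorb1 mult.commute[of _ "G _"] mult.assoc flip: ennreal_mult)
    qed
  qed
  finally show ?thesis ..
qed

end

section \<open>Summability and the limit of the increments\<close>

lemma powr_diff_le_concave:
  fixes a b \<alpha> :: real
  assumes "0 \<le> b" "b \<le> a" "0 < \<alpha>" "\<alpha> \<le> 1"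
  shows "a powr \<alpha> - b powr \<alpha> \<le> (a - b) powr \<alpha>"
proof (cases "b = 0 \<or> a = b")
  case True
  then show ?thesis by auto
next
  case False
  then have pos: "0 < b" "0 < a - b" "0 < a" using assms by auto
  have base: "x powr \<alpha> = x * x powr (\<alpha> - 1)" if "x > 0" for x
    using powr_mult_base[of x "\<alpha> - 1"] that by simp
  have "a powr \<alpha> = (a - b) * a powr (\<alpha> - 1) + b * a powr (\<alpha> - 1)"
    using base[OF pos(3)] by (simp add: algebra_simps)
  also have "\<dots> \<le> (a - b) * (a - b) powr (\<alpha> - 1) + b * b powr (\<alpha> - 1)"
    using pos assms by (intro add_mono mult_left_mono powr_mono2') auto
  also have "\<dots> = (a - b) powr \<alpha> + b powr \<alpha>" using base pos by simp
  finally show ?thesis by simp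
qed

lemma powr_diff_le_convex:
  fixes a b \<alpha> :: real
  assumes "0 \<le> b" "b \<le> a" "1 \<le> \<alpha>"
  shows "a powr \<alpha> - b powr \<alpha> \<le> \<alpha> * (a - b) * a powr (\<alpha> - 1)"
proof -
  consider "a = b" | "b = 0" "a > 0" | "0 < b" "b < a" using assms by linarith
  then show ?thesis
  proof cases
    case 2
    then have "a powr \<alpha> = 1 * (a * a powr (\<alpha> - 1))" using powr_mult_base[of a "\<alpha> - 1"] by simp
    also have "\<dots> \<le> \<alpha> * (a * a powr (\<alpha> - 1))" using assms 2 by (intro mult_right_mono) auto
    finally show ?thesis using 2 by (simp add: mult.assoc)
  next
    case 3
    have "\<exists>z>b. z < a \<and> a powr \<alpha> - b powr \<alpha> = (a - b) * (\<alpha> * z powr (\<alpha> - 1))"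
      using 3 by (intro MVT2) (auto intro!: has_real_derivative_powr)
    then obtain z where z: "b < z" "z < a" "a powr \<alpha> - b powr \<alpha> = (a - b) * (\<alpha> * z powr (\<alpha> - 1))" by blast
    have "z powr (\<alpha> - 1) \<le> a powr (\<alpha> - 1)" using z 3 assms by (intro powr_mono2) auto
    then have "(a - b) * (\<alpha> * z powr (\<alpha> - 1)) \<le> (a - b) * (\<alpha> * a powr (\<alpha> - 1))"
      using 3 assms by (intro mult_left_mono) auto
    then show ?thesis using z(3) by (simp add: ac_simps)
  qed simp
qed

lemma cesaro_increments:
  fixes b d :: "nat \<Rightarrow> real"
  assumes inc: "\<And>k. k \<ge> 1 \<Longrightarrow> b (Suc k) - b k = d k" and lim: "d \<longlonglongrightarrow> l"
  shows "(\<lambda>k. b k / real k) \<longlonglongrightarrow> l"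
proof (rule LIMSEQ_I)
  fix r :: real assume r: "0 < r"
  then obtain n where n: "\<And>k. k \<ge> n \<Longrightarrow> \<bar>d k - l\<bar> < r / 2" using LIMSEQ_D[OF lim, of "r / 2"] by auto
  define m where "m = max n 1"
  have step: "\<bar>b (m + i) - b m - real i * l\<bar> \<le> real i * (r / 2)" for i
  proof (induction i)
    case (Suc i)
    have "b (m + Suc i) - b (m + i) = d (m + i)" using inc[of "m + i"] by (simp add: m_def)
    then have "\<bar>b (m + Suc i) - b m - real (Suc i) * l\<bar> \<le> \<bar>b (m + i) - b m - real i * l\<bar> + \<bar>d (m + i) - l\<bar>"
      by (simp add: algebra_simps)
    also have "\<dots> \<le> real i * (r / 2) + r / 2"
    proof -
      have "\<bar>d (m + i) - l\<bar> < r / 2" by (rule n) (auto simp: m_def)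
      then show ?thesis using Suc by linarith
    qed
    also have "\<dots> = real (Suc i) * (r / 2)" by (simp add: algebra_simps)
    finally show ?case .
  qed simp
  define c where "c = \<bar>b m - real m * l\<bar>"
  obtain k0 where k0: "2 * c / r < real k0" using reals_Archimedean2 by blast
  show "\<exists>no. \<forall>k\<ge>no. norm (b k / real k - l) < r"
  proof (intro exI allI impI)
    fix k assume k: "max k0 m + 1 \<le> k"
    then obtain i where i: "k = m + i" using le_Suc_ex by (metis add_leE max.bounded_iff)
    have kpos: "real k > 0" using k by simp
    have "\<bar>b k - real k * l\<bar> \<le> real i * (r / 2) + c"
    proof -
      have "b k - real k * l = (b (m + i) - b m - real i * l) + (b m - real m * l)"
        by (simp add: i algebra_simps)
      then show ?thesis using step[of i] unfolding c_def by linarith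
    qed
    also have "\<dots> \<le> real k * (r / 2) + c" using i r by simp
    also have "c < real k * (r / 2)"
    proof -
      have "2 * c / r < real k" using k0 k by linarith
      then show ?thesis using r by (simp add: field_simps)
    qed
    finally have "\<bar>b k - real k * l\<bar> < real k * r" by (simp add: mult.commute)
    moreover have "b k / real k - l = (b k - real k * l) / real k" using kpos by (simp add: field_simps)
    ultimately show "norm (b k / real k - l) < r" using kpos by (simp add: divide_less_eq mult.commute)
  qed
qed

lemma nn_integral_int_reindex:
  fixes f :: "int \<Rightarrow> ennreal"
  shows "bij g \<Longrightarrow> (\<integral>\<^sup>+j. f (g j) \<partial>count_space UNIV) = (\<integral>\<^sup>+j. f j \<partial>count_space UNIV)"
  by (rule nn_integral_bij_count_space)

lemma bij_uminus_int: "bij (uminus :: int \<Rightarrow> int)"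
  by (rule o_bij[of uminus]) auto

lemma sum_ennreal_max: "(\<Sum>j\<in>S. ennreal (f j)) = ennreal (\<Sum>j\<in>S. max 0 (f j))"
proof -
  have "(\<Sum>j\<in>S. ennreal (f j)) = (\<Sum>j\<in>S. ennreal (max 0 (f j)))"
    by (rule sum.cong) (auto simp: max_def ennreal_neg)
  also have "\<dots> = ennreal (\<Sum>j\<in>S. max 0 (f j))" by (rule sum_ennreal) simp
  finally show ?thesis .
qed

lemma l1_norm_shift: "l1_norm N (shift j x) = l1_norm N x"
  unfolding l1_norm_nn_integral shift_nth
  by (rule nn_integral_int_reindex) (auto intro!: bij_betwI[of _ _ _ "\<lambda>i. i + j"])

lemma l1_norm_scale:
  assumes "is_norm N" "0 \<le> c"
  shows "l1_norm N (scale_seq c x) = ennreal c * l1_norm N x"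
  unfolding l1_norm_nn_integral using assms
  by (subst nn_integral_cmult[symmetric]) (auto intro!: nn_integral_cong simp: is_norm_def ennreal_mult)

lemma l1_norm_window_tendsto_0:
  assumes "N 0 = 0" "l1_norm N x < \<top>" "\<And>j. \<forall>\<^sub>F n in sequentially. j \<notin> S n"
  shows "(\<lambda>n. l1_norm N (window (S n) x)) \<longlonglongrightarrow> 0"
proof -
  have "(\<lambda>n. \<integral>\<^sup>+j. ennreal (N (window (S n) x j)) \<partial>count_space UNIV) \<longlonglongrightarrow> (\<integral>\<^sup>+(j::int). 0 \<partial>count_space UNIV)"
  proof (rule nn_integral_dominated_convergence[where w="\<lambda>j. ennreal (N (x j))"])
    show "AE j in count_space UNIV. ennreal (N (window (S n) x j)) \<le> ennreal (N (x j))" for n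
      using assms(1) by (auto simp: window_nth)
    show "AE j in count_space UNIV. (\<lambda>n. ennreal (N (window (S n) x j))) \<longlonglongrightarrow> 0"
    proof (rule AE_I2)
      fix j :: int
      show "(\<lambda>n. ennreal (N (window (S n) x j))) \<longlonglongrightarrow> 0"
        by (rule tendsto_eventually, rule eventually_mono[OF assms(3)[of j]]) (simp add: window_nth assms(1))
    qed
  qed (use assms(2) in \<open>auto simp: l1_norm_nn_integral\<close>)
  then show ?thesis by (simp add: l1_norm_nn_integral)
qed

lemma l1_norm_window_mono:
  assumes "N 0 = 0" "S \<subseteq> T"
  shows "l1_norm N (window S x) \<le> l1_norm N (window T x)"
  unfolding l1_norm_nn_integral using assms
  by (intro nn_integral_mono) (auto simp: window_nth)

lemma window_UNIV [simp]: "window UNIV x = x" by (simp add: window_def)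

locale lipschitz_functional_setting =
  anchored_setting N \<alpha> M X P Y \<nu>fin \<nu> PQ Q + tail_functional_setting N \<alpha> M X P Y \<nu>fin \<nu> H C
  for N :: "real ^ 'd \<Rightarrow> real" and \<alpha> :: real and M :: "'w measure" and X
    and P :: "'v measure" and Y and \<nu>fin \<nu> and PQ :: "'q measure" and Q and H C +
  assumes lipschitz: "\<And>x y. ennreal \<bar>H x - H y\<bar> \<le> ennreal C * l1_norm N (\<lambda>j. x j - y j)"
    and moment: "\<alpha> > 1 \<Longrightarrow>
      (\<integral>\<^sup>+ w. ennreal_powr (l1_norm N (window {0..} (spectral N (Y w)))) (\<alpha> - 1) \<partial>P) < \<infinity>"
begin

abbreviation L :: "(int \<Rightarrow> real ^ 'd) \<Rightarrow> ennreal" where "L \<equiv> l1_norm N"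
abbreviation K :: "(int \<Rightarrow> real ^ 'd) \<Rightarrow> real" where "K \<equiv> pos_powr H \<alpha>"

lemma borel_measurable_l1_norm [measurable]: "L \<in> borel_measurable borel"
  unfolding l1_norm_nn_integral[abs_def] by measurable

lemma borel_measurable_ennreal_powr [measurable]: "(\<lambda>x. ennreal_powr x a) \<in> borel_measurable borel"
  unfolding ennreal_powr_def[abs_def] by measurable

lemma K_nonneg [simp]: "0 \<le> K x" by (simp add: pos_powr_def)
lemma K_shift: "K (shift j x) = K x" by (simp add: pos_powr_def H_shift)
lemma K_scale: "c > 0 \<Longrightarrow> K (scale_seq c x) = c powr \<alpha> * K x"
proof -
  assume c: "c > 0"
  have "max (c * H x) 0 = c * max (H x) 0" using c by (simp add: max_mult_distrib_left)
  then show ?thesis using c by (simp add: pos_powr_def H_scale powr_mult)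
qed

lemma H_le: assumes "L x < \<top>" shows "\<bar>H x\<bar> \<le> C * enn2real (L x)"
proof -
  have "ennreal \<bar>H x\<bar> \<le> ennreal (C * enn2real (L x))"
    using H_bound[of x] C assms by (simp add: ennreal_mult)
  then show ?thesis using C by (subst (asm) ennreal_le_iff) auto
qed

lemma H_diff_le:
  assumes "(\<lambda>j. x j - y j) = z" "L z < \<top>" shows "\<bar>H x - H y\<bar> \<le> C * enn2real (L z)"
proof -
  have "ennreal \<bar>H x - H y\<bar> \<le> ennreal (C * enn2real (L z))"
    using lipschitz[of x y] C assms by (simp add: ennreal_mult)
  then show ?thesis using C by (subst (asm) ennreal_le_iff) auto
qed

lemma K_tendsto: "(\<lambda>n. H (x n)) \<longlonglongrightarrow> H y \<Longrightarrow> (\<lambda>n. K (x n)) \<longlonglongrightarrow> K y"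
  unfolding pos_powr_def using alpha by (intro tendsto_powr' tendsto_max tendsto_const) auto

lemma K_window_tendsto:
  assumes fin: "L (window T x) < \<top>" and S: "\<And>n. S n \<subseteq> T" "\<And>j. j \<in> T \<Longrightarrow> \<forall>\<^sub>F n in sequentially. j \<in> S n"
  shows "(\<lambda>n. K (window (S n) x)) \<longlonglongrightarrow> K (window T x)"
proof (rule K_tendsto)
  have z: "L (window (T - S n) x) < \<top>" for n
    by (rule le_less_trans[OF l1_norm_window_mono fin]) auto
  have "(\<lambda>n. L (window (T - S n) (window T x))) \<longlonglongrightarrow> 0"
  proof (rule l1_norm_window_tendsto_0[OF _ fin])
    fix j show "\<forall>\<^sub>F n in sequentially. j \<notin> T - S n"
      using S(2)[of j] by (cases "j \<in> T") (auto elim: eventually_mono)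
  qed simp
  moreover have "window (T - S n) (window T x) = window (T - S n) x" for n
    by (simp add: window_window Int_absorb2)
  ultimately have "(\<lambda>n. L (window (T - S n) x)) \<longlonglongrightarrow> 0" by simp
  then have "(\<lambda>n. C * enn2real (L (window (T - S n) x))) \<longlonglongrightarrow> C * enn2real 0"
    by (intro tendsto_mult tendsto_const tendsto_enn2real) auto
  then have lim0: "(\<lambda>n. C * enn2real (L (window (T - S n) x))) \<longlonglongrightarrow> 0" by simp
  have bnd: "norm (H (window (S n) x) - H (window T x)) \<le> C * enn2real (L (window (T - S n) x))" for n
  proof -
    have "(\<lambda>j. window T x j - window (S n) x j) = window (T - S n) x"
      using S(1)[of n] by (auto simp: window_def fun_eq_iff)
    from H_diff_le[OF this z] show ?thesis by (simp add: abs_minus_commute)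
  qed
  have "(\<lambda>n. H (window (S n) x) - H (window T x)) \<longlonglongrightarrow> 0"
    by (rule Lim_null_comparison[OF always_eventually[OF allI[OF bnd]] lim0])
  then show "(\<lambda>n. H (window (S n) x)) \<longlonglongrightarrow> H (window T x)" by (simp add: LIM_zero_iff)
qed

definition dominating :: "(int \<Rightarrow> real ^ 'd) \<Rightarrow> real" where
  "dominating x = (if \<alpha> \<le> 1 then C powr \<alpha> else \<alpha> * C powr \<alpha> * enn2real (L (window {0..} x)) powr (\<alpha> - 1))"

text \<open>
  Removing the coordinate \<open>0\<close>, of norm \<open>1\<close>, changes \<open>H\<close> by at most \<open>C\<close>. For \<open>\<alpha> \<le> 1\<close> use subadditivity
  of \<open>t\<^sup>\<alpha>\<close>; for \<open>\<alpha> > 1\<close> the mean value theorem, with \<open>|H|\<close> bounded by \<open>C\<close> times the \<open>\<ell>\<^sup>1\<close> norm.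
\<close>

lemma increment_le_dominating:
  assumes x0: "N (x 0) = 1" and A: "0 \<in> A" "A \<subseteq> {0..}" and fin: "\<alpha> > 1 \<Longrightarrow> L (window {0..} x) < \<top>"
  shows "\<bar>K (window A x) - K (window (A - {0}) x)\<bar> \<le> dominating x"
proof -
  define a where "a = max (H (window A x)) 0"
  define b where "b = max (H (window (A - {0}) x)) 0"
  have nn: "a \<ge> 0" "b \<ge> 0" by (simp_all add: a_def b_def)
  have d: "(\<lambda>j. window A x j - window (A - {0}) x j) = window {0} x"
    using A by (auto simp: window_def fun_eq_iff)
  have L1: "L (window {0} x) = 1" by (simp add: l1_norm_window_finite x0)
  have "\<bar>H (window A x) - H (window (A - {0}) x)\<bar> \<le> C" using H_diff_le[OF d] L1 by simp
  then have ab: "\<bar>a - b\<bar> \<le> C" by (auto simp: a_def b_def)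
  have main: "u powr \<alpha> - v powr \<alpha> \<le> dominating x"
    if uv: "0 \<le> v" "v \<le> u" "u - v \<le> C" and u: "\<alpha> > 1 \<Longrightarrow> u \<le> C * enn2real (L (window {0..} x))" for u v
  proof (cases "\<alpha> \<le> 1")
    case True
    have "u powr \<alpha> - v powr \<alpha> \<le> (u - v) powr \<alpha>" using uv alpha True by (intro powr_diff_le_concave)
    also have "\<dots> \<le> C powr \<alpha>" using uv alpha by (intro powr_mono2) auto
    finally show ?thesis using True by (simp add: dominating_def)
  next
    case False
    have "u powr \<alpha> - v powr \<alpha> \<le> \<alpha> * (u - v) * u powr (\<alpha> - 1)"
      using uv False by (intro powr_diff_le_convex) auto
    also have "\<dots> \<le> \<alpha> * C * (C * enn2real (L (window {0..} x))) powr (\<alpha> - 1)"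
      using uv u alpha False C by (intro mult_mono powr_mono2) auto
    also have "\<dots> = \<alpha> * (C * C powr (\<alpha> - 1)) * enn2real (L (window {0..} x)) powr (\<alpha> - 1)"
      using C by (simp add: powr_mult)
    also have "C * C powr (\<alpha> - 1) = C powr \<alpha>" using powr_mult_base[of C "\<alpha> - 1"] C by simp
    finally show ?thesis using False by (simp add: dominating_def)
  qed
  have le: "max (H (window B x)) 0 \<le> C * enn2real (L (window {0..} x))" if "\<alpha> > 1" "B \<subseteq> {0..}" for B
  proof -
    have m: "L (window B x) \<le> L (window {0..} x)" using that by (intro l1_norm_window_mono) auto
    have f: "L (window {0..} x) < \<top>" using fin that by simp
    have "\<bar>H (window B x)\<bar> \<le> C * enn2real (L (window B x))" by (rule H_le[OF le_less_trans[OF m f]])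
    also have "\<dots> \<le> C * enn2real (L (window {0..} x))"
      using C m f by (intro mult_left_mono enn2real_mono) auto
    finally have "\<bar>H (window B x)\<bar> \<le> C * enn2real (L (window {0..} x))" .
    then show ?thesis using C by auto
  qed
  have "A - {0} \<subseteq> {0..}" using A by auto
  then have leb: "b \<le> C * enn2real (L (window {0..} x))" if "\<alpha> > 1"
    unfolding b_def by (rule le[OF that])
  have lea: "a \<le> C * enn2real (L (window {0..} x))" if "\<alpha> > 1"
    unfolding a_def by (rule le[OF that A(2)])
  have "a powr \<alpha> - b powr \<alpha> \<le> dominating x" if "b \<le> a"
    by (rule main) (use that nn ab lea in auto)
  moreover have "b powr \<alpha> - a powr \<alpha> \<le> dominating x" if "a \<le> b"
    by (rule main) (use that nn ab leb in auto)
  moreover have "K (window A x) = a powr \<alpha>" "K (window (A - {0}) x) = b powr \<alpha>"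
    by (simp_all add: pos_powr_def a_def b_def)
  moreover have "a powr \<alpha> \<le> b powr \<alpha> \<or> b powr \<alpha> \<le> a powr \<alpha>" by linarith
  moreover have "a \<le> b \<Longrightarrow> a powr \<alpha> \<le> b powr \<alpha>" "b \<le> a \<Longrightarrow> b powr \<alpha> \<le> a powr \<alpha>"
    using nn alpha by (auto intro: powr_mono2)
  ultimately show ?thesis by (cases "a \<le> b") auto
qed

text \<open>
  For \<open>\<alpha> \<le> 1\<close>, transporting \<open>G(y) = |y\<^sub>0|\<^sup>\<alpha>\<close> gives \<open>\<theta> E \<Sum>\<^sub>j |Q\<^sub>j|\<^sup>\<alpha> = 1\<close>, and \<open>|Q\<^sub>j| \<le> |Q\<^sub>j|\<^sup>\<alpha>\<close>. For \<open>\<alpha> > 1\<close>,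
  transporting \<open>G(y) = |y\<^sub>0| (\<Sum>\<^bsub>j\<ge>0\<^esub> |y\<^sub>j|)\<^bsup>\<alpha>-1\<^esup>\<close> turns the moment condition into
  \<open>\<Sum>\<^sub>i |Q\<^sub>i| (\<Sum>\<^bsub>j\<ge>i\<^esub> |Q\<^sub>j|)\<^bsup>\<alpha>-1\<^esup> < \<infinity>\<close> almost surely. As \<open>Q\<^sub>0 \<noteq> 0\<close>, the term \<open>i = 0\<close> bounds the future of \<open>Q\<close>;
  for \<open>i \<le> 0\<close> the inner sums are at least \<open>|Q\<^sub>0|\<close>, which bounds the past.
\<close>

lemma AE_Q_l1: "AE w in PQ. L (Q w) < \<top>"
proof -
  have Q1: "AE w in PQ. Q w 0 \<noteq> 0 \<and> (\<forall>j. N (Q w j) \<le> 1)"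
  proof (rule AE_Q)
    show "AE w in P. scale_seq (1 / peak (Y w)) (Y w) 0 \<noteq> 0 \<and> (\<forall>j. N (scale_seq (1 / peak (Y w)) (Y w) j) \<le> 1)"
      using AE_vanishing AE_Y0
    proof eventually_elim
      case (elim w)
      have "peak (Y w) > 1" using le_peak[OF elim(1), of 0] elim(2) by simp
      moreover have "Y w 0 \<noteq> 0" using elim(2) by auto
      ultimately show ?case using le_peak[OF elim(1)] by (auto simp: N_scale)
    qed
  qed measurable
  show ?thesis
  proof (cases "\<alpha> \<le> 1")
    case True
    define G where "G y = ennreal (N (y 0) powr \<alpha>)" for y :: "int \<Rightarrow> real ^ 'd"
    have [measurable]: "G \<in> borel_measurable borel" unfolding G_def by measurable
    have "(\<integral>\<^sup>+w. G (\<Theta> w) \<partial>P) = \<theta> * (\<integral>\<^sup>+w. orbit_sum G (Q w) \<partial>PQ)"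
      using alpha by (intro mass_transport) (auto simp: G_def N_scale powr_mult ennreal_mult)
    moreover have "(\<integral>\<^sup>+w. G (\<Theta> w) \<partial>P) = (\<integral>\<^sup>+w. 1 \<partial>P)"
      using AE_Y0 by (intro nn_integral_cong_AE) (auto simp: G_def N_spectral_0 elim!: eventually_mono)
    ultimately have "(\<integral>\<^sup>+w. orbit_sum G (Q w) \<partial>PQ) \<noteq> \<infinity>"
      using \<theta>_nonzero by (auto simp: P.emeasure_space_1 ennreal_mult_eq_top_iff)
    then have "AE w in PQ. (orbit_sum G (Q w)) \<noteq> \<infinity>"
      by (intro nn_integral_noteq_infinite) auto
    with Q1 show ?thesis
    proof eventually_elim
      case (elim w)
      have "L (Q w) \<le> (\<integral>\<^sup>+j. ennreal (N (Q w j) powr \<alpha>) \<partial>count_space UNIV)"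
        unfolding l1_norm_nn_integral
      proof (intro nn_integral_mono ennreal_leI)
        fix j
        show "N (Q w j) \<le> N (Q w j) powr \<alpha>"
          using powr_mono'[of \<alpha> 1 "N (Q w j)"] elim(1) True by (cases "Q w j = 0") auto
      qed
      also have "\<dots> = (orbit_sum G (Q w))"
        using nn_integral_int_reindex[OF bij_uminus_int, of "\<lambda>j. ennreal (N (Q w j) powr \<alpha>)"] unfolding G_def by simp
      finally show ?case using elim(2) by (auto simp: less_top top_unique)
    qed
  next
    case False
    define G where "G y = ennreal (N (y 0)) * ennreal_powr (L (window {0..} y)) (\<alpha> - 1)" for y :: "int \<Rightarrow> real ^ 'd"
    have [measurable]: "G \<in> borel_measurable borel" unfolding G_def by measurable
    have pscale: "ennreal_powr (ennreal c * t) a = ennreal (c powr a) * ennreal_powr t a" if "c > 0" for c t a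
      using that by (cases t) (auto simp: ennreal_powr_def ennreal_mult_top powr_mult simp flip: ennreal_mult)
    have "(\<integral>\<^sup>+w. G (\<Theta> w) \<partial>P) = \<theta> * (\<integral>\<^sup>+w. orbit_sum G (Q w) \<partial>PQ)"
    proof (rule mass_transport)
      fix c :: real and y assume c: "c > 0"
      have "ennreal (c powr \<alpha>) = ennreal c * ennreal (c powr (\<alpha> - 1))"
        using powr_mult_base[of c "\<alpha> - 1"] c by (simp flip: ennreal_mult)
      then show "G (scale_seq c y) = ennreal (c powr \<alpha>) * G y"
        using c norm by (simp add: G_def N_scale window_scale_seq l1_norm_scale pscale ennreal_mult ac_simps del: scale_seq_nth)
          (simp add: N_scale ennreal_mult ac_simps)
    qed (auto simp: G_def)
    moreover have "(\<integral>\<^sup>+w. G (\<Theta> w) \<partial>P) < \<infinity>"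
    proof -
      have "(\<integral>\<^sup>+w. G (\<Theta> w) \<partial>P) = (\<integral>\<^sup>+w. ennreal_powr (L (window {0..} (\<Theta> w))) (\<alpha> - 1) \<partial>P)"
        using AE_Y0 by (intro nn_integral_cong_AE) (auto simp: G_def N_spectral_0 elim!: eventually_mono)
      then show ?thesis using moment False by simp
    qed
    ultimately have "(\<integral>\<^sup>+w. orbit_sum G (Q w) \<partial>PQ) \<noteq> \<infinity>"
      using \<theta>_nonzero by (auto simp: ennreal_mult_eq_top_iff)
    then have "AE w in PQ. (orbit_sum G (Q w)) \<noteq> \<infinity>"
      by (intro nn_integral_noteq_infinite) auto
    with Q1 show ?thesis
    proof eventually_elim
      case (elim w)
      let ?q = "Q w"
      let ?S = "orbit_sum G ?q"
      have q: "N (?q 0) > 0" using elim(1) N_nonneg[of "?q 0"] by (auto simp: less_le)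
      have ge: "G (shift j ?q) \<le> ?S" for j
        using nn_integral_ge_point[of j UNIV "\<lambda>j. G (shift j ?q)"] by simp
      have fin0: "L (window {0..} ?q) < \<top>"
      proof (rule ccontr)
        assume "\<not> ?thesis"
        then have "G ?q = \<top>" using elim(1) by (simp add: G_def ennreal_powr_def less_top ennreal_mult_top)
        then show False using ge[of 0] elim(2) by (simp add: top_unique)
      qed
      \<comment> \<open>lower bound of the inner sums, to the power \<open>\<alpha> - 1\<close>, for \<open>i \<le> 0\<close>\<close>
      define c where "c = N (?q 0) powr (\<alpha> - 1)"
      have c: "c > 0" using elim(1) by (simp add: c_def)
      have lower: "ennreal c * ennreal (N (?q (- j))) \<le> G (shift j ?q)" if "j \<ge> 0" for j
      proof -
        have "ennreal (N (window {0..} (shift j ?q) j)) \<le> L (window {0..} (shift j ?q))"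
          unfolding l1_norm_nn_integral
          using nn_integral_ge_point[of j UNIV "\<lambda>i. ennreal (N (window {0..} (shift j ?q) i))"] by simp
        then have *: "ennreal (N (?q 0)) \<le> L (window {0..} (shift j ?q))" using that by (simp add: window_nth)
        have "ennreal c \<le> ennreal_powr (L (window {0..} (shift j ?q))) (\<alpha> - 1)"
        proof (cases "L (window {0..} (shift j ?q))")
          case (real t)
          then have "N (?q 0) \<le> t" using * by (simp add: ennreal_le_iff)
          then have "c \<le> t powr (\<alpha> - 1)" unfolding c_def using False q by (intro powr_mono2) auto
          then show ?thesis using real by (simp add: ennreal_powr_def ennreal_leI)
        qed (simp add: ennreal_powr_def)
        then have "ennreal c * ennreal (N (?q (- j)))
            \<le> ennreal_powr (L (window {0..} (shift j ?q))) (\<alpha> - 1) * ennreal (N (?q (- j)))"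
          by (rule mult_right_mono) simp
        then show ?thesis unfolding G_def by (simp add: mult.commute)
      qed
      have "ennreal c * L ?q \<le> (\<integral>\<^sup>+i. ennreal c * ennreal (N (window {0..} ?q i)) + G (shift (- i) ?q) \<partial>count_space UNIV)"
        unfolding l1_norm_nn_integral
      proof (subst nn_integral_cmult[symmetric], simp, intro nn_integral_mono)
        fix i
        show "ennreal c * ennreal (N (?q i)) \<le> ennreal c * ennreal (N (window {0..} ?q i)) + G (shift (- i) ?q)"
          using lower[of "- i"] by (cases "i \<ge> 0") (auto simp: window_nth)
      qed
      also have "\<dots> = ennreal c * L (window {0..} ?q) + (\<integral>\<^sup>+i. G (shift (- i) ?q) \<partial>count_space UNIV)"
        unfolding l1_norm_nn_integral by (subst nn_integral_add) (auto simp: nn_integral_cmult)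
      also have "(\<integral>\<^sup>+i. G (shift (- i) ?q) \<partial>count_space UNIV) = ?S"
        using nn_integral_int_reindex[OF bij_uminus_int, of "\<lambda>j. G (shift j ?q)"] by simp
      also have "ennreal c * L (window {0..} ?q) + ?S < \<top>"
        using fin0 elim(2) by (simp add: ennreal_mult_less_top less_top)
      finally have "ennreal c * L ?q < \<top>" .
      then show ?case using c by (auto simp: ennreal_mult_less_top)
    qed
  qed
qed

text \<open>
  For \<open>\<alpha> > 1\<close> this is contained in the moment condition. For \<open>\<alpha> \<le> 1\<close> it is transported from \<open>Q\<close>, with
  \<open>G(y) = |y\<^sub>0|\<^sup>\<alpha>\<close> restricted to the sequences that are not summable, a shift invariant set.
\<close>

lemma AE_spectral_l1: "AE w in P. L (window {0..} (\<Theta> w)) < \<top>"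
proof (cases "\<alpha> \<le> 1")
  case False
  then have "AE w in P. ennreal_powr (L (window {0..} (\<Theta> w))) (\<alpha> - 1) \<noteq> \<infinity>"
    using moment by (intro nn_integral_noteq_infinite) auto
  then show ?thesis by eventually_elim (auto simp: ennreal_powr_def less_top[symmetric])
next
  case True
  define G where "G y = ennreal (N (y 0) powr \<alpha>) * (if L y = \<top> then 1 else 0)" for y
  have [measurable]: "G \<in> borel_measurable borel" unfolding G_def[abs_def] by measurable
  have "(\<integral>\<^sup>+w. G (\<Theta> w) \<partial>P) = \<theta> * (\<integral>\<^sup>+w. orbit_sum G (Q w) \<partial>PQ)"
  proof (rule mass_transport)
    fix c :: real and y assume c: "c > 0"
    then have "L (scale_seq c y) = \<top> \<longleftrightarrow> L y = \<top>"
      using norm by (simp add: l1_norm_scale ennreal_mult_eq_top_iff)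
    then show "G (scale_seq c y) = ennreal (c powr \<alpha>) * G y"
      using c by (simp add: G_def N_scale powr_mult ennreal_mult)
  qed (use alpha in \<open>auto simp: G_def\<close>)
  also have "(\<integral>\<^sup>+w. orbit_sum G (Q w) \<partial>PQ) = (\<integral>\<^sup>+w. 0 \<partial>PQ)"
  proof (rule nn_integral_cong_AE)
    show "AE w in PQ. (orbit_sum G (Q w)) = 0"
      using AE_Q_l1 by eventually_elim (auto simp: G_def l1_norm_shift)
  qed
  finally have "(\<integral>\<^sup>+w. G (\<Theta> w) \<partial>P) = 0" by simp
  then have "AE w in P. G (\<Theta> w) = 0" by (subst (asm) nn_integral_0_iff_AE) auto
  with AE_Y0 show ?thesis
  proof eventually_elim
    case (elim w)
    then have "L (\<Theta> w) \<noteq> \<top>" using N_spectral_0[of "Y w"] by (auto simp: G_def)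
    then have "L (window UNIV (\<Theta> w)) < \<top>" by (simp add: less_top)
    then show ?case by (rule le_less_trans[rotated]) (intro l1_norm_window_mono, auto)
  qed
qed

lemma dominating_integrable: "integrable P (\<lambda>w. dominating (\<Theta> w))"
proof (cases "\<alpha> \<le> 1")
  case True
  then show ?thesis by (simp add: dominating_def)
next
  case False
  have "integrable P (\<lambda>w. enn2real (L (window {0..} (\<Theta> w))) powr (\<alpha> - 1))"
  proof (rule integrableI_nonneg)
    have "(\<integral>\<^sup>+w. ennreal (enn2real (L (window {0..} (\<Theta> w))) powr (\<alpha> - 1)) \<partial>P)
       = (\<integral>\<^sup>+w. ennreal_powr (L (window {0..} (\<Theta> w))) (\<alpha> - 1) \<partial>P)"
      using AE_spectral_l1 by (intro nn_integral_cong_AE) (auto simp: ennreal_powr_def elim!: eventually_mono)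
    then show "(\<integral>\<^sup>+w. ennreal (enn2real (L (window {0..} (\<Theta> w))) powr (\<alpha> - 1)) \<partial>P) < \<infinity>"
      using moment False by simp
  qed auto
  then show ?thesis using False by (simp add: dominating_def)
qed

lemma borel_measurable_dominating [measurable]: "dominating \<in> borel_measurable borel"
  unfolding dominating_def[abs_def] by measurable

abbreviation gain :: "(int \<Rightarrow> real ^ 'd) \<Rightarrow> real" where
  "gain y \<equiv> K (window {0..} y) - K (window {1..} y)"

lemma windows_0: "{0..k::int} - {0} = {1..k}" "{0::int..} - {0} = {1..}" by auto

lemma gain_integrable: "integrable P (\<lambda>w. gain (\<Theta> w))"
proof (rule Bochner_Integration.integrable_bound[OF dominating_integrable])
  show "AE w in P. norm (gain (\<Theta> w)) \<le> norm (dominating (\<Theta> w))"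
    using AE_spectral_l1 AE_Y0
  proof eventually_elim
    case (elim w)
    have "\<bar>K (window {0..} (\<Theta> w)) - K (window ({0..} - {0}) (\<Theta> w))\<bar> \<le> dominating (\<Theta> w)"
      by (rule increment_le_dominating) (use elim N_spectral_0[of "Y w"] in auto)
    then show ?case by (simp add: windows_0)
  qed
qed measurable

lemma increments_tendsto:
  "(\<lambda>k. LINT w|P. block_gain (int k) (\<Theta> w)) \<longlonglongrightarrow> (LINT w|P. gain (\<Theta> w))"
proof (rule integral_dominated_convergence[OF _ _ dominating_integrable])
  show "AE w in P. norm (block_gain (int k) (\<Theta> w)) \<le> dominating (\<Theta> w)" for k
    using AE_spectral_l1 AE_Y0
  proof eventually_elim
    case (elim w)
    have "\<bar>K (window {0..int k} (\<Theta> w)) - K (window ({0..int k} - {0}) (\<Theta> w))\<bar> \<le> dominating (\<Theta> w)"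
      by (rule increment_le_dominating) (use elim N_spectral_0[of "Y w"] in auto)
    then show ?case by (simp add: windows_0)
  qed
  show "AE w in P. (\<lambda>k. block_gain (int k) (\<Theta> w)) \<longlonglongrightarrow> gain (\<Theta> w)"
    using AE_spectral_l1
  proof eventually_elim
    case (elim w)
    have "L (window {1..} (\<Theta> w)) < \<top>"
      by (rule le_less_trans[OF _ elim]) (intro l1_norm_window_mono, auto)
    moreover have "\<forall>\<^sub>F n in sequentially. j \<in> {s..int n}" if "j \<in> {s..}" for j s
      using that by (intro eventually_sequentiallyI[of "nat j"]) auto
    ultimately show ?case using elim by (intro tendsto_diff K_window_tendsto) auto
  qed
qed measurable

lemma telescope:
  fixes k :: "int \<Rightarrow> real"
  shows "(\<Sum>j\<in>{- int n..int n}. k (- j) - k (1 - j)) = k (- int n) - k (int n + 1)"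
proof (induction n)
  case (Suc n)
  have "{- int (Suc n)..int (Suc n)} = insert (- int (Suc n)) (insert (int (Suc n)) {- int n..int n})" by auto
  then show ?case using Suc by (simp add: algebra_simps)
qed simp

text \<open>
  Shifting by \<open>j\<close> moves the windows \<open>{0..}\<close> and \<open>{1..}\<close> of the shifted sequence to \<open>{-j..}\<close> and
  \<open>{1-j..}\<close> of \<open>q\<close>, so the symmetric partial sums telescope. The positive and negative parts are kept
  on different sides, so that every term of the limit identity makes sense in \<open>[0,\<infinity>]\<close>.
\<close>

lemma sum_gain:
  assumes fin: "L q < \<top>"
  shows "(orbit_sum (\<lambda>y. ennreal (gain y)) q)
    = (orbit_sum (\<lambda>y. ennreal (- gain y)) q) + ennreal (K q)"
proof -
  define k where "k m = K (window {m..} q)" for m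
  have g: "gain (shift j q) = k (- j) - k (1 - j)" for j
  proof -
    have "{i. i + j \<in> {s..}} = {s - j..}" for s by auto
    then show ?thesis by (simp add: k_def window_shift K_shift)
  qed
  have finw: "L (window S q) < \<top>" for S
    using l1_norm_window_mono[of N S UNIV q] fin by (auto intro: le_less_trans)
  have "(\<lambda>n. K (window {- int n..} q)) \<longlonglongrightarrow> K (window UNIV q)"
  proof (rule K_window_tendsto)
    show "\<forall>\<^sub>F n in sequentially. j \<in> {- int n..}" for j
      by (intro eventually_sequentiallyI[of "nat \<bar>j\<bar>"]) auto
  qed (use fin in auto)
  then have lim1: "(\<lambda>n. k (- int n)) \<longlonglongrightarrow> K q" by (simp add: k_def)
  have lim2: "(\<lambda>n. k (int n + 1)) \<longlonglongrightarrow> 0"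
  proof -
    have "(\<lambda>n. L (window {int n + 1..} q)) \<longlonglongrightarrow> 0"
    proof (rule l1_norm_window_tendsto_0[OF _ fin])
      show "\<forall>\<^sub>F n in sequentially. j \<notin> {int n + 1..}" for j
        by (intro eventually_sequentiallyI[of "nat \<bar>j\<bar>"]) auto
    qed simp
    then have "(\<lambda>n. C * enn2real (L (window {int n + 1..} q))) \<longlonglongrightarrow> C * enn2real 0"
      by (intro tendsto_mult tendsto_const tendsto_enn2real) auto
    then have lim0: "(\<lambda>n. C * enn2real (L (window {int n + 1..} q))) \<longlonglongrightarrow> 0" by simp
    have bnd: "norm (H (window {int n + 1..} q)) \<le> C * enn2real (L (window {int n + 1..} q))" for n
      using H_le[OF finw] by simp
    have "(\<lambda>n. H (window {int n + 1..} q)) \<longlonglongrightarrow> 0"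
      by (rule Lim_null_comparison[OF always_eventually[OF allI[OF bnd]] lim0])
    moreover have H0: "H (\<lambda>_. 0) = 0" using H_le[of "\<lambda>_. 0"] by (simp add: l1_norm_nn_integral)
    ultimately have "(\<lambda>n. K (window {int n + 1..} q)) \<longlonglongrightarrow> K (\<lambda>_. 0)" by (intro K_tendsto) simp
    then show ?thesis using H0 by (simp add: k_def pos_powr_def)
  qed
  define A where "A n = (\<Sum>j\<in>{- int n..int n}. ennreal (gain (shift j q)))" for n
  define B where "B n = (\<Sum>j\<in>{- int n..int n}. ennreal (- gain (shift j q)))" for n
  have "A n + ennreal (k (int n + 1)) = B n + ennreal (k (- int n))" for n
  proof -
    have "A n = ennreal (\<Sum>j\<in>{- int n..int n}. max 0 (gain (shift j q)))"
      unfolding A_def by (rule sum_ennreal_max)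
    moreover have "B n = ennreal (\<Sum>j\<in>{- int n..int n}. max 0 (- gain (shift j q)))"
      unfolding B_def by (rule sum_ennreal_max)
    moreover have "(\<Sum>j\<in>{- int n..int n}. max 0 (gain (shift j q))) - (\<Sum>j\<in>{- int n..int n}. max 0 (- gain (shift j q)))
        = k (- int n) - k (int n + 1)"
      unfolding telescope[symmetric] sum_subtractf[symmetric] by (intro sum.cong) (auto simp: g)
    ultimately show ?thesis
      by (simp add: sum_nonneg k_def flip: ennreal_plus)
  qed
  then have eq: "(\<lambda>n. A n + ennreal (k (int n + 1))) = (\<lambda>n. B n + ennreal (k (- int n)))" by auto
  have "(\<lambda>n. A n + ennreal (k (int n + 1))) \<longlonglongrightarrow> (orbit_sum (\<lambda>y. ennreal (gain y)) q) + ennreal 0"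
    unfolding A_def by (intro tendsto_add sum_tendsto_nn_integral_count_space tendsto_ennrealI lim2)
  moreover have "(\<lambda>n. B n + ennreal (k (- int n))) \<longlonglongrightarrow> (orbit_sum (\<lambda>y. ennreal (- gain y)) q) + ennreal (K q)"
    unfolding B_def by (intro tendsto_add sum_tendsto_nn_integral_count_space tendsto_ennrealI lim1)
  ultimately show ?thesis unfolding eq using LIMSEQ_unique by fastforce
qed

lemma gain_transport:
  "integrable PQ (\<lambda>w. K (Q w))"
  "(LINT w|P. gain (\<Theta> w)) = ext_index N P Y * (LINT w|PQ. K (Q w))"
proof -
  have van: "gain y = 0" if "y 0 = 0" for y
  proof -
    have "window {0..} y = window {1..} y"
    proof
      fix i show "window {0..} y i = window {1..} y i" using that by (cases "i = 0") (auto simp: window_nth)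
    qed
    then show ?thesis by simp
  qed
  have hom: "gain (scale_seq c y) = c powr \<alpha> * gain y" if "c > 0" for c y
    using that by (simp add: window_scale_seq K_scale algebra_simps)
  have transport: "(\<integral>\<^sup>+w. ennreal (f (\<Theta> w)) \<partial>P) = \<theta> * (\<integral>\<^sup>+w. orbit_sum (\<lambda>y. ennreal (f y)) (Q w) \<partial>PQ)"
    if [measurable]: "f \<in> borel_measurable borel" and f: "f = gain \<or> f = (\<lambda>y. - gain y)" for f
  proof (rule mass_transport)
    show "ennreal (f (scale_seq c y)) = ennreal (c powr \<alpha>) * ennreal (f y)" if "c > 0" for c y
    proof -
      have "f (scale_seq c y) = c powr \<alpha> * f y" using f hom[OF that, of y] by (auto simp: algebra_simps)
      then show ?thesis by (simp add: ennreal_mult')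
    qed
    show "ennreal (f y) = 0" if "y 0 = 0" for y using f van[of y] that by auto
  qed measurable
  have tp: "(\<integral>\<^sup>+w. ennreal (gain (\<Theta> w)) \<partial>P) = \<theta> * (\<integral>\<^sup>+w. orbit_sum (\<lambda>y. ennreal (gain y)) (Q w) \<partial>PQ)"
    by (rule transport) auto
  have tn: "(\<integral>\<^sup>+w. ennreal (- gain (\<Theta> w)) \<partial>P) = \<theta> * (\<integral>\<^sup>+w. orbit_sum (\<lambda>y. ennreal (- gain y)) (Q w) \<partial>PQ)"
    by (rule transport) auto
  have "(\<integral>\<^sup>+w. orbit_sum (\<lambda>y. ennreal (gain y)) (Q w) \<partial>PQ)
     = (\<integral>\<^sup>+w. (orbit_sum (\<lambda>y. ennreal (- gain y)) (Q w)) + ennreal (K (Q w)) \<partial>PQ)"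
    using AE_Q_l1 by (intro nn_integral_cong_AE) (auto simp: sum_gain elim!: eventually_mono)
  also have "\<dots> = (\<integral>\<^sup>+w. (orbit_sum (\<lambda>y. ennreal (- gain y)) (Q w)) \<partial>PQ) + (\<integral>\<^sup>+w. ennreal (K (Q w)) \<partial>PQ)"
    by (rule nn_integral_add) measurable
  finally have eq: "(\<integral>\<^sup>+w. ennreal (gain (\<Theta> w)) \<partial>P) = (\<integral>\<^sup>+w. ennreal (- gain (\<Theta> w)) \<partial>P) + \<theta> * (\<integral>\<^sup>+w. ennreal (K (Q w)) \<partial>PQ)"
    unfolding tp tn by (simp add: distrib_left)
  have fin: "(\<integral>\<^sup>+w. ennreal (gain (\<Theta> w)) \<partial>P) < \<top>" "(\<integral>\<^sup>+w. ennreal (- gain (\<Theta> w)) \<partial>P) < \<top>"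
    using gain_integrable by (auto simp: real_integrable_def less_top)
  then have "\<theta> * (\<integral>\<^sup>+w. ennreal (K (Q w)) \<partial>PQ) < \<top>" unfolding eq by simp
  then have finK: "(\<integral>\<^sup>+w. ennreal (K (Q w)) \<partial>PQ) < \<top>"
    using \<theta>_nonzero by (auto simp: ennreal_mult_less_top)
  then show int: "integrable PQ (\<lambda>w. K (Q w))"
    by (intro integrableI_nonneg) auto
  have "(LINT w|P. gain (\<Theta> w)) = enn2real (\<integral>\<^sup>+w. ennreal (gain (\<Theta> w)) \<partial>P) - enn2real (\<integral>\<^sup>+w. ennreal (- gain (\<Theta> w)) \<partial>P)"
    by (rule real_lebesgue_integral_def[OF gain_integrable])
  also have "\<dots> = enn2real (\<theta> * (\<integral>\<^sup>+w. ennreal (K (Q w)) \<partial>PQ))"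
    unfolding eq using fin \<open>\<theta> * (\<integral>\<^sup>+w. ennreal (K (Q w)) \<partial>PQ) < \<top>\<close> by (subst enn2real_plus) auto
  also have "\<dots> = ext_index N P Y * (LINT w|PQ. K (Q w))"
    by (simp add: enn2real_mult integral_eq_nn_integral ext_index_def flip: extremal_index_past)
  finally show "(LINT w|P. gain (\<Theta> w)) = ext_index N P Y * (LINT w|PQ. K (Q w))" .
qed

end

section \<open>The growth rate of \<open>b\<^sub>k\<close>\<close>

theorem lemma3p15:
  fixes N :: "real ^ 'd \<Rightarrow> real"
    and \<alpha> C :: real
    and M :: "'w measure" and X :: "'w \<Rightarrow> int \<Rightarrow> real ^ 'd"
    and P :: "'v measure" and Y \<Theta> :: "'v \<Rightarrow> int \<Rightarrow> real ^ 'd"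
    and PQ :: "'q measure" and Q :: "'q \<Rightarrow> int \<Rightarrow> real ^ 'd"
    and \<nu>fin :: "int \<Rightarrow> int \<Rightarrow> (int \<Rightarrow> real ^ 'd) measure"
    and \<nu> :: "(int \<Rightarrow> real ^ 'd) measure"
    and H :: "(int \<Rightarrow> real ^ 'd) \<Rightarrow> real"
    and b :: "nat \<Rightarrow> real"
  assumes "is_norm N"
    and "prob_space M" and "X \<in> borel_measurable M" and "stationary M X"
    and "regularly_varying N M X \<nu>fin"
    and "\<alpha> > 0" and "tail_process N \<alpha> M X P Y"
    and "tail_measure \<nu>fin \<nu>"
    and "AE \<omega> in P. Y \<omega> \<in> ell0 N"
    and "conditional_spectral N P Y PQ Q"
    and "H \<in> borel_measurable borel"
    and "\<And>x. H (backshift x) = H x"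
    and "\<And>c x. c > 0 \<Longrightarrow> H (scale_seq c x) = c * H x"
    and "\<And>k::nat. k \<ge> 1 \<Longrightarrow> continuous_on (block {1..int k}) H"
    and "C > 0" and "\<And>x. ennreal \<bar>H x\<bar> \<le> ennreal C * l1_norm N x"
  defines "\<Theta> \<equiv> \<lambda>\<omega>. spectral N (Y \<omega>)"
    and "b \<equiv> tail_const N M X H"
  shows
    "(\<forall>k\<ge>1. (tail_ratio N M X H k \<longlongrightarrow> b k) at_top \<and>
            emeasure \<nu> {y. H (window {1..int k} y) > 1} = ennreal (b k)) \<and>
     (\<forall>k\<ge>1. integrable P (\<lambda>\<omega>. pos_powr H \<alpha> (window {0..int k} (\<Theta> \<omega>))
                             - pos_powr H \<alpha> (window {1..int k} (\<Theta> \<omega>))) \<and>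
            b (k + 1) - b k =
              (LINT \<omega>|P. pos_powr H \<alpha> (window {0..int k} (\<Theta> \<omega>))
                        - pos_powr H \<alpha> (window {1..int k} (\<Theta> \<omega>)))) \<and>
     ((\<forall>x y. ennreal \<bar>H x - H y\<bar> \<le> ennreal C * l1_norm N (\<lambda>j. x j - y j)) \<and>
      (\<alpha> > 1 \<longrightarrow>
         (\<integral>\<^sup>+ \<omega>. ennreal_powr (l1_norm N (window {0..} (\<Theta> \<omega>))) (\<alpha> - 1) \<partial>P) < \<infinity>)
      \<longrightarrow>
        integrable P (\<lambda>\<omega>. pos_powr H \<alpha> (window {0..} (\<Theta> \<omega>))
                        - pos_powr H \<alpha> (window {1..} (\<Theta> \<omega>))) \<and>
        integrable PQ (\<lambda>\<omega>. pos_powr H \<alpha> (Q \<omega>)) \<and>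
        ((\<lambda>k. b k / real k) \<longlonglongrightarrow>
           (LINT \<omega>|P. pos_powr H \<alpha> (window {0..} (\<Theta> \<omega>))
                     - pos_powr H \<alpha> (window {1..} (\<Theta> \<omega>)))) \<and>
        (LINT \<omega>|P. pos_powr H \<alpha> (window {0..} (\<Theta> \<omega>))
                  - pos_powr H \<alpha> (window {1..} (\<Theta> \<omega>)))
          = ext_index N P Y * (LINT \<omega>|PQ. pos_powr H \<alpha> (Q \<omega>)))"
proof -
  let ?gain = "\<lambda>y. pos_powr H \<alpha> (window {0..} y) - pos_powr H \<alpha> (window {1..} y)"
  interpret F: tail_functional_setting N \<alpha> M X P Y \<nu>fin \<nu> H C
    using assms(1-8,11-16)
    by (intro tail_functional_setting.intro tail_setting.intro tail_functional_setting_axioms.intro)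
  have ratio: "tail_ratio N M X H k = (\<lambda>u. measure M {\<omega> \<in> space M. H (window {1..int k} (X \<omega>)) > u} / F.p u)" for k
    by (simp add: tail_ratio_def F.p_def fun_eq_iff)
  have lim: "(tail_ratio N M X H k \<longlongrightarrow> measure \<nu> {y. H (window {1..int k} y) > 1}) at_top" if "k \<ge> 1" for k
    unfolding ratio using that by (intro F.window_functional(1)) simp
  have b: "b k = measure \<nu> {y. H (window {1..int k} y) > 1}" if "k \<ge> 1" for k
    unfolding b_def tail_const_def by (rule tendsto_Lim[OF _ lim[OF that]]) simp
  have part1: "(tail_ratio N M X H k \<longlongrightarrow> b k) at_top \<and>
      emeasure \<nu> {y. H (window {1..int k} y) > 1} = ennreal (b k)" if k: "k \<ge> 1" for k
  proof
    show "(tail_ratio N M X H k \<longlongrightarrow> b k) at_top" using lim[OF k] b[OF k] by simp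
    have "emeasure \<nu> {y. H (window {1..int k} y) > 1} < \<infinity>" using k by (intro F.window_functional(2)) simp
    then show "emeasure \<nu> {y. H (window {1..int k} y) > 1} = ennreal (b k)"
      by (simp add: b[OF k] emeasure_eq_ennreal_measure less_top)
  qed
  have part2: "integrable P (\<lambda>\<omega>. F.block_gain (int k) (\<Theta> \<omega>)) \<and>
      b (k + 1) - b k =
        (LINT \<omega>|P. F.block_gain (int k) (\<Theta> \<omega>))"
    if k: "k \<ge> 1" for k
  proof
    have k': "1 \<le> int k" using k by simp
    show "integrable P (\<lambda>\<omega>. F.block_gain (int k) (\<Theta> \<omega>))"
      unfolding \<Theta>_def by (rule F.block_increment(1)[OF k'])
    have "b (k + 1) = measure \<nu> {y. H (window {0..int k} y) > 1}"
      using F.measure_window_shift[of 0 "int k" 1] b[of "k + 1"] by (simp add: add.commute)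
    then show "b (k + 1) - b k =
        (LINT \<omega>|P. F.block_gain (int k) (\<Theta> \<omega>))"
      unfolding \<Theta>_def using F.block_increment(2)[OF k'] b[OF k] by simp
  qed
  have part3: "integrable P (\<lambda>\<omega>. ?gain (\<Theta> \<omega>)) \<and>
        integrable PQ (\<lambda>\<omega>. pos_powr H \<alpha> (Q \<omega>)) \<and>
        ((\<lambda>k. b k / real k) \<longlonglongrightarrow>
           (LINT \<omega>|P. ?gain (\<Theta> \<omega>))) \<and>
        (LINT \<omega>|P. ?gain (\<Theta> \<omega>))
          = ext_index N P Y * (LINT \<omega>|PQ. pos_powr H \<alpha> (Q \<omega>))"
    if lip: "\<forall>x y. ennreal \<bar>H x - H y\<bar> \<le> ennreal C * l1_norm N (\<lambda>j. x j - y j)"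
      and mom: "\<alpha> > 1 \<longrightarrow> (\<integral>\<^sup>+ \<omega>. ennreal_powr (l1_norm N (window {0..} (\<Theta> \<omega>))) (\<alpha> - 1) \<partial>P) < \<infinity>"
  proof -
    interpret G: lipschitz_functional_setting N \<alpha> M X P Y \<nu>fin \<nu> PQ Q H C
      using F.tail_setting_axioms F.tail_functional_setting_axioms assms(9,10) lip mom
      unfolding \<Theta>_def
      by (intro lipschitz_functional_setting.intro anchored_setting.intro anchored_setting_axioms.intro
          lipschitz_functional_setting_axioms.intro) auto
    have "(\<lambda>k. b k / real k) \<longlonglongrightarrow>
        (LINT \<omega>|P. ?gain (\<Theta> \<omega>))"
    proof (rule cesaro_increments)
      show "b (Suc k) - b k =
          (LINT \<omega>|P. F.block_gain (int k) (\<Theta> \<omega>))" if "1 \<le> k" for k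
        using part2[OF that] by simp
    qed (unfold \<Theta>_def, rule G.increments_tendsto)
    then show ?thesis
      using G.gain_integrable G.gain_transport unfolding \<Theta>_def by blast
  qed
  show ?thesis using part1 part2 part3 by blast
qed

end
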